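(* Let $\mathbb{X}\subseteq\mathbb{P}^n$ be a $0$-dimensional scheme. The Koszul complex $$0\longrightarrow \Omega^{n+1}_{R_{\mathbb{X}}/K}\stackrel{\gamma}{\longrightarrow}\Omega^{n}_{R_{\mathbb{X}}/K}\longrightarrow\cdots\longrightarrow\Omega^2_{R_{\mathbb{X}}/K}\stackrel{\gamma}{\longrightarrow}\Omega^1_{R_{\mathbb{X}}/K}\stackrel{\gamma}{\longrightarrow}\mathfrak{m}_{\mathbb{X}}\longrightarrow 0$$ is an exact sequence of graded $R_{\mathbb{X}}$-modules.
   Context: $K$ is a field of characteristic zero, $S=K[X_0,\dots,X_n]$ ($n\ge 1$) with the standard grading is the homogeneous coordinate ring of $\mathbb{P}^n$ over $K$. For a $0$-dimensional subscheme $\mathbb{X}\subseteq\mathbb{P}^n$, $I_{\mathbb{X}}\subseteq S$ is its saturated homogeneous vanishing ideal, $R_{\mathbb{X}}=S/I_{\mathbb{X}}$, $x_i$ is the image of $X_i$ in $R_{\mathbb{X}}$, and $\mathfrak{m}_{\mathbb{X}}=\langle x_0,\dots,x_n\rangle$ is the homogeneous maximal ideal. $\Omega^1_{R_{\mathbb{X}}/K}$ is the module of Kähler differentials of $R_{\mathbb{X}}/K$ with universal derivation $d$, a graded $R_{\mathbb{X}}$-module with $\deg(dx_i)=1$, and $\Omega^m_{R_{\mathbb{X}}/K}=\bigwedge^m_{R_{\mathbb{X}}}\Omega^1_{R_{\mathbb{X}}/K}$. The map $\gamma:\Omega^1_{R_{\mathbb{X}}/K}\to R_{\mathbb{X}}$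 is the unique homogeneous $R_{\mathbb{X}}$-linear map with $\gamma(df)=\deg(f)\cdot f$ for homogeneous $f$ (i.e. $\gamma\circ d$ is the Euler derivation); in particular $\gamma(dx_i)=x_i$. It extends to homogeneous $R_{\mathbb{X}}$-linear maps $\gamma:\Omega^m_{R_{\mathbb{X}}/K}\to\Omega^{m-1}_{R_{\mathbb{X}}/K}$ by $\gamma(\omega_1\wedge\cdots\wedge\omega_m)=\sum_{j=1}^m(-1)^{j+1}\gamma(\omega_j)\,\omega_1\wedge\cdots\wedge\widehat{\omega_j}\wedge\cdots\wedge\omega_m$ for $\omega_1,\dots,\omega_m\in\Omega^1_{R_{\mathbb{X}}/K}$. *)

theory Defs
  imports "HOL-Algebra.Module" "HOL-Algebra.QuotRing" "HOL-Algebra.Generated_Groups"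
    "HOL-Library.Poly_Mapping"
begin

section \<open>Modules: homomorphisms, gradings, free modules, quotients\<close>

definition module_hom ::
  "('a, 'r) ring_scheme \<Rightarrow> ('a, 'b, 'm) module_scheme \<Rightarrow> ('a, 'c, 'n) module_scheme \<Rightarrow> ('b \<Rightarrow> 'c) set"
  where "module_hom R M N = {h \<in> carrier M \<rightarrow> carrier N.
    (\<forall>x\<in>carrier M. \<forall>y\<in>carrier M. h (x \<oplus>\<^bsub>M\<^esub> y) = h x \<oplus>\<^bsub>N\<^esub> h y) \<and>
    (\<forall>r\<in>carrier R. \<forall>x\<in>carrier M. h (r \<odot>\<^bsub>M\<^esub> x) = r \<odot>\<^bsub>N\<^esub> h x)}"

text \<open>Gradings are indexed by \<open>nat\<close>: the components in negative degrees of all modules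
  considered here vanish.\<close>

definition graded_module ::
  "('a, 'r) ring_scheme \<Rightarrow> (nat \<Rightarrow> 'a set) \<Rightarrow> ('a, 'b, 'm) module_scheme \<Rightarrow> (nat \<Rightarrow> 'b set) \<Rightarrow> bool"
  where "graded_module R Rg M Mg \<longleftrightarrow>
    module R M \<and>
    (\<forall>d. subgroup (Mg d) (add_monoid M)) \<and>
    (\<forall>x\<in>carrier M. \<exists>!c. (\<forall>d. c d \<in> Mg d) \<and> finite {d. c d \<noteq> \<zero>\<^bsub>M\<^esub>} \<and>
        x = finsum M c {d. c d \<noteq> \<zero>\<^bsub>M\<^esub>}) \<and>
    (\<forall>i j. \<forall>r\<in>Rg i. \<forall>x\<in>Mg j. r \<odot>\<^bsub>M\<^esub> x \<in> Mg (i + j))"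

definition graded_hom ::
  "('a, 'r) ring_scheme \<Rightarrow> ('a, 'b, 'm) module_scheme \<Rightarrow> (nat \<Rightarrow> 'b set)
    \<Rightarrow> ('a, 'c, 'n) module_scheme \<Rightarrow> (nat \<Rightarrow> 'c set) \<Rightarrow> ('b \<Rightarrow> 'c) set"
  where "graded_hom R M Mg N Ng = {h \<in> module_hom R M N. \<forall>d. h ` Mg d \<subseteq> Ng d}"

definition ring_module :: "('a, 'r) ring_scheme \<Rightarrow> ('a, 'a) module"
  where "ring_module R = \<lparr>carrier = carrier R, mult = mult R, one = \<one>\<^bsub>R\<^esub>,
    zero = \<zero>\<^bsub>R\<^esub>, add = add R, smult = mult R\<rparr>"

text \<open>The multiplicative fields of the record type of modules play no role for the
  modules below and are left unspecified.\<close>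

definition free_module :: "('a, 'r) ring_scheme \<Rightarrow> 'x set \<Rightarrow> ('a, 'x \<Rightarrow> 'a) module"
  where "free_module R X =
    \<lparr>carrier = {c \<in> X \<rightarrow>\<^sub>E carrier R. finite {x \<in> X. c x \<noteq> \<zero>\<^bsub>R\<^esub>}},
     mult = undefined, one = undefined,
     zero = (\<lambda>x\<in>X. \<zero>\<^bsub>R\<^esub>),
     add = (\<lambda>c c'. \<lambda>x\<in>X. c x \<oplus>\<^bsub>R\<^esub> c' x),
     smult = (\<lambda>r c. \<lambda>x\<in>X. r \<otimes>\<^bsub>R\<^esub> c x)\<rparr>"

definition free_gen :: "('a, 'r) ring_scheme \<Rightarrow> 'x set \<Rightarrow> 'x \<Rightarrow> 'x \<Rightarrow> 'a"
  where "free_gen R X x = (\<lambda>y\<in>X. if y = x then \<one>\<^bsub>R\<^esub> else \<zero>\<^bsub>R\<^esub>)"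

definition submodule_span ::
  "('a, 'r) ring_scheme \<Rightarrow> ('a, 'b, 'm) module_scheme \<Rightarrow> 'b set \<Rightarrow> 'b set"
  where "submodule_span R M A = \<Inter>{N. submodule N R M \<and> A \<subseteq> N}"

definition quotient_module :: "('a, 'b, 'm) module_scheme \<Rightarrow> 'b set \<Rightarrow> ('a, 'b set) module"
  where "quotient_module M N =
    \<lparr>carrier = a_rcosets\<^bsub>M\<^esub> N, mult = undefined, one = undefined, zero = N, add = set_add M,
     smult = (\<lambda>r C. \<Union>x\<in>C. N +>\<^bsub>M\<^esub> (r \<odot>\<^bsub>M\<^esub> x))\<rparr>"

section \<open>Kaehler differentials\<close>

text \<open>The module of Kaehler differentials of \<open>R\<close> over the subring \<open>k\<close> is the free module on
  symbols \<open>d f\<close>, \<open>f \<in> R\<close>, modulo additivity, the Leibniz rule, and \<open>d c = 0\<close> for \<open>c \<in> k\<close>.\<close>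

definition kaehler_rels :: "('a, 'r) ring_scheme \<Rightarrow> 'a set \<Rightarrow> ('a \<Rightarrow> 'a) set"
  where "kaehler_rels R k = (let F = free_module R (carrier R); \<delta> = free_gen R (carrier R) in
    {\<delta> (f \<oplus>\<^bsub>R\<^esub> g) \<ominus>\<^bsub>F\<^esub> (\<delta> f \<oplus>\<^bsub>F\<^esub> \<delta> g) |f g. f \<in> carrier R \<and> g \<in> carrier R} \<union>
    {\<delta> (f \<otimes>\<^bsub>R\<^esub> g) \<ominus>\<^bsub>F\<^esub> (f \<odot>\<^bsub>F\<^esub> \<delta> g \<oplus>\<^bsub>F\<^esub> g \<odot>\<^bsub>F\<^esub> \<delta> f) |f g. f \<in> carrier R \<and> g \<in> carrier R} \<union>
    \<delta> ` k)"

definition kaehler :: "('a, 'r) ring_scheme \<Rightarrow> 'a set \<Rightarrow> ('a, ('a \<Rightarrow> 'a) set) module"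
  where "kaehler R k = quotient_module (free_module R (carrier R))
    (submodule_span R (free_module R (carrier R)) (kaehler_rels R k))"

definition kaehler_d :: "('a, 'r) ring_scheme \<Rightarrow> 'a set \<Rightarrow> 'a \<Rightarrow> ('a \<Rightarrow> 'a) set"
  where "kaehler_d R k f =
    submodule_span R (free_module R (carrier R)) (kaehler_rels R k)
      +>\<^bsub>free_module R (carrier R)\<^esub> free_gen R (carrier R) f"

text \<open>The grading for which \<open>d\<close> is homogeneous of degree 0, i.e.\ \<open>deg (d f) = deg f\<close>.\<close>

definition kaehler_deg ::
  "('a, 'r) ring_scheme \<Rightarrow> (nat \<Rightarrow> 'a set) \<Rightarrow> 'a set \<Rightarrow> nat \<Rightarrow> ('a \<Rightarrow> 'a) set set"
  where "kaehler_deg R Rg k e = generate (add_monoid (kaehler R k))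
    {r \<odot>\<^bsub>kaehler R k\<^esub> kaehler_d R k f |r f i j. r \<in> Rg i \<and> f \<in> Rg j \<and> i + j = e}"

section \<open>Exterior powers\<close>

text \<open>The \<open>m\<close>-th exterior power is the free module on \<open>m\<close>-tuples modulo the relations making
  the tuple \<open>(w\<^sub>1, \<dots>, w\<^sub>m)\<close> multilinear and alternating.\<close>

definition tuples :: "('a, 'b, 'm) module_scheme \<Rightarrow> nat \<Rightarrow> 'b list set"
  where "tuples M m = {ws. length ws = m \<and> set ws \<subseteq> carrier M}"

definition ext_rels ::
  "('a, 'r) ring_scheme \<Rightarrow> ('a, 'b, 'm) module_scheme \<Rightarrow> nat \<Rightarrow> ('b list \<Rightarrow> 'a) set"
  where "ext_rels R M m = (let F = free_module R (tuples M m); \<delta> = free_gen R (tuples M m) in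
    {\<delta> (ws[i := u \<oplus>\<^bsub>M\<^esub> v]) \<ominus>\<^bsub>F\<^esub> (\<delta> (ws[i := u]) \<oplus>\<^bsub>F\<^esub> \<delta> (ws[i := v])) |ws i u v.
      ws \<in> tuples M m \<and> i < m \<and> u \<in> carrier M \<and> v \<in> carrier M} \<union>
    {\<delta> (ws[i := r \<odot>\<^bsub>M\<^esub> u]) \<ominus>\<^bsub>F\<^esub> r \<odot>\<^bsub>F\<^esub> \<delta> (ws[i := u]) |ws i r u.
      ws \<in> tuples M m \<and> i < m \<and> r \<in> carrier R \<and> u \<in> carrier M} \<union>
    {\<delta> ws |ws i j. ws \<in> tuples M m \<and> i < j \<and> j < m \<and> ws ! i = ws ! j})"

definition ext_power ::
  "('a, 'r) ring_scheme \<Rightarrow> ('a, 'b, 'm) module_scheme \<Rightarrow> nat \<Rightarrow> ('a, ('b list \<Rightarrow> 'a) set) module"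
  where "ext_power R M m = quotient_module (free_module R (tuples M m))
    (submodule_span R (free_module R (tuples M m)) (ext_rels R M m))"

definition wedge ::
  "('a, 'r) ring_scheme \<Rightarrow> ('a, 'b, 'm) module_scheme \<Rightarrow> 'b list \<Rightarrow> ('b list \<Rightarrow> 'a) set"
  where "wedge R M ws = (let m = length ws in
    submodule_span R (free_module R (tuples M m)) (ext_rels R M m)
      +>\<^bsub>free_module R (tuples M m)\<^esub> free_gen R (tuples M m) ws)"

text \<open>The grading with \<open>deg (w\<^sub>1 \<and> \<dots> \<and> w\<^sub>m) = deg w\<^sub>1 + \<dots> + deg w\<^sub>m\<close>.  It is used for
  \<open>m \<ge> 1\<close> only.\<close>

definition ext_deg ::
  "('a, 'r) ring_scheme \<Rightarrow> ('a, 'b, 'm) module_scheme \<Rightarrow> (nat \<Rightarrow> 'b set) \<Rightarrow> nat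
    \<Rightarrow> nat \<Rightarrow> ('b list \<Rightarrow> 'a) set set"
  where "ext_deg R M Mg m e = generate (add_monoid (ext_power R M m))
    {wedge R M ws |ws ds. length ws = m \<and> length ds = m \<and> (\<forall>i<m. ws ! i \<in> Mg (ds ! i)) \<and>
      sum_list ds = e}"

section \<open>The maps of the Koszul complex\<close>

text \<open>Each map is the unique one with its defining property; the extensionality condition only
  normalises values outside of the carrier.\<close>

definition euler_map ::
  "('a, 'r) ring_scheme \<Rightarrow> (nat \<Rightarrow> 'a set) \<Rightarrow> 'a set \<Rightarrow> ('a \<Rightarrow> 'a) set \<Rightarrow> 'a"
  where "euler_map R Rg k = (THE g. g \<in> extensional (carrier (kaehler R k)) \<and>
    g \<in> graded_hom R (kaehler R k) (kaehler_deg R Rg k) (ring_module R) Rg \<and>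
    (\<forall>d. \<forall>f\<in>Rg d. g (kaehler_d R k f) = add_pow R d f))"

text \<open>The sign is \<open>(-1)\<^sup>j\<close> because list positions are counted from 0.\<close>

definition contraction ::
  "('a, 'r) ring_scheme \<Rightarrow> ('a, 'b, 'm) module_scheme \<Rightarrow> ('b \<Rightarrow> 'a) \<Rightarrow> nat
    \<Rightarrow> ('b list \<Rightarrow> 'a) set \<Rightarrow> ('b list \<Rightarrow> 'a) set"
  where "contraction R M g m = (THE h. h \<in> extensional (carrier (ext_power R M m)) \<and>
    h \<in> module_hom R (ext_power R M m) (ext_power R M (m - 1)) \<and>
    (\<forall>ws\<in>tuples M m. h (wedge R M ws) =
      (\<Oplus>\<^bsub>ext_power R M (m - 1)\<^esub> j\<in>{..<m}.
        ((\<ominus>\<^bsub>R\<^esub> \<one>\<^bsub>R\<^esub>) [^]\<^bsub>R\<^esub> j \<otimes>\<^bsub>R\<^esub> g (ws ! j)) \<odot>\<^bsub>ext_power R M (m - 1)\<^esub>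
          wedge R M (take j ws @ drop (Suc j) ws))))"

text \<open>A linear form \<open>g\<close> on \<open>M\<close>, transported to the first exterior power along the canonical
  isomorphism \<open>w \<mapsto> wedge R M [w]\<close>.\<close>

definition ext_one_map ::
  "('a, 'r) ring_scheme \<Rightarrow> ('a, 'b, 'm) module_scheme \<Rightarrow> ('b \<Rightarrow> 'a) \<Rightarrow> ('b list \<Rightarrow> 'a) set \<Rightarrow> 'a"
  where "ext_one_map R M g = (THE h. h \<in> extensional (carrier (ext_power R M 1)) \<and>
    h \<in> module_hom R (ext_power R M 1) (ring_module R) \<and>
    (\<forall>w\<in>carrier M. h (wedge R M [w]) = g w))"

section \<open>The homogeneous coordinate ring of projective space\<close>

text \<open>A polynomial in the variables \<open>X\<^sub>0, X\<^sub>1, \<dots>\<close> is a finitely supported map from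
  monomials to coefficients, a monomial being the finitely supported map of its exponents.\<close>

type_synonym 'k mpoly = "(nat \<Rightarrow>\<^sub>0 nat) \<Rightarrow>\<^sub>0 'k"

definition polys :: "nat \<Rightarrow> 'k::field mpoly ring"
  where "polys n = \<lparr>carrier = {p. \<forall>t\<in>Poly_Mapping.keys p. Poly_Mapping.keys t \<subseteq> {0..n}},
    mult = (*), one = 1, zero = 0, add = (+)\<rparr>"

definition const_poly :: "'k::field \<Rightarrow> 'k mpoly"
  where "const_poly c = Poly_Mapping.single 0 c"

definition var :: "nat \<Rightarrow> 'k::field mpoly"
  where "var i = Poly_Mapping.single (Poly_Mapping.single i 1) 1"

definition monom_deg :: "(nat \<Rightarrow>\<^sub>0 nat) \<Rightarrow> nat"
  where "monom_deg t = (\<Sum>i\<in>Poly_Mapping.keys t. Poly_Mapping.lookup t i)"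

definition homog :: "nat \<Rightarrow> nat \<Rightarrow> 'k::field mpoly set"
  where "homog n d = {p \<in> carrier (polys n). \<forall>t\<in>Poly_Mapping.keys p. monom_deg t = d}"

definition homog_ideal :: "nat \<Rightarrow> 'k::field mpoly set \<Rightarrow> bool"
  where "homog_ideal n I \<longleftrightarrow> (\<exists>A \<subseteq> (\<Union>d. homog n d). I = Idl\<^bsub>polys n\<^esub> A)"

definition saturated :: "nat \<Rightarrow> 'k::field mpoly set \<Rightarrow> bool"
  where "saturated n I \<longleftrightarrow>
    (\<forall>f\<in>carrier (polys n). (\<forall>i\<le>n. \<exists>e. var i ^ e * f \<in> I) \<longrightarrow> f \<in> I)"

section \<open>Zero-dimensional subschemes\<close>

text \<open>The points of the closed subscheme \<open>Proj (S / I)\<close> of projective space.\<close>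

definition proj_points :: "nat \<Rightarrow> 'k::field mpoly set \<Rightarrow> 'k mpoly set set"
  where "proj_points n I =
    {P. primeideal P (polys n) \<and> homog_ideal n P \<and> I \<subseteq> P \<and> \<not> var ` {0..n} \<subseteq> P}"

text \<open>The dimension of the underlying topological space: its irreducible closed subsets correspond,
  with inclusions reversed, to the elements of \<open>proj_points n I\<close>.  The empty scheme has no
  dimension in this sense.\<close>

definition has_proj_chain :: "nat \<Rightarrow> 'k::field mpoly set \<Rightarrow> nat \<Rightarrow> bool"
  where "has_proj_chain n I l \<longleftrightarrow>
    (\<exists>P. (\<forall>i\<le>l. P i \<in> proj_points n I) \<and> (\<forall>i<l. P i \<subset> P (Suc i)))"

definition has_proj_dim :: "nat \<Rightarrow> 'k::field mpoly set \<Rightarrow> nat \<Rightarrow> bool"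
  where "has_proj_dim n I d \<longleftrightarrow> has_proj_chain n I d \<and> (\<forall>l>d. \<not> has_proj_chain n I l)"

text \<open>Closed subschemes of projective space correspond bijectively to saturated homogeneous
  ideals; \<open>I\<close> is the vanishing ideal of a subscheme of dimension 0.\<close>

definition zero_dim_subscheme :: "nat \<Rightarrow> 'k::field mpoly set \<Rightarrow> bool"
  where "zero_dim_subscheme n I \<longleftrightarrow> homog_ideal n I \<and> saturated n I \<and> has_proj_dim n I 0"

section \<open>The Koszul complex of a subscheme\<close>

definition coord_ring :: "nat \<Rightarrow> 'k::field mpoly set \<Rightarrow> 'k mpoly set ring"
  where "coord_ring n I = polys n Quot I"

definition coord_deg :: "nat \<Rightarrow> 'k::field mpoly set \<Rightarrow> nat \<Rightarrow> 'k mpoly set set"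
  where "coord_deg n I d = (\<lambda>p. I +>\<^bsub>polys n\<^esub> p) ` homog n d"

definition coord_consts :: "nat \<Rightarrow> 'k::field mpoly set \<Rightarrow> 'k mpoly set set"
  where "coord_consts n I = range (\<lambda>c. I +>\<^bsub>polys n\<^esub> const_poly c)"

definition max_ideal :: "nat \<Rightarrow> 'k::field mpoly set \<Rightarrow> 'k mpoly set set"
  where "max_ideal n I = Idl\<^bsub>coord_ring n I\<^esub> ((\<lambda>i. I +>\<^bsub>polys n\<^esub> var i) ` {0..n})"

definition max_module :: "nat \<Rightarrow> 'k::field mpoly set \<Rightarrow> ('k mpoly set, 'k mpoly set) module"
  where "max_module n I = (ring_module (coord_ring n I))\<lparr>carrier := max_ideal n I\<rparr>"

definition max_deg :: "nat \<Rightarrow> 'k::field mpoly set \<Rightarrow> nat \<Rightarrow> 'k mpoly set set"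
  where "max_deg n I d = max_ideal n I \<inter> coord_deg n I d"

abbreviation Omega1 ::
  "nat \<Rightarrow> 'k::field mpoly set \<Rightarrow> ('k mpoly set, ('k mpoly set \<Rightarrow> 'k mpoly set) set) module"
  where "Omega1 n I \<equiv> kaehler (coord_ring n I) (coord_consts n I)"

abbreviation Omega1_deg ::
  "nat \<Rightarrow> 'k::field mpoly set \<Rightarrow> nat \<Rightarrow> ('k mpoly set \<Rightarrow> 'k mpoly set) set set"
  where "Omega1_deg n I \<equiv> kaehler_deg (coord_ring n I) (coord_deg n I) (coord_consts n I)"

definition Omega ::
  "nat \<Rightarrow> 'k::field mpoly set \<Rightarrow> nat
    \<Rightarrow> ('k mpoly set, (('k mpoly set \<Rightarrow> 'k mpoly set) set list \<Rightarrow> 'k mpoly set) set) module"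
  where "Omega n I m = ext_power (coord_ring n I) (Omega1 n I) m"

definition Omega_deg ::
  "nat \<Rightarrow> 'k::field mpoly set \<Rightarrow> nat
    \<Rightarrow> nat \<Rightarrow> (('k mpoly set \<Rightarrow> 'k mpoly set) set list \<Rightarrow> 'k mpoly set) set set"
  where "Omega_deg n I m = ext_deg (coord_ring n I) (Omega1 n I) (Omega1_deg n I) m"

abbreviation euler ::
  "nat \<Rightarrow> 'k::field mpoly set \<Rightarrow> ('k mpoly set \<Rightarrow> 'k mpoly set) set \<Rightarrow> 'k mpoly set"
  where "euler n I \<equiv> euler_map (coord_ring n I) (coord_deg n I) (coord_consts n I)"

text \<open>\<open>koszul n I m\<close> is the map from \<open>Omega n I m\<close> to \<open>Omega n I (m - 1)\<close>, used for
  \<open>m \<ge> 2\<close>; \<open>koszul_last n I\<close> is the map from \<open>Omega n I 1\<close> to the coordinate ring.\<close>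

definition koszul ::
  "nat \<Rightarrow> 'k::field mpoly set \<Rightarrow> nat
    \<Rightarrow> (('k mpoly set \<Rightarrow> 'k mpoly set) set list \<Rightarrow> 'k mpoly set) set
    \<Rightarrow> (('k mpoly set \<Rightarrow> 'k mpoly set) set list \<Rightarrow> 'k mpoly set) set"
  where "koszul n I m = contraction (coord_ring n I) (Omega1 n I) (euler n I) m"

definition koszul_last ::
  "nat \<Rightarrow> 'k::field mpoly set
    \<Rightarrow> (('k mpoly set \<Rightarrow> 'k mpoly set) set list \<Rightarrow> 'k mpoly set) set \<Rightarrow> 'k mpoly set"
  where "koszul_last n I = ext_one_map (coord_ring n I) (Omega1 n I) (euler n I)"

end

theory Submission
  imports Defs
begin

text \<open>Let \<open>h\<close> denote the exterior derivative.  By Cartan's formula the Lie derivative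
  \<open>\<gamma> h + h \<gamma>\<close> along the Euler field acts on forms of degree \<open>e\<close> as multiplication by \<open>e\<close>, which is
  invertible for \<open>e > 0\<close> in characteristic zero, and there are no nonzero \<open>m\<close>-forms of degree \<open>0\<close>
  for \<open>m \<ge> 1\<close>.  Hence a homogeneous form \<open>\<omega>\<close> of degree \<open>e\<close> with \<open>\<gamma> \<omega> = 0\<close> is \<open>\<gamma> (h \<omega> / e)\<close>.
  The same operator shows that the gradings are direct sums, since it realises the homogeneous
  components as eigenspaces with distinct eigenvalues.  On the left the complex stops because the
  module of differentials is generated by \<open>n + 1\<close> elements, so that the exterior power of
  exponent \<open>n + 2\<close> vanishes.\<close>

text \<open>The exterior derivative is additive but not linear, and the kernel of an additive map
  need not be a submodule. The universal properties of free modules, differentials and exterior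
  powers are therefore stated for maps additive in the coefficient \<open>r\<close> of a generator;
  linearity is replaced by balancing conditions that say how a scalar passes between the coefficient
  and the entries. Putting \<open>dr\<close> in front of a product is compatible with the relations
  only after a correction by the \<open>dw\<^sub>j\<close> is added; it vanishes on exact factors.
  Cartan's formula is checked only on products of a homogeneous \<open>r\<close> with exact
  homogeneous factors \<open>df\<close>, since these span. A form in the kernel need not be
  homogeneous, so its components must be shown to lie in the kernel as well. The last map has the
  ring as target, not an exterior power: exactness there is first obtained for the target
  \<open>E 0\<close> and carried over through the identification of \<open>E 0\<close> with the
  ring. The coordinate ring enters only through a derivation that multiplies degree \<open>e\<close>
  by \<open>e\<close>. It descends from polynomials because the ideal is generated by homogeneous
  elements.\<close>

lemma additive_homI:
  assumes "abelian_group M" "abelian_group N"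
    and "\<And>x. x \<in> carrier M \<Longrightarrow> h x \<in> carrier N"
    and "\<And>x y. \<lbrakk>x \<in> carrier M; y \<in> carrier M\<rbrakk> \<Longrightarrow> h (x \<oplus>\<^bsub>M\<^esub> y) = h x \<oplus>\<^bsub>N\<^esub> h y"
  shows "abelian_group_hom M N h"
proof -
  interpret M: abelian_group M by fact
  interpret N: abelian_group N by fact
  show ?thesis
    using assms by unfold_locales (auto simp: hom_def)
qed

lemma module_homD:
  assumes "h \<in> module_hom R M N"
  shows "\<And>x. x \<in> carrier M \<Longrightarrow> h x \<in> carrier N"
    and "\<And>x y. \<lbrakk>x \<in> carrier M; y \<in> carrier M\<rbrakk> \<Longrightarrow> h (x \<oplus>\<^bsub>M\<^esub> y) = h x \<oplus>\<^bsub>N\<^esub> h y"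
    and "\<And>r x. \<lbrakk>r \<in> carrier R; x \<in> carrier M\<rbrakk> \<Longrightarrow> h (r \<odot>\<^bsub>M\<^esub> x) = r \<odot>\<^bsub>N\<^esub> h x"
  using assms unfolding module_hom_def by auto

lemma module_hom_additive:
  assumes "h \<in> module_hom R M N" "module R M" "module R N"
  shows "abelian_group_hom M N h"
  using assms by (intro additive_homI) (auto simp: module_def dest: module_homD)

subsection \<open>Free modules\<close>

lemma free_module_simps:
  "carrier (free_module R X) = {c \<in> X \<rightarrow>\<^sub>E carrier R. finite {x \<in> X. c x \<noteq> \<zero>\<^bsub>R\<^esub>}}"
  "\<zero>\<^bsub>free_module R X\<^esub> = (\<lambda>x\<in>X. \<zero>\<^bsub>R\<^esub>)"
  "c \<oplus>\<^bsub>free_module R X\<^esub> c' = (\<lambda>x\<in>X. c x \<oplus>\<^bsub>R\<^esub> c' x)"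
  "r \<odot>\<^bsub>free_module R X\<^esub> c = (\<lambda>x\<in>X. r \<otimes>\<^bsub>R\<^esub> c x)"
  by (simp_all add: free_module_def)

context cring
begin

lemma free_module_addI:
  assumes "c \<in> carrier (free_module R X)" "c' \<in> carrier (free_module R X)"
  shows "(\<lambda>x\<in>X. c x \<oplus> c' x) \<in> carrier (free_module R X)"
proof -
  have "{x \<in> X. (\<lambda>x\<in>X. c x \<oplus> c' x) x \<noteq> \<zero>} \<subseteq> {x \<in> X. c x \<noteq> \<zero>} \<union> {x \<in> X. c' x \<noteq> \<zero>}"
    by auto
  then have "finite {x \<in> X. (\<lambda>x\<in>X. c x \<oplus> c' x) x \<noteq> \<zero>}"
    by (rule finite_subset) (use assms in \<open>simp add: free_module_simps\<close>)
  then show ?thesis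
    using assms by (auto simp: free_module_simps PiE_def Pi_def)
qed

lemma free_module_smultI:
  assumes "c \<in> carrier (free_module R X)" "r \<in> carrier R"
  shows "(\<lambda>x\<in>X. r \<otimes> c x) \<in> carrier (free_module R X)"
proof -
  have "{x \<in> X. (\<lambda>x\<in>X. r \<otimes> c x) x \<noteq> \<zero>} \<subseteq> {x \<in> X. c x \<noteq> \<zero>}"
    using assms by auto
  then have "finite {x \<in> X. (\<lambda>x\<in>X. r \<otimes> c x) x \<noteq> \<zero>}"
    by (rule finite_subset) (use assms in \<open>simp add: free_module_simps\<close>)
  then show ?thesis
    using assms by (auto simp: free_module_simps PiE_def Pi_def)
qed

lemma free_module_mem:
  "\<lbrakk>c \<in> carrier (free_module R X); x \<in> X\<rbrakk> \<Longrightarrow> c x \<in> carrier R"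
  by (auto simp: free_module_simps)

lemma free_module_ext:
  assumes "c \<in> carrier (free_module R X)" "c' \<in> carrier (free_module R X)"
    and "\<And>x. x \<in> X \<Longrightarrow> c x = c' x"
  shows "c = c'"
  using assms by (auto simp: free_module_simps intro: PiE_ext)

lemma free_module_module: "module R (free_module R X)"
proof (rule moduleI)
  note mem = free_module_mem[of _ X]
  show "cring R" by (rule is_cring)
  show "abelian_group (free_module R X)"
  proof (rule abelian_groupI)
    fix c assume c: "c \<in> carrier (free_module R X)"
    have "(\<lambda>x\<in>X. (\<ominus> \<one>) \<otimes> c x) \<in> carrier (free_module R X)"
      using c by (intro free_module_smultI) auto
    moreover have "(\<lambda>x\<in>X. (\<ominus> \<one>) \<otimes> c x) \<oplus>\<^bsub>free_module R X\<^esub> c = \<zero>\<^bsub>free_module R X\<^esub>"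
      using mem[OF c] by (auto simp: free_module_simps l_minus l_neg intro!: restrict_ext)
    ultimately show "\<exists>d\<in>carrier (free_module R X). d \<oplus>\<^bsub>free_module R X\<^esub> c = \<zero>\<^bsub>free_module R X\<^esub>"
      by blast
  next
    fix c c' assume "c \<in> carrier (free_module R X)" "c' \<in> carrier (free_module R X)"
    then show "c \<oplus>\<^bsub>free_module R X\<^esub> c' \<in> carrier (free_module R X)"
      using free_module_addI by (simp add: free_module_simps(3))
  next
    fix c assume "c \<in> carrier (free_module R X)"
    then show "\<zero>\<^bsub>free_module R X\<^esub> \<oplus>\<^bsub>free_module R X\<^esub> c = c"
      by (auto simp: free_module_simps PiE_def Pi_def intro!: extensionalityI[of _ X])
  qed (auto simp: free_module_simps a_ac PiE_def Pi_def intro!: restrict_ext)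
  fix a c assume "a \<in> carrier R" "c \<in> carrier (free_module R X)"
  then show "a \<odot>\<^bsub>free_module R X\<^esub> c \<in> carrier (free_module R X)"
    using free_module_smultI by (simp add: free_module_simps(4))
next
  fix c assume "c \<in> carrier (free_module R X)"
  then show "\<one> \<odot>\<^bsub>free_module R X\<^esub> c = c"
    by (auto simp: free_module_simps PiE_def Pi_def intro!: extensionalityI[of _ X])
qed (auto simp: free_module_simps l_distr r_distr m_assoc PiE_def Pi_def intro!: restrict_ext)

lemma free_gen_closed:
  assumes "x \<in> X"
  shows "free_gen R X x \<in> carrier (free_module R X)"
proof -
  have "{y \<in> X. free_gen R X x y \<noteq> \<zero>} \<subseteq> {x}"
    by (auto simp: free_gen_def)
  then have "finite {y \<in> X. free_gen R X x y \<noteq> \<zero>}"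
    using finite_subset by blast
  then show ?thesis
    by (auto simp: free_module_simps free_gen_def)
qed

lemma free_module_induct [consumes 1, case_names zero gen add]:
  assumes c: "c \<in> carrier (free_module R X)"
    and zero: "P \<zero>\<^bsub>free_module R X\<^esub>"
    and gen: "\<And>r x. \<lbrakk>r \<in> carrier R; x \<in> X\<rbrakk> \<Longrightarrow> P (r \<odot>\<^bsub>free_module R X\<^esub> free_gen R X x)"
    and add: "\<And>a b. \<lbrakk>a \<in> carrier (free_module R X); b \<in> carrier (free_module R X); P a; P b\<rbrakk>
      \<Longrightarrow> P (a \<oplus>\<^bsub>free_module R X\<^esub> b)"
  shows "P c"
proof -
  have "\<And>c. c \<in> carrier (free_module R X) \<Longrightarrow> {x \<in> X. c x \<noteq> \<zero>} = S \<Longrightarrow> P c" if "finite S" for S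
    using that
  proof (induction S rule: finite_induct)
    case empty
    then have "c = \<zero>\<^bsub>free_module R X\<^esub>"
      by (auto simp: free_module_simps PiE_def Pi_def intro!: extensionalityI[of _ X])
    then show ?case using zero by simp
  next
    case (insert x S)
    \<comment> \<open>\<open>c\<close> is split into its value at \<open>x\<close> times the
      generator and \<open>c\<close> with that value reset to zero, whose support is the smaller
      set.\<close>
    let ?u = "c x \<odot>\<^bsub>free_module R X\<^esub> free_gen R X x"
    let ?v = "c(x := \<zero>)"
    have x: "x \<in> X" "c x \<in> carrier R"
      using insert by (auto simp: free_module_simps)
    have sv: "{y \<in> X. ?v y \<noteq> \<zero>} = S"
      using insert by auto
    have v: "?v \<in> carrier (free_module R X)"
      using insert x sv by (auto simp: free_module_simps PiE_def Pi_def extensional_def)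
    have u: "?u \<in> carrier (free_module R X)"
      using x by (intro module.smult_closed[OF free_module_module] free_gen_closed)
    have "c = ?u \<oplus>\<^bsub>free_module R X\<^esub> ?v"
      using insert.prems(1) u v x
      by (intro free_module_ext[of _ X] insert.prems(1))
        (auto intro!: abelian_monoid.a_closed module.axioms
          simp: abelian_group.axioms module.axioms(2)[OF free_module_module],
         auto simp: free_module_simps(2-4) free_gen_def free_module_mem[OF insert.prems(1)])
    moreover have "P ?u" using gen x by blast
    moreover have "P ?v" by (rule insert.IH[OF v sv])
    ultimately show ?case using add u v by metis
  qed
  then show ?thesis using c by (auto simp: free_module_simps)
qed

text \<open>The coefficients are treated additively rather than linearly: the exterior derivative,
  which is not linear, is constructed from this universal property as well.\<close>

definition free_lift :: "('d, 'e) ring_scheme \<Rightarrow> 'x set \<Rightarrow> ('a \<Rightarrow> 'x \<Rightarrow> 'd) \<Rightarrow> ('x \<Rightarrow> 'a) \<Rightarrow> 'd"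
  where "free_lift N X \<phi> c = finsum N (\<lambda>x. \<phi> (c x) x) {x \<in> X. c x \<noteq> \<zero>}"

lemma additive_zero:
  assumes "abelian_group N" "\<And>r. r \<in> carrier R \<Longrightarrow> \<psi> r \<in> carrier N"
    and "\<And>r s. \<lbrakk>r \<in> carrier R; s \<in> carrier R\<rbrakk> \<Longrightarrow> \<psi> (r \<oplus> s) = \<psi> r \<oplus>\<^bsub>N\<^esub> \<psi> s"
  shows "\<psi> \<zero> = \<zero>\<^bsub>N\<^esub>"
proof -
  interpret abelian_group_hom R N \<psi>
    using assms by (intro additive_homI) (auto simp: is_abelian_group)
  show ?thesis by (rule hom_zero)
qed

lemma free_lift:
  assumes N: "abelian_group N"
    and \<phi>: "\<And>r x. \<lbrakk>r \<in> carrier R; x \<in> X\<rbrakk> \<Longrightarrow> \<phi> r x \<in> carrier N"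
    and \<phi>add: "\<And>r s x. \<lbrakk>r \<in> carrier R; s \<in> carrier R; x \<in> X\<rbrakk> \<Longrightarrow> \<phi> (r \<oplus> s) x = \<phi> r x \<oplus>\<^bsub>N\<^esub> \<phi> s x"
  shows "abelian_group_hom (free_module R X) N (free_lift N X \<phi>)"
    and "\<And>r x. \<lbrakk>r \<in> carrier R; x \<in> X\<rbrakk>
      \<Longrightarrow> free_lift N X \<phi> (r \<odot>\<^bsub>free_module R X\<^esub> free_gen R X x) = \<phi> r x"
proof -
  interpret N: abelian_group N by fact
  interpret F: module R "free_module R X" by (rule free_module_module)
  have \<phi>0: "\<phi> \<zero> x = \<zero>\<^bsub>N\<^esub>" if "x \<in> X" for x
    using additive_zero[of N "\<lambda>r. \<phi> r x"] that N \<phi> \<phi>add by auto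
  \<comment> \<open>Summing over any finite superset of the support allows \<open>c\<close>,
    \<open>c'\<close> and their sum to be treated over one common index set.\<close>
  have lift: "free_lift N X \<phi> c = finsum N (\<lambda>x. \<phi> (c x) x) S"
    if "finite S" "S \<subseteq> X" "{x \<in> X. c x \<noteq> \<zero>} \<subseteq> S" "c \<in> carrier (free_module R X)" for c S
    unfolding free_lift_def using that \<phi>0 \<phi> free_module_mem[of c X]
    by (intro N.add.finprod_mono_neutral_cong_left) (auto intro!: Pi_I)
  show "abelian_group_hom (free_module R X) N (free_lift N X \<phi>)"
  proof (rule additive_homI)
    fix c assume "c \<in> carrier (free_module R X)"
    then show "free_lift N X \<phi> c \<in> carrier N"
      unfolding free_lift_def by (intro N.finsum_closed Pi_I \<phi>) (auto simp: free_module_mem)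
  next
    fix c c' assume c: "c \<in> carrier (free_module R X)" "c' \<in> carrier (free_module R X)"
    note mem = free_module_mem[OF c(1)] free_module_mem[OF c(2)]
    let ?S = "{x \<in> X. c x \<noteq> \<zero>} \<union> {x \<in> X. c' x \<noteq> \<zero>}"
    have S: "finite ?S" "?S \<subseteq> X"
      using c by (auto simp: free_module_simps)
    have "free_lift N X \<phi> (c \<oplus>\<^bsub>free_module R X\<^esub> c')
        = finsum N (\<lambda>x. \<phi> ((c \<oplus>\<^bsub>free_module R X\<^esub> c') x) x) ?S"
      using S c by (intro lift) (auto simp: free_module_simps(3) free_module_addI)
    also have "\<dots> = finsum N (\<lambda>x. \<phi> (c x) x \<oplus>\<^bsub>N\<^esub> \<phi> (c' x) x) ?S"
      using S \<phi> \<phi>add mem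
      by (intro N.finsum_cong') (auto simp: free_module_simps(3) intro!: N.a_closed)
    also have "\<dots> = finsum N (\<lambda>x. \<phi> (c x) x) ?S \<oplus>\<^bsub>N\<^esub> finsum N (\<lambda>x. \<phi> (c' x) x) ?S"
      using S \<phi> mem by (intro N.finsum_addf) auto
    also have "\<dots> = free_lift N X \<phi> c \<oplus>\<^bsub>N\<^esub> free_lift N X \<phi> c'"
      using S c by (simp add: lift[of ?S])
    finally show "free_lift N X \<phi> (c \<oplus>\<^bsub>free_module R X\<^esub> c')
        = free_lift N X \<phi> c \<oplus>\<^bsub>N\<^esub> free_lift N X \<phi> c'" .
  qed (use N in \<open>auto intro: module.axioms free_module_module\<close>)
  fix r x assume rx: "r \<in> carrier R" "x \<in> X"
  then have "free_lift N X \<phi> (r \<odot>\<^bsub>free_module R X\<^esub> free_gen R X x)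
      = finsum N (\<lambda>y. \<phi> ((r \<odot>\<^bsub>free_module R X\<^esub> free_gen R X x) y) y) {x}"
    using free_gen_closed
    by (intro lift F.smult_closed) (auto simp: free_module_simps(4) free_gen_def split: if_splits)
  also have "\<dots> = \<phi> ((r \<odot>\<^bsub>free_module R X\<^esub> free_gen R X x) x) x"
    using rx \<phi> by (simp add: free_module_simps(4) free_gen_def)
  also have "\<dots> = \<phi> r x"
    using rx by (simp add: free_module_simps(4) free_gen_def)
  finally show "free_lift N X \<phi> (r \<odot>\<^bsub>free_module R X\<^esub> free_gen R X x) = \<phi> r x" .
qed

end

subsection \<open>Quotients\<close>

context module
begin

lemma submodule_span_submodule:
  assumes "A \<subseteq> carrier M"
  shows "submodule (submodule_span R M A) R M"
proof -
  have "submodule (carrier M) R M" by (rule carrier_is_submodule)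
  moreover have "\<zero>\<^bsub>M\<^esub> \<in> N" if "submodule N R M" for N
    using subgroup.one_closed[OF submodule.axioms(1)[OF that]] by simp
  ultimately show ?thesis
    unfolding submodule_span_def using assms
    by (intro submoduleI)
      (auto simp: submoduleE(3) submoduleE(4) submoduleE(5))
qed

lemma submodule_span_incl: "a \<in> A \<Longrightarrow> a \<in> submodule_span R M A"
  unfolding submodule_span_def by blast

lemma submodule_span_minimal:
  "\<lbrakk>submodule N R M; A \<subseteq> N\<rbrakk> \<Longrightarrow> submodule_span R M A \<subseteq> N"
  unfolding submodule_span_def by blast

context
  fixes N
  assumes sub: "submodule N R M"
begin

interpretation N: abelian_subgroup N M
  using sub by (intro abelian_subgroupI3)
    (auto intro: additive_subgroup.intro submodule.axioms M.abelian_group_axioms)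

lemma quotient_simps:
  "carrier (quotient_module M N) = (\<lambda>x. N +>\<^bsub>M\<^esub> x) ` carrier M"
  "\<zero>\<^bsub>quotient_module M N\<^esub> = N"
  by (auto simp: quotient_module_def A_RCOSETS_def')

lemma coset_eq_iff:
  assumes "x \<in> carrier M" "y \<in> carrier M"
  shows "N +>\<^bsub>M\<^esub> x = N +>\<^bsub>M\<^esub> y \<longleftrightarrow> x \<ominus>\<^bsub>M\<^esub> y \<in> N"
proof -
  have "N +>\<^bsub>M\<^esub> x = N +>\<^bsub>M\<^esub> y \<longleftrightarrow> x \<in> N +>\<^bsub>M\<^esub> y"
  proof
    show "x \<in> N +>\<^bsub>M\<^esub> y" if "N +>\<^bsub>M\<^esub> x = N +>\<^bsub>M\<^esub> y"
      using N.a_rcos_self[OF assms(1)] unfolding that .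
  qed (rule N.a_repr_independence'[OF _ assms(2), symmetric])
  then show ?thesis
    by (simp add: N.a_rcos_module[OF assms(2,1)] a_minus_def)
qed

lemma coset_zero_iff: "x \<in> carrier M \<Longrightarrow> N +>\<^bsub>M\<^esub> x = N \<longleftrightarrow> x \<in> N"
  using coset_eq_iff[of x "\<zero>\<^bsub>M\<^esub>"] N.a_subset M.minus_equality[of "\<zero>\<^bsub>M\<^esub>" "\<zero>\<^bsub>M\<^esub>"]
  by (simp add: a_minus_def)

lemma quotient_add:
  "\<lbrakk>x \<in> carrier M; y \<in> carrier M\<rbrakk>
    \<Longrightarrow> (N +>\<^bsub>M\<^esub> x) \<oplus>\<^bsub>quotient_module M N\<^esub> (N +>\<^bsub>M\<^esub> y) = N +>\<^bsub>M\<^esub> (x \<oplus>\<^bsub>M\<^esub> y)"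
  by (simp add: quotient_module_def N.a_rcos_sum)

text \<open>The union in the definition of the scalar action runs over equal cosets:
  \<open>N\<close> is stable under \<open>r\<close>, so the coset of \<open>r y\<close> does not
  depend on the representative \<open>y\<close>.\<close>

lemma quotient_smult:
  assumes "r \<in> carrier R" "x \<in> carrier M"
  shows "r \<odot>\<^bsub>quotient_module M N\<^esub> (N +>\<^bsub>M\<^esub> x) = N +>\<^bsub>M\<^esub> (r \<odot>\<^bsub>M\<^esub> x)"
proof -
  have "N +>\<^bsub>M\<^esub> (r \<odot>\<^bsub>M\<^esub> y) = N +>\<^bsub>M\<^esub> (r \<odot>\<^bsub>M\<^esub> x)" if y: "y \<in> N +>\<^bsub>M\<^esub> x" for y
  proof -
    have yc: "y \<in> carrier M"
      using y assms N.a_subset by (auto simp: a_r_coset_def')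
    have "y \<ominus>\<^bsub>M\<^esub> x \<in> N"
      using y yc assms by (simp add: N.a_rcos_module a_minus_def)
    then have "r \<odot>\<^bsub>M\<^esub> (y \<ominus>\<^bsub>M\<^esub> x) \<in> N"
      using sub assms by (auto intro: submodule.smult_closed)
    then show ?thesis
      using assms yc by (simp add: coset_eq_iff a_minus_def smult_r_distr smult_r_minus)
  qed
  moreover have "x \<in> N +>\<^bsub>M\<^esub> x"
    using assms by (simp add: N.a_rcos_self)
  ultimately have "(\<Union>y\<in>N +>\<^bsub>M\<^esub> x. N +>\<^bsub>M\<^esub> (r \<odot>\<^bsub>M\<^esub> y)) = N +>\<^bsub>M\<^esub> (r \<odot>\<^bsub>M\<^esub> x)"
    by (intro SUP_eq_const) blast+
  then show ?thesis
    by (simp add: quotient_module_def)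
qed

lemma quotient_module_module: "module R (quotient_module M N)"
proof (rule moduleI)
  show "abelian_group (quotient_module M N)"
  proof (rule abelian_groupI)
    fix C assume "C \<in> carrier (quotient_module M N)"
    then obtain x where x: "x \<in> carrier M" "C = N +>\<^bsub>M\<^esub> x" by (auto simp: quotient_simps)
    have "(N +>\<^bsub>M\<^esub> (\<ominus>\<^bsub>M\<^esub> x)) \<oplus>\<^bsub>quotient_module M N\<^esub> C = N"
      using x by (simp add: quotient_add M.l_neg coset_zero_iff)
    then show "\<exists>y\<in>carrier (quotient_module M N). y \<oplus>\<^bsub>quotient_module M N\<^esub> C = \<zero>\<^bsub>quotient_module M N\<^esub>"
      using x by (auto simp: quotient_simps)
  next
    show "\<zero>\<^bsub>quotient_module M N\<^esub> \<in> carrier (quotient_module M N)"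
      using coset_zero_iff[of "\<zero>\<^bsub>M\<^esub>"] by (force simp: quotient_simps)
  next
    fix C assume "C \<in> carrier (quotient_module M N)"
    moreover have "N = N +>\<^bsub>M\<^esub> \<zero>\<^bsub>M\<^esub>"
      using coset_zero_iff[of "\<zero>\<^bsub>M\<^esub>"] by simp
    ultimately show "\<zero>\<^bsub>quotient_module M N\<^esub> \<oplus>\<^bsub>quotient_module M N\<^esub> C = C"
      using quotient_add[of "\<zero>\<^bsub>M\<^esub>"] by (auto simp: quotient_simps)
  qed (auto simp: quotient_simps(1) quotient_add M.a_ac)
qed (auto simp: is_cring quotient_simps(1) quotient_add quotient_smult smult_l_distr smult_r_distr
    smult_assoc1)

lemma quotient_lift:
  assumes h: "abelian_group_hom M G h" and zero: "\<And>x. x \<in> N \<Longrightarrow> h x = \<zero>\<^bsub>G\<^esub>"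
  shows "\<exists>h'. abelian_group_hom (quotient_module M N) G h' \<and> (\<forall>x\<in>carrier M. h' (N +>\<^bsub>M\<^esub> x) = h x)"
proof -
  interpret h: abelian_group_hom M G h by fact
  interpret Q: module R "quotient_module M N" by (rule quotient_module_module)
  define h' where "h' C = h (SOME x. x \<in> carrier M \<and> N +>\<^bsub>M\<^esub> x = C)" for C
  have eq: "h' (N +>\<^bsub>M\<^esub> x) = h x" if x: "x \<in> carrier M" for x
  proof -
    let ?y = "SOME y. y \<in> carrier M \<and> N +>\<^bsub>M\<^esub> y = N +>\<^bsub>M\<^esub> x"
    have y: "?y \<in> carrier M \<and> N +>\<^bsub>M\<^esub> ?y = N +>\<^bsub>M\<^esub> x"
      by (rule someI[of _ x]) (use x in simp)
    then have "h (?y \<ominus>\<^bsub>M\<^esub> x) = \<zero>\<^bsub>G\<^esub>"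
      using x zero coset_eq_iff by blast
    then have "h ?y \<oplus>\<^bsub>G\<^esub> (\<ominus>\<^bsub>G\<^esub> h x) = \<zero>\<^bsub>G\<^esub>"
      using x y by (simp add: a_minus_def)
    then show ?thesis
      unfolding h'_def using x y h.H.minus_equality[of "h ?y" "\<ominus>\<^bsub>G\<^esub> h x"] by simp
  qed
  have "abelian_group_hom (quotient_module M N) G h'"
    by (rule additive_homI)
      (auto simp: Q.M.abelian_group_axioms h.H.abelian_group_axioms quotient_simps(1) eq quotient_add)
  with eq show ?thesis by blast
qed

end

end

text \<open>Differentials and exterior powers are both quotients of a free module by a span of
  relations; their universal properties are instances of the one proved here.\<close>

locale presentation = cring R for R :: "('a, 'r) ring_scheme" (structure) +
  fixes X :: "'x set" and A :: "('x \<Rightarrow> 'a) set"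
  assumes rels: "A \<subseteq> carrier (free_module R X)"
begin

abbreviation F where "F \<equiv> free_module R X"
abbreviation rel_span where "rel_span \<equiv> submodule_span R F A"
abbreviation Q where "Q \<equiv> quotient_module F rel_span"
abbreviation cls where "cls c \<equiv> rel_span +>\<^bsub>F\<^esub> c"
abbreviation gen where "gen x \<equiv> cls (free_gen R X x)"

sublocale F: module R F by (rule free_module_module)

lemma span_sub: "submodule rel_span R F"
  by (rule F.submodule_span_submodule[OF rels])

lemma Q_module: "module R Q"
  by (rule F.quotient_module_module[OF span_sub])

lemma cls_hom: "abelian_group_hom F Q cls"
  using F.abelian_group_axioms module.axioms(2)[OF Q_module]
  by (intro additive_homI) (auto simp: F.quotient_simps(1)[OF span_sub] F.quotient_add[OF span_sub])

sublocale cls: abelian_group_hom F Q "\<lambda>c. cls c" by (rule cls_hom)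

lemma cls_smult: "\<lbrakk>r \<in> carrier R; c \<in> carrier F\<rbrakk> \<Longrightarrow> cls (r \<odot>\<^bsub>F\<^esub> c) = r \<odot>\<^bsub>Q\<^esub> cls c"
  by (simp add: F.quotient_smult[OF span_sub])

lemma cls_rel: "a \<in> A \<Longrightarrow> cls a = \<zero>\<^bsub>Q\<^esub>"
  using rels F.coset_zero_iff[OF span_sub] F.submodule_span_incl
  by (simp add: F.quotient_simps(2)[OF span_sub] subset_iff)

lemma gen_closed: "x \<in> X \<Longrightarrow> gen x \<in> carrier Q"
  by (simp add: free_gen_closed)

lemma induct [consumes 1, case_names zero gen add]:
  assumes "c \<in> carrier Q"
    and "P \<zero>\<^bsub>Q\<^esub>"
    and "\<And>r x. \<lbrakk>r \<in> carrier R; x \<in> X\<rbrakk> \<Longrightarrow> P (r \<odot>\<^bsub>Q\<^esub> gen x)"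
    and "\<And>a b. \<lbrakk>a \<in> carrier Q; b \<in> carrier Q; P a; P b\<rbrakk> \<Longrightarrow> P (a \<oplus>\<^bsub>Q\<^esub> b)"
  shows "P c"
proof -
  obtain y where y: "y \<in> carrier F" "c = cls y"
    using assms(1) by (auto simp: F.quotient_simps(1)[OF span_sub])
  have "P (cls y)" using y(1)
  proof (induction y rule: free_module_induct)
    case (gen r x)
    then show ?case using assms(3) cls_smult[OF gen(1) free_gen_closed[OF gen(2)]] by simp
  qed (use assms(2,4) in simp_all)
  then show ?thesis using y by simp
qed

text \<open>The map is only additive, so killing the relations themselves would not kill their span.
  Hence the condition asks that every multiple \<open>r a\<close> of a relation be killed.\<close>

lemma lift:
  assumes N: "abelian_group N"
    and \<phi>: "\<And>r x. \<lbrakk>r \<in> carrier R; x \<in> X\<rbrakk> \<Longrightarrow> \<phi> r x \<in> carrier N"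
    and \<phi>add: "\<And>r s x. \<lbrakk>r \<in> carrier R; s \<in> carrier R; x \<in> X\<rbrakk> \<Longrightarrow> \<phi> (r \<oplus> s) x = \<phi> r x \<oplus>\<^bsub>N\<^esub> \<phi> s x"
    and rel: "\<And>h r a. \<lbrakk>abelian_group_hom F N h;
        \<And>r x. \<lbrakk>r \<in> carrier R; x \<in> X\<rbrakk> \<Longrightarrow> h (r \<odot>\<^bsub>F\<^esub> free_gen R X x) = \<phi> r x;
        r \<in> carrier R; a \<in> A\<rbrakk> \<Longrightarrow> h (r \<odot>\<^bsub>F\<^esub> a) = \<zero>\<^bsub>N\<^esub>"
  shows "\<exists>h. abelian_group_hom Q N h \<and>
    (\<forall>r\<in>carrier R. \<forall>x\<in>X. h (r \<odot>\<^bsub>Q\<^esub> gen x) = \<phi> r x)"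
proof -
  let ?h = "free_lift N X \<phi>"
  have h: "abelian_group_hom F N ?h"
    by (rule free_lift(1)) (fact N \<phi> \<phi>add)+
  have hg: "?h (r \<odot>\<^bsub>F\<^esub> free_gen R X x) = \<phi> r x" if "r \<in> carrier R" "x \<in> X" for r x
    using free_lift(2)[of N X \<phi>, OF N \<phi> \<phi>add that] by blast
  interpret h: abelian_group_hom F N ?h by (rule h)
  \<comment> \<open>The largest submodule contained in the kernel of the additive map; it takes the
    place of the kernel.\<close>
  let ?K = "{y \<in> carrier F. \<forall>r\<in>carrier R. ?h (r \<odot>\<^bsub>F\<^esub> y) = \<zero>\<^bsub>N\<^esub>}"
  have "submodule ?K R F"
    by (rule F.submoduleI)
      (auto simp: F.smult_r_minus F.smult_r_distr F.smult_assoc1[symmetric])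
  moreover have "A \<subseteq> ?K"
    using rels rel[OF h hg] by auto
  ultimately have "rel_span \<subseteq> ?K"
    by (rule F.submodule_span_minimal)
  then have "?h y = \<zero>\<^bsub>N\<^esub>" if "y \<in> rel_span" for y
    using that F.smult_one[of y] by force
  from F.quotient_lift[OF span_sub h this] obtain h' where
    h': "abelian_group_hom Q N h'" "\<forall>c\<in>carrier F. h' (cls c) = ?h c" by blast
  have "h' (r \<odot>\<^bsub>Q\<^esub> gen x) = \<phi> r x" if "r \<in> carrier R" "x \<in> X" for r x
    using h'(2) hg[OF that] that by (simp add: cls_smult[symmetric] free_gen_closed)
  with h'(1) show ?thesis by blast
qed

end

subsection \<open>Universal property of differentials\<close>

locale differentials = cring R for R :: "('a, 'r) ring_scheme" (structure) +
  fixes k :: "'a set"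
  assumes const_subset: "k \<subseteq> carrier R"
begin

abbreviation \<Omega> where "\<Omega> \<equiv> kaehler R k"
abbreviation d where "d \<equiv> kaehler_d R k"

lemma kaehler_rels_closed: "kaehler_rels R k \<subseteq> carrier (free_module R (carrier R))"
proof -
  interpret F: module R "free_module R (carrier R)" by (rule free_module_module)
  note [simp] = free_gen_closed
  show ?thesis
    unfolding kaehler_rels_def Let_def using const_subset by (auto simp: subset_iff a_minus_def)
qed

interpretation pres: presentation R "carrier R" "kaehler_rels R k"
  by unfold_locales (rule kaehler_rels_closed)

lemma kaehler_module: "module R \<Omega>"
  unfolding kaehler_def by (rule pres.Q_module)

sublocale \<Omega>: module R \<Omega> by (rule kaehler_module)

lemma kaehler_eq: "\<Omega> = pres.Q"
  by (simp add: kaehler_def)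

lemma d_eq: "d f = pres.gen f"
  by (simp add: kaehler_d_def)

lemma d_closed [simp]: "f \<in> carrier R \<Longrightarrow> d f \<in> carrier \<Omega>"
  by (simp add: d_eq kaehler_eq free_gen_closed)

lemma d_add:
  assumes "f \<in> carrier R" "g \<in> carrier R"
  shows "d (f \<oplus> g) = d f \<oplus>\<^bsub>\<Omega>\<^esub> d g"
proof -
  let ?F = "free_module R (carrier R)" and ?\<delta> = "free_gen R (carrier R)"
  have "?\<delta> (f \<oplus> g) \<ominus>\<^bsub>?F\<^esub> (?\<delta> f \<oplus>\<^bsub>?F\<^esub> ?\<delta> g) \<in> kaehler_rels R k"
    unfolding kaehler_rels_def Let_def using assms by blast
  from pres.cls_rel[OF this] have "d (f \<oplus> g) \<oplus>\<^bsub>\<Omega>\<^esub> (\<ominus>\<^bsub>\<Omega>\<^esub> (d f \<oplus>\<^bsub>\<Omega>\<^esub> d g)) = \<zero>\<^bsub>\<Omega>\<^esub>"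
    using assms by (simp add: a_minus_def free_gen_closed d_eq kaehler_eq del: \<Omega>.minus_add)
  then show ?thesis
    using assms \<Omega>.M.minus_equality[of "d (f \<oplus> g)" "\<ominus>\<^bsub>\<Omega>\<^esub> (d f \<oplus>\<^bsub>\<Omega>\<^esub> d g)"] by simp
qed

lemma d_mult:
  assumes "f \<in> carrier R" "g \<in> carrier R"
  shows "d (f \<otimes> g) = f \<odot>\<^bsub>\<Omega>\<^esub> d g \<oplus>\<^bsub>\<Omega>\<^esub> g \<odot>\<^bsub>\<Omega>\<^esub> d f"
proof -
  let ?F = "free_module R (carrier R)" and ?\<delta> = "free_gen R (carrier R)"
  let ?u = "f \<odot>\<^bsub>\<Omega>\<^esub> d g \<oplus>\<^bsub>\<Omega>\<^esub> g \<odot>\<^bsub>\<Omega>\<^esub> d f"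
  have "?\<delta> (f \<otimes> g) \<ominus>\<^bsub>?F\<^esub> (f \<odot>\<^bsub>?F\<^esub> ?\<delta> g \<oplus>\<^bsub>?F\<^esub> g \<odot>\<^bsub>?F\<^esub> ?\<delta> f) \<in> kaehler_rels R k"
    unfolding kaehler_rels_def Let_def using assms by blast
  from pres.cls_rel[OF this] have "d (f \<otimes> g) \<oplus>\<^bsub>\<Omega>\<^esub> (\<ominus>\<^bsub>\<Omega>\<^esub> ?u) = \<zero>\<^bsub>\<Omega>\<^esub>"
    using assms by (simp add: a_minus_def free_gen_closed d_eq kaehler_eq pres.cls_smult del: \<Omega>.minus_add)
  then show ?thesis
    using assms \<Omega>.M.minus_equality[of "d (f \<otimes> g)" "\<ominus>\<^bsub>\<Omega>\<^esub> ?u"] by simp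
qed

lemma d_const: "c \<in> k \<Longrightarrow> d c = \<zero>\<^bsub>\<Omega>\<^esub>"
  unfolding d_eq kaehler_eq by (rule pres.cls_rel) (auto simp: kaehler_rels_def Let_def)

lemma d_one: "d \<one> = \<zero>\<^bsub>\<Omega>\<^esub>"
  using d_mult[of \<one> \<one>] \<Omega>.M.add.r_cancel_one'[of "d \<one>" "d \<one>"] by simp

lemma kaehler_induct [consumes 1, case_names zero gen add]:
  assumes "w \<in> carrier \<Omega>"
    and "P \<zero>\<^bsub>\<Omega>\<^esub>"
    and "\<And>r f. \<lbrakk>r \<in> carrier R; f \<in> carrier R\<rbrakk> \<Longrightarrow> P (r \<odot>\<^bsub>\<Omega>\<^esub> d f)"
    and "\<And>a b. \<lbrakk>a \<in> carrier \<Omega>; b \<in> carrier \<Omega>; P a; P b\<rbrakk> \<Longrightarrow> P (a \<oplus>\<^bsub>\<Omega>\<^esub> b)"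
  shows "P w"
  using assms unfolding kaehler_def kaehler_d_def by (rule pres.induct)

text \<open>\<open>\<phi> r f\<close> is the intended value on \<open>r df\<close>. As no linearity
  is available, the outer coefficient is absorbed into the Leibniz condition:
  \<open>r (f dg)\<close> is read as \<open>(r f) dg\<close>.\<close>

lemma kaehler_lift:
  assumes N: "abelian_group N"
    and \<phi>: "\<And>r f. \<lbrakk>r \<in> carrier R; f \<in> carrier R\<rbrakk> \<Longrightarrow> \<phi> r f \<in> carrier N"
    and add1: "\<And>r s f. \<lbrakk>r \<in> carrier R; s \<in> carrier R; f \<in> carrier R\<rbrakk> \<Longrightarrow> \<phi> (r \<oplus> s) f = \<phi> r f \<oplus>\<^bsub>N\<^esub> \<phi> s f"
    and add2: "\<And>r f g. \<lbrakk>r \<in> carrier R; f \<in> carrier R; g \<in> carrier R\<rbrakk> \<Longrightarrow> \<phi> r (f \<oplus> g) = \<phi> r f \<oplus>\<^bsub>N\<^esub> \<phi> r g"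
    and leibniz: "\<And>r f g. \<lbrakk>r \<in> carrier R; f \<in> carrier R; g \<in> carrier R\<rbrakk>
      \<Longrightarrow> \<phi> r (f \<otimes> g) = \<phi> (r \<otimes> f) g \<oplus>\<^bsub>N\<^esub> \<phi> (r \<otimes> g) f"
    and const: "\<And>r c. \<lbrakk>r \<in> carrier R; c \<in> k\<rbrakk> \<Longrightarrow> \<phi> r c = \<zero>\<^bsub>N\<^esub>"
  shows "\<exists>h. abelian_group_hom \<Omega> N h \<and>
    (\<forall>r\<in>carrier R. \<forall>f\<in>carrier R. h (r \<odot>\<^bsub>\<Omega>\<^esub> d f) = \<phi> r f)"
  unfolding kaehler_def kaehler_d_def
proof (rule pres.lift[OF N \<phi> add1])
  let ?F = "free_module R (carrier R)" and ?\<delta> = "free_gen R (carrier R)"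
  fix h r a
  assume h: "abelian_group_hom ?F N h"
    and gen: "\<And>r x. \<lbrakk>r \<in> carrier R; x \<in> carrier R\<rbrakk> \<Longrightarrow> h (r \<odot>\<^bsub>?F\<^esub> ?\<delta> x) = \<phi> r x"
    and r: "r \<in> carrier R" and a: "a \<in> kaehler_rels R k"
  interpret h: abelian_group_hom ?F N h by fact
  note simps = a_minus_def pres.F.smult_r_distr pres.F.smult_r_minus pres.F.smult_assoc1[symmetric] free_gen_closed
    gen r \<phi> h.H.r_neg
  from a consider f g where "f \<in> carrier R" "g \<in> carrier R"
      "a = ?\<delta> (f \<oplus> g) \<ominus>\<^bsub>?F\<^esub> (?\<delta> f \<oplus>\<^bsub>?F\<^esub> ?\<delta> g)"
    | f g where "f \<in> carrier R" "g \<in> carrier R"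
      "a = ?\<delta> (f \<otimes> g) \<ominus>\<^bsub>?F\<^esub> (f \<odot>\<^bsub>?F\<^esub> ?\<delta> g \<oplus>\<^bsub>?F\<^esub> g \<odot>\<^bsub>?F\<^esub> ?\<delta> f)"
    | c where "c \<in> k" "a = ?\<delta> c"
    unfolding kaehler_rels_def Let_def by blast
  then show "h (r \<odot>\<^bsub>?F\<^esub> a) = \<zero>\<^bsub>N\<^esub>"
  proof cases
    case 1
    then show ?thesis by (simp add: simps add2 del: pres.F.minus_add h.H.minus_add)
  next
    case 2
    then show ?thesis by (simp add: simps leibniz del: pres.F.minus_add h.H.minus_add)
  next
    case 3
    then show ?thesis using const_subset by (simp add: gen r const subset_iff)
  qed
qed

end

subsection \<open>Alternating maps\<close>

definition signed :: "('b, 'm) ring_scheme \<Rightarrow> nat \<Rightarrow> 'b \<Rightarrow> 'b"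
  where "signed N j x = (if even j then x else \<ominus>\<^bsub>N\<^esub> x)"

lemma tuples_iff: "ws \<in> tuples M m \<longleftrightarrow> length ws = m \<and> set ws \<subseteq> carrier M"
  by (simp add: tuples_def)

text \<open>Additivity in each slot stands in for multilinearity, since some of the maps needed for
  the exterior derivative are not linear. Vanishing on equal neighbours is enough: equal entries
  further apart are brought together by swaps.\<close>

locale alternating = M: abelian_group M + N: abelian_group N
  for M :: "('b, 'm) ring_scheme" and N :: "('c, 'n) ring_scheme" +
  fixes m :: nat and f :: "'b list \<Rightarrow> 'c"
  assumes closed: "\<lbrakk>length ws = m; set ws \<subseteq> carrier M\<rbrakk> \<Longrightarrow> f ws \<in> carrier N"
    and additive: "\<lbrakk>Suc (length xs + length ys) = m; set xs \<subseteq> carrier M; set ys \<subseteq> carrier M;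
        u \<in> carrier M; v \<in> carrier M\<rbrakk>
      \<Longrightarrow> f (xs @ (u \<oplus>\<^bsub>M\<^esub> v) # ys) = f (xs @ u # ys) \<oplus>\<^bsub>N\<^esub> f (xs @ v # ys)"
    and adjacent: "\<lbrakk>Suc (Suc (length xs + length ys)) = m; set xs \<subseteq> carrier M; set ys \<subseteq> carrier M;
        u \<in> carrier M\<rbrakk> \<Longrightarrow> f (xs @ u # u # ys) = \<zero>\<^bsub>N\<^esub>"
begin

text \<open>Polarisation: the value with both neighbours equal to the sum of \<open>u\<close> and
  \<open>v\<close> vanishes, and of its four terms only the two mixed ones survive.\<close>

lemma swap:
  assumes "Suc (Suc (length xs + length ys)) = m" "set xs \<subseteq> carrier M" "set ys \<subseteq> carrier M"
    "u \<in> carrier M" "v \<in> carrier M"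
  shows "f (xs @ u # v # ys) = \<ominus>\<^bsub>N\<^esub> f (xs @ v # u # ys)"
proof -
  have c: "f (xs @ a # b # ys) \<in> carrier N" if "a \<in> carrier M" "b \<in> carrier M" for a b
    using assms that by (intro closed) auto
  have "\<zero>\<^bsub>N\<^esub> = f (xs @ (u \<oplus>\<^bsub>M\<^esub> v) # (u \<oplus>\<^bsub>M\<^esub> v) # ys)"
    using assms adjacent by simp
  also have "\<dots> = f (xs @ u # (u \<oplus>\<^bsub>M\<^esub> v) # ys) \<oplus>\<^bsub>N\<^esub> f (xs @ v # (u \<oplus>\<^bsub>M\<^esub> v) # ys)"
    using assms by (intro additive) auto
  also have "f (xs @ u # (u \<oplus>\<^bsub>M\<^esub> v) # ys) = f (xs @ u # u # ys) \<oplus>\<^bsub>N\<^esub> f (xs @ u # v # ys)"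
    using assms additive[of "xs @ [u]" ys u v] by simp
  also have "f (xs @ v # (u \<oplus>\<^bsub>M\<^esub> v) # ys) = f (xs @ v # u # ys) \<oplus>\<^bsub>N\<^esub> f (xs @ v # v # ys)"
    using assms additive[of "xs @ [v]" ys u v] by simp
  finally have "f (xs @ u # v # ys) \<oplus>\<^bsub>N\<^esub> f (xs @ v # u # ys) = \<zero>\<^bsub>N\<^esub>"
    using assms adjacent c by simp
  then show ?thesis
    using N.minus_equality[of "f (xs @ u # v # ys)" "f (xs @ v # u # ys)"] c assms by simp
qed

text \<open>Each entry of \<open>xs\<close> that \<open>u\<close> passes costs one swap; the
  induction takes the entry next to \<open>u\<close> first.\<close>

lemma move_front:
  assumes "Suc (length xs + length ys) = m" "set xs \<subseteq> carrier M" "set ys \<subseteq> carrier M" "u \<in> carrier M"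
  shows "f (u # xs @ ys) = signed N (length xs) (f (xs @ u # ys))"
  using assms
proof (induction xs arbitrary: ys rule: rev_induct)
  case Nil
  then show ?case by (simp add: signed_def)
next
  case (snoc x xs)
  have "f (xs @ u # x # ys) = \<ominus>\<^bsub>N\<^esub> f (xs @ x # u # ys)"
    using snoc.prems by (intro swap) auto
  moreover have "f (u # xs @ x # ys) = signed N (length xs) (f (xs @ u # x # ys))"
    using snoc.prems by (intro snoc.IH) auto
  moreover have "f (xs @ x # u # ys) \<in> carrier N"
    using snoc.prems by (intro closed) auto
  ultimately show ?case by (simp add: signed_def)
qed

text \<open>The first copy of \<open>u\<close> is swapped rightwards until it stands next to the
  second; signs do not matter because the value becomes zero.\<close>

lemma repeated:
  assumes "Suc (Suc (length xs + length ys + length zs)) = m"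
    "set xs \<subseteq> carrier M" "set ys \<subseteq> carrier M" "set zs \<subseteq> carrier M" "u \<in> carrier M"
  shows "f (xs @ u # ys @ u # zs) = \<zero>\<^bsub>N\<^esub>"
  using assms
proof (induction ys arbitrary: xs)
  case Nil
  then show ?case by (simp add: adjacent)
next
  case (Cons y ys)
  have "f (xs @ u # y # ys @ u # zs) = \<ominus>\<^bsub>N\<^esub> f (xs @ y # u # ys @ u # zs)"
    using Cons.prems by (intro swap) auto
  also have "f (xs @ y # u # ys @ u # zs) = \<zero>\<^bsub>N\<^esub>"
    using Cons.IH[of "xs @ [y]"] Cons.prems by simp
  finally show ?case by simp
qed

lemma not_distinct:
  assumes "length ws = m" "set ws \<subseteq> carrier M" "\<not> distinct ws"
  shows "f ws = \<zero>\<^bsub>N\<^esub>"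
proof -
  obtain xs u ys zs where "ws = xs @ [u] @ ys @ [u] @ zs"
    using not_distinct_decomp[OF assms(3)] by blast
  then show ?thesis using repeated assms by auto
qed

lemma zero_slot:
  assumes "Suc (length xs + length ys) = m" "set xs \<subseteq> carrier M" "set ys \<subseteq> carrier M"
  shows "f (xs @ \<zero>\<^bsub>M\<^esub> # ys) = \<zero>\<^bsub>N\<^esub>"
proof -
  have "f (xs @ \<zero>\<^bsub>M\<^esub> # ys) \<in> carrier N" using assms by (intro closed) auto
  moreover have "f (xs @ \<zero>\<^bsub>M\<^esub> # ys) = f (xs @ \<zero>\<^bsub>M\<^esub> # ys) \<oplus>\<^bsub>N\<^esub> f (xs @ \<zero>\<^bsub>M\<^esub> # ys)"
    using assms additive[of xs ys "\<zero>\<^bsub>M\<^esub>" "\<zero>\<^bsub>M\<^esub>"] by simp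
  ultimately show ?thesis using N.add.r_cancel_one' by metis
qed

end

subsection \<open>Universal property of exterior powers\<close>

context module
begin

abbreviation E where "E m \<equiv> ext_power R M m"
abbreviation W where "W \<equiv> wedge R M"

lemma tuples_update: "\<lbrakk>ws \<in> tuples M m; u \<in> carrier M\<rbrakk> \<Longrightarrow> ws[i := u] \<in> tuples M m"
  by (auto simp: tuples_iff dest!: set_update_subset_insert[THEN subsetD])

lemma ext_rels_closed: "ext_rels R M m \<subseteq> carrier (free_module R (tuples M m))"
proof -
  interpret F: module R "free_module R (tuples M m)" by (rule free_module_module)
  show ?thesis
    unfolding ext_rels_def Let_def
    by (auto simp: a_minus_def free_gen_closed tuples_update)
qed

lemma ext_presentation: "presentation R (tuples M m) (ext_rels R M m)"
  by unfold_locales (rule ext_rels_closed)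

lemma ext_module: "module R (E m)"
  unfolding ext_power_def by (rule presentation.Q_module[OF ext_presentation])

lemma wedge_closed:
  "\<lbrakk>length ws = m; set ws \<subseteq> carrier M\<rbrakk> \<Longrightarrow> W ws \<in> carrier (E m)"
  unfolding ext_power_def wedge_def Let_def
  using presentation.gen_closed[OF ext_presentation, of ws m] by (simp add: tuples_iff)

lemma ext_induct [consumes 1, case_names zero gen add]:
  assumes "w \<in> carrier (E m)"
    and "P \<zero>\<^bsub>E m\<^esub>"
    and gen: "\<And>r ws. \<lbrakk>r \<in> carrier R; length ws = m; set ws \<subseteq> carrier M\<rbrakk> \<Longrightarrow> P (r \<odot>\<^bsub>E m\<^esub> W ws)"
    and "\<And>a b. \<lbrakk>a \<in> carrier (E m); b \<in> carrier (E m); P a; P b\<rbrakk> \<Longrightarrow> P (a \<oplus>\<^bsub>E m\<^esub> b)"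
  shows "P w"
  using assms(1,2) _ assms(4) unfolding ext_power_def
proof (rule presentation.induct[OF ext_presentation])
qed (use gen in \<open>auto simp: tuples_iff ext_power_def wedge_def Let_def\<close>)

context
  fixes m :: nat
begin

interpretation pres: presentation R "tuples M m" "ext_rels R M m"
  by (rule ext_presentation)

interpretation E: module R "E m" by (rule ext_module)

lemma ext_eq: "E m = pres.Q"
  by (simp add: ext_power_def)

lemma wedge_eq: "length ws = m \<Longrightarrow> W ws = pres.gen ws"
  by (simp add: wedge_def Let_def)

lemma wedge_smult:
  assumes "Suc (length xs + length ys) = m" "set xs \<subseteq> carrier M" "set ys \<subseteq> carrier M"
    "r \<in> carrier R" "u \<in> carrier M"
  shows "W (xs @ (r \<odot>\<^bsub>M\<^esub> u) # ys) = r \<odot>\<^bsub>E m\<^esub> W (xs @ u # ys)"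
proof -
  let ?F = pres.F and ?\<delta> = "free_gen R (tuples M m)"
  have tup: "xs @ x # ys \<in> tuples M m" if "x \<in> carrier M" for x
    using assms that by (auto simp: tuples_iff)
  \<comment> \<open>The relations are phrased with list updates. The witness is the tuple with
    \<open>u\<close> in place, updated at position \<open>length xs\<close>.\<close>
  have "\<exists>ws i r' u'. ?\<delta> (xs @ (r \<odot>\<^bsub>M\<^esub> u) # ys) \<ominus>\<^bsub>?F\<^esub> r \<odot>\<^bsub>?F\<^esub> ?\<delta> (xs @ u # ys)
      = ?\<delta> (ws[i := r' \<odot>\<^bsub>M\<^esub> u']) \<ominus>\<^bsub>?F\<^esub> r' \<odot>\<^bsub>?F\<^esub> ?\<delta> (ws[i := u']) \<and>
      ws \<in> tuples M m \<and> i < m \<and> r' \<in> carrier R \<and> u' \<in> carrier M"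
    using assms tup[of u]
    by (intro exI[of _ "xs @ u # ys"] exI[of _ "length xs"] exI[of _ r] exI[of _ u]) auto
  then have "?\<delta> (xs @ (r \<odot>\<^bsub>M\<^esub> u) # ys) \<ominus>\<^bsub>?F\<^esub> r \<odot>\<^bsub>?F\<^esub> ?\<delta> (xs @ u # ys) \<in> ext_rels R M m"
    unfolding ext_rels_def Let_def by blast
  from pres.cls_rel[OF this]
  have "W (xs @ (r \<odot>\<^bsub>M\<^esub> u) # ys) \<oplus>\<^bsub>E m\<^esub> (\<ominus>\<^bsub>E m\<^esub> (r \<odot>\<^bsub>E m\<^esub> W (xs @ u # ys))) = \<zero>\<^bsub>E m\<^esub>"
    using assms by (simp add: a_minus_def free_gen_closed wedge_eq ext_eq tup pres.cls_smult)
  then show ?thesis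
    using assms E.M.minus_equality[of "W (xs @ (r \<odot>\<^bsub>M\<^esub> u) # ys)" "\<ominus>\<^bsub>E m\<^esub> (r \<odot>\<^bsub>E m\<^esub> W (xs @ u # ys))"]
    by (simp add: wedge_closed)
qed

lemma wedge_alternating: "alternating M (E m) m W"
proof
  let ?F = pres.F and ?\<delta> = "free_gen R (tuples M m)"
  fix xs ys u v
  assume as: "Suc (length xs + length ys) = m" "set xs \<subseteq> carrier M" "set ys \<subseteq> carrier M"
    "u \<in> carrier M" "v \<in> carrier M"
  have tup: "xs @ x # ys \<in> tuples M m" if "x \<in> carrier M" for x
    using as that by (auto simp: tuples_iff)
  let ?a = "?\<delta> (xs @ (u \<oplus>\<^bsub>M\<^esub> v) # ys) \<ominus>\<^bsub>?F\<^esub> (?\<delta> (xs @ u # ys) \<oplus>\<^bsub>?F\<^esub> ?\<delta> (xs @ v # ys))"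
  have "\<exists>ws i u' v'. ?a = ?\<delta> (ws[i := u' \<oplus>\<^bsub>M\<^esub> v']) \<ominus>\<^bsub>?F\<^esub> (?\<delta> (ws[i := u']) \<oplus>\<^bsub>?F\<^esub> ?\<delta> (ws[i := v'])) \<and>
      ws \<in> tuples M m \<and> i < m \<and> u' \<in> carrier M \<and> v' \<in> carrier M"
    using as tup[of u]
    by (intro exI[of _ "xs @ u # ys"] exI[of _ "length xs"] exI[of _ u] exI[of _ v]) auto
  then have "?a \<in> ext_rels R M m"
    unfolding ext_rels_def Let_def by blast
  from pres.cls_rel[OF this]
  have "W (xs @ (u \<oplus>\<^bsub>M\<^esub> v) # ys) \<oplus>\<^bsub>E m\<^esub> (\<ominus>\<^bsub>E m\<^esub> (W (xs @ u # ys) \<oplus>\<^bsub>E m\<^esub> W (xs @ v # ys))) = \<zero>\<^bsub>E m\<^esub>"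
    using as by (simp add: a_minus_def free_gen_closed wedge_eq ext_eq tup del: E.minus_add)
  then show "W (xs @ (u \<oplus>\<^bsub>M\<^esub> v) # ys) = W (xs @ u # ys) \<oplus>\<^bsub>E m\<^esub> W (xs @ v # ys)"
    using as E.M.minus_equality[of "W (xs @ (u \<oplus>\<^bsub>M\<^esub> v) # ys)"
        "\<ominus>\<^bsub>E m\<^esub> (W (xs @ u # ys) \<oplus>\<^bsub>E m\<^esub> W (xs @ v # ys))"]
    by (simp add: wedge_closed)
next
  fix xs ys u
  assume as: "Suc (Suc (length xs + length ys)) = m" "set xs \<subseteq> carrier M" "set ys \<subseteq> carrier M"
    "u \<in> carrier M"
  have "\<exists>ws i j. free_gen R (tuples M m) (xs @ u # u # ys) = free_gen R (tuples M m) ws \<and>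
      ws \<in> tuples M m \<and> i < j \<and> j < m \<and> ws ! i = ws ! j"
    using as by (intro exI[of _ "xs @ u # u # ys"] exI[of _ "length xs"] exI[of _ "Suc (length xs)"])
      (auto simp: tuples_iff nth_append)
  then have "free_gen R (tuples M m) (xs @ u # u # ys) \<in> ext_rels R M m"
    unfolding ext_rels_def Let_def by blast
  from pres.cls_rel[OF this] show "W (xs @ u # u # ys) = \<zero>\<^bsub>E m\<^esub>"
    using as by (simp add: wedge_eq ext_eq)
qed (rule wedge_closed)

text \<open>\<open>\<phi> r ws\<close> is the intended value on \<open>r W ws\<close>. The last
  condition is the balancing that replaces linearity: a scalar may be moved from any entry into the
  coefficient.\<close>

lemma ext_lift:
  assumes N: "abelian_group N"
    and alt: "\<And>r. r \<in> carrier R \<Longrightarrow> alternating M N m (\<phi> r)"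
    and add: "\<And>r s ws. \<lbrakk>r \<in> carrier R; s \<in> carrier R; length ws = m; set ws \<subseteq> carrier M\<rbrakk>
      \<Longrightarrow> \<phi> (r \<oplus> s) ws = \<phi> r ws \<oplus>\<^bsub>N\<^esub> \<phi> s ws"
    and smult: "\<And>r s u xs ys. \<lbrakk>r \<in> carrier R; s \<in> carrier R; u \<in> carrier M;
        Suc (length xs + length ys) = m; set xs \<subseteq> carrier M; set ys \<subseteq> carrier M\<rbrakk>
      \<Longrightarrow> \<phi> r (xs @ (s \<odot>\<^bsub>M\<^esub> u) # ys) = \<phi> (r \<otimes> s) (xs @ u # ys)"
  shows "\<exists>h. abelian_group_hom (E m) N h \<and>
    (\<forall>r\<in>carrier R. \<forall>ws. length ws = m \<and> set ws \<subseteq> carrier M \<longrightarrow> h (r \<odot>\<^bsub>E m\<^esub> W ws) = \<phi> r ws)"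
proof -
  let ?F = pres.F and ?\<delta> = "free_gen R (tuples M m)"
  have closed: "\<phi> r ws \<in> carrier N" if "r \<in> carrier R" "ws \<in> tuples M m" for r ws
    using alternating.closed[OF alt] that by (auto simp: tuples_iff)
  have "\<exists>h. abelian_group_hom pres.Q N h \<and>
      (\<forall>r\<in>carrier R. \<forall>x\<in>tuples M m. h (r \<odot>\<^bsub>pres.Q\<^esub> pres.gen x) = \<phi> r x)"
  proof (rule pres.lift[OF N closed])
    fix h r a
    assume h: "abelian_group_hom ?F N h"
      and gen: "\<And>r x. \<lbrakk>r \<in> carrier R; x \<in> tuples M m\<rbrakk> \<Longrightarrow> h (r \<odot>\<^bsub>?F\<^esub> ?\<delta> x) = \<phi> r x"
      and r: "r \<in> carrier R" and a: "a \<in> ext_rels R M m"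
    interpret h: abelian_group_hom ?F N h by fact
    interpret \<phi>: alternating M N m "\<phi> r" using alt r by blast
    note simps = a_minus_def pres.F.smult_r_distr pres.F.smult_r_minus pres.F.smult_assoc1[symmetric] free_gen_closed
      gen r closed h.H.r_neg tuples_update
    \<comment> \<open>Translates the list updates of the relations into the split lists used by
      \<open>alternating\<close>.\<close>
    have split: "ws[i := x] = take i ws @ x # drop (Suc i) ws"
        "Suc (length (take i ws) + length (drop (Suc i) ws)) = m"
        "set (take i ws) \<subseteq> carrier M" "set (drop (Suc i) ws) \<subseteq> carrier M"
      if "ws \<in> tuples M m" "i < m" for ws i x
      using that set_take_subset[of i ws] set_drop_subset[of "Suc i" ws]
      by (auto simp: tuples_iff upd_conv_take_nth_drop)
    from a consider ws i u v where "ws \<in> tuples M m" "i < m" "u \<in> carrier M" "v \<in> carrier M"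
        "a = ?\<delta> (ws[i := u \<oplus>\<^bsub>M\<^esub> v]) \<ominus>\<^bsub>?F\<^esub> (?\<delta> (ws[i := u]) \<oplus>\<^bsub>?F\<^esub> ?\<delta> (ws[i := v]))"
      | ws i s u where "ws \<in> tuples M m" "i < m" "s \<in> carrier R" "u \<in> carrier M"
        "a = ?\<delta> (ws[i := s \<odot>\<^bsub>M\<^esub> u]) \<ominus>\<^bsub>?F\<^esub> s \<odot>\<^bsub>?F\<^esub> ?\<delta> (ws[i := u])"
      | ws i j where "ws \<in> tuples M m" "i < j" "j < m" "ws ! i = ws ! j" "a = ?\<delta> ws"
      unfolding ext_rels_def Let_def by (elim UnE CollectE exE conjE) (rule that; assumption)+
    then show "h (r \<odot>\<^bsub>?F\<^esub> a) = \<zero>\<^bsub>N\<^esub>"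
    proof cases
      case 1
      have "\<phi> r (ws[i := u \<oplus>\<^bsub>M\<^esub> v]) = \<phi> r (ws[i := u]) \<oplus>\<^bsub>N\<^esub> \<phi> r (ws[i := v])"
        using 1 split \<phi>.additive by simp
      with 1 show ?thesis by (simp add: simps del: pres.F.minus_add h.H.minus_add)
    next
      case 2
      have "\<phi> r (ws[i := s \<odot>\<^bsub>M\<^esub> u]) = \<phi> (r \<otimes> s) (ws[i := u])"
        using 2 r split smult by simp
      with 2 show ?thesis by (simp add: simps)
    next
      case 3
      then have "\<not> distinct ws"
        using nth_eq_iff_index_eq[of ws i j] by (auto simp: tuples_iff)
      with 3 show ?thesis
        using \<phi>.not_distinct[of ws] by (simp add: gen r tuples_iff)
    qed
  qed (use add in \<open>auto simp: tuples_iff\<close>)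
  then obtain h where h: "abelian_group_hom pres.Q N h"
    "\<forall>r\<in>carrier R. \<forall>x\<in>tuples M m. h (r \<odot>\<^bsub>pres.Q\<^esub> pres.gen x) = \<phi> r x" by blast
  then show ?thesis
    by (intro exI[of _ h]) (auto simp: ext_power_def wedge_eq tuples_iff)
qed

end

end

subsection \<open>Alternating sums\<close>

text \<open>\<open>alt_sum N B [] ws\<close> is the sum of the \<open>(-1)\<^sup>j B w\<^sub>j (w\<^sub>0, \<dots>, w\<^sub>m without w\<^sub>j)\<close>.
  The recursion, with the entries already passed accumulated in \<open>p\<close>, makes the sum visibly
  alternating: two equal neighbours cancel after two steps.\<close>

fun alt_sum :: "('c, 'n) ring_scheme \<Rightarrow> ('b \<Rightarrow> 'b list \<Rightarrow> 'c) \<Rightarrow> 'b list \<Rightarrow> 'b list \<Rightarrow> 'c"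
  where
    "alt_sum N B p [] = \<zero>\<^bsub>N\<^esub>"
  | "alt_sum N B p (w # ws) = B w (p @ ws) \<oplus>\<^bsub>N\<^esub> (\<ominus>\<^bsub>N\<^esub> alt_sum N B (p @ [w]) ws)"

lemma (in abelian_group) a_inv_zero [simp]: "\<ominus> \<zero> = \<zero>"
  using minus_equality[of \<zero> \<zero>] by simp

lemma (in abelian_group) signed_closed [simp]: "x \<in> carrier G \<Longrightarrow> signed G j x \<in> carrier G"
  by (simp add: signed_def)

lemma (in abelian_group) signed_Suc: "x \<in> carrier G \<Longrightarrow> signed G (Suc j) x = \<ominus> signed G j x"
  by (simp add: signed_def)

lemma (in abelian_group) finsum_a_inv:
  assumes "finite S" "f \<in> S \<rightarrow> carrier G"
  shows "finsum G (\<lambda>i. \<ominus> f i) S = \<ominus> finsum G f S"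
  using assms by (induction S rule: finite_induct) (auto simp: minus_add Pi_def)

lemma (in abelian_group) finsum_lessThan_Suc_shift:
  assumes "f \<in> {..<Suc n} \<rightarrow> carrier G"
  shows "finsum G f {..<Suc n} = f 0 \<oplus> finsum G (\<lambda>i. f (Suc i)) {..<n}"
proof -
  have "finsum G f {..<Suc n} = finsum G f (insert 0 (Suc ` {..<n}))"
    by (simp only: lessThan_Suc_eq_insert_0)
  also have "\<dots> = f 0 \<oplus> finsum G f (Suc ` {..<n})"
    using assms by (intro finsum_insert) (auto simp: Pi_def)
  also have "finsum G f (Suc ` {..<n}) = finsum G (\<lambda>i. f (Suc i)) {..<n}"
    using assms by (intro finsum_reindex) (auto simp: Pi_def)
  finally show ?thesis .
qed

text \<open>Two constructions share this pattern: \<open>B w vs = g w \<odot> W vs\<close> yields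
  the contraction, and \<open>B w vs = dw \<and> vs\<close> yields the correction term of the
  exterior derivative.\<close>

locale insertion = M: abelian_group M + N: abelian_group N
  for M :: "('b, 'm) ring_scheme" and N :: "('c, 'n) ring_scheme" +
  fixes m :: nat and B :: "'b \<Rightarrow> 'b list \<Rightarrow> 'c"
  assumes alternating: "w \<in> carrier M \<Longrightarrow> alternating M N m (B w)"
    and additive: "\<lbrakk>u \<in> carrier M; v \<in> carrier M; length ws = m; set ws \<subseteq> carrier M\<rbrakk>
      \<Longrightarrow> B (u \<oplus>\<^bsub>M\<^esub> v) ws = B u ws \<oplus>\<^bsub>N\<^esub> B v ws"
begin

abbreviation S where "S \<equiv> alt_sum N B"

lemma B_closed: "\<lbrakk>w \<in> carrier M; length ws = m; set ws \<subseteq> carrier M\<rbrakk> \<Longrightarrow> B w ws \<in> carrier N"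
  by (rule alternating.closed[OF alternating])

lemma S_closed:
  "\<lbrakk>length p + length ws = Suc m; set p \<subseteq> carrier M; set ws \<subseteq> carrier M\<rbrakk> \<Longrightarrow> S p ws \<in> carrier N"
  by (induction ws arbitrary: p) (auto intro!: N.a_closed B_closed)

text \<open>An entry already passed is never singled out again; it only occurs among the alternating
  arguments of \<open>B\<close>.\<close>

lemma S_additive_prefix:
  assumes "Suc (length p + length q + length ws) = Suc m"
    "set p \<subseteq> carrier M" "set q \<subseteq> carrier M" "set ws \<subseteq> carrier M" "u \<in> carrier M" "v \<in> carrier M"
  shows "S (p @ (u \<oplus>\<^bsub>M\<^esub> v) # q) ws = S (p @ u # q) ws \<oplus>\<^bsub>N\<^esub> S (p @ v # q) ws"
  using assms
proof (induction ws arbitrary: q)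
  case (Cons w ws)
  have "B w (p @ (u \<oplus>\<^bsub>M\<^esub> v) # q @ ws) = B w (p @ u # q @ ws) \<oplus>\<^bsub>N\<^esub> B w (p @ v # q @ ws)"
    using Cons.prems by (intro alternating.additive[OF alternating]) auto
  moreover have "S (p @ (u \<oplus>\<^bsub>M\<^esub> v) # q @ [w]) ws = S (p @ u # q @ [w]) ws \<oplus>\<^bsub>N\<^esub> S (p @ v # q @ [w]) ws"
    using Cons.prems by (intro Cons.IH) auto
  moreover have "B w (p @ x # q @ ws) \<in> carrier N" "S (p @ x # q @ [w]) ws \<in> carrier N"
    if "x \<in> carrier M" for x
    using Cons.prems that by (auto intro!: B_closed S_closed)
  ultimately show ?case
    using Cons.prems by (simp add: N.minus_add N.a_ac)
qed simp

text \<open>The entry in question is singled out exactly once, where additivity of \<open>B\<close>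
  in its first argument is used; in all other terms it is an ordinary argument.\<close>

lemma S_additive:
  assumes "Suc (length p + length xs + length ys) = Suc m"
    "set p \<subseteq> carrier M" "set xs \<subseteq> carrier M" "set ys \<subseteq> carrier M" "u \<in> carrier M" "v \<in> carrier M"
  shows "S p (xs @ (u \<oplus>\<^bsub>M\<^esub> v) # ys) = S p (xs @ u # ys) \<oplus>\<^bsub>N\<^esub> S p (xs @ v # ys)"
  using assms
proof (induction xs arbitrary: p)
  case Nil
  have "B (u \<oplus>\<^bsub>M\<^esub> v) (p @ ys) = B u (p @ ys) \<oplus>\<^bsub>N\<^esub> B v (p @ ys)"
    using Nil by (intro additive) auto
  moreover have "S (p @ [u \<oplus>\<^bsub>M\<^esub> v]) ys = S (p @ [u]) ys \<oplus>\<^bsub>N\<^esub> S (p @ [v]) ys"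
    using Nil by (intro S_additive_prefix) auto
  moreover have "B x (p @ ys) \<in> carrier N" "S (p @ [x]) ys \<in> carrier N" if "x \<in> carrier M" for x
    using Nil that by (auto intro!: B_closed S_closed)
  ultimately show ?case
    using Nil by (simp add: N.minus_add N.a_ac)
next
  case (Cons x xs)
  have "B x (p @ xs @ (u \<oplus>\<^bsub>M\<^esub> v) # ys) = B x (p @ xs @ u # ys) \<oplus>\<^bsub>N\<^esub> B x (p @ xs @ v # ys)"
    using Cons.prems alternating.additive[OF alternating, of x "p @ xs" ys u v] by simp
  moreover have "S (p @ [x]) (xs @ (u \<oplus>\<^bsub>M\<^esub> v) # ys) = S (p @ [x]) (xs @ u # ys) \<oplus>\<^bsub>N\<^esub> S (p @ [x]) (xs @ v # ys)"
    using Cons.prems by (intro Cons.IH) auto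
  moreover have "B x (p @ xs @ a # ys) \<in> carrier N" "S (p @ [x]) (xs @ a # ys) \<in> carrier N"
    if "a \<in> carrier M" for a
    using Cons.prems that by (auto intro!: B_closed S_closed)
  ultimately show ?case
    using Cons.prems by (simp add: N.minus_add N.a_ac)
qed

lemma S_adjacent_prefix:
  assumes "Suc (Suc (length p + length q + length ws)) = Suc m"
    "set p \<subseteq> carrier M" "set q \<subseteq> carrier M" "set ws \<subseteq> carrier M" "u \<in> carrier M"
  shows "S (p @ u # u # q) ws = \<zero>\<^bsub>N\<^esub>"
  using assms
proof (induction ws arbitrary: q)
  case (Cons w ws)
  have "B w (p @ u # u # q @ ws) = \<zero>\<^bsub>N\<^esub>"
    using Cons.prems by (intro alternating.adjacent[OF alternating]) auto
  moreover have "S (p @ u # u # q @ [w]) ws = \<zero>\<^bsub>N\<^esub>"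
    using Cons.prems by (intro Cons.IH) auto
  ultimately show ?case by simp
qed simp

lemma S_adjacent:
  assumes "Suc (Suc (length p + length xs + length ys)) = Suc m"
    "set p \<subseteq> carrier M" "set xs \<subseteq> carrier M" "set ys \<subseteq> carrier M" "u \<in> carrier M"
  shows "S p (xs @ u # u # ys) = \<zero>\<^bsub>N\<^esub>"
  using assms
proof (induction xs arbitrary: p)
  case Nil
  have "S (p @ [u, u]) ys = \<zero>\<^bsub>N\<^esub>"
    using Nil by (intro S_adjacent_prefix) auto
  moreover have "B u (p @ u # ys) \<in> carrier N"
    using Nil by (auto intro!: B_closed)
  ultimately show ?case
    using Nil by (simp add: N.minus_add N.r_neg)
next
  case (Cons x xs)
  have "B x (p @ xs @ u # u # ys) = \<zero>\<^bsub>N\<^esub>"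
    using Cons.prems alternating.adjacent[OF alternating, of x "p @ xs" ys u] by simp
  moreover have "S (p @ [x]) (xs @ u # u # ys) = \<zero>\<^bsub>N\<^esub>"
    using Cons.prems by (intro Cons.IH) auto
  ultimately show ?case by simp
qed

lemma S_alternating: "alternating M N (Suc m) (S [])"
  by unfold_locales (auto intro: S_closed S_additive S_adjacent)

text \<open>Connects the recursion, which suits inductions, with the indexed sum that defines
  \<open>contraction\<close>.\<close>

lemma S_finsum:
  assumes "length p + length ws = Suc m" "set p \<subseteq> carrier M" "set ws \<subseteq> carrier M"
  shows "S p ws = (\<Oplus>\<^bsub>N\<^esub>j\<in>{..<length ws}. signed N j (B (ws ! j) (p @ take j ws @ drop (Suc j) ws)))"
  using assms
proof (induction ws arbitrary: p)
  case (Cons w ws)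
  let ?f = "\<lambda>j. B (ws ! j) (p @ w # take j ws @ drop (Suc j) ws)"
  have f: "?f j \<in> carrier N" if "j < length ws" for j
    using Cons.prems that set_take_subset[of j ws] set_drop_subset[of "Suc j" ws]
    by (intro B_closed) (auto simp: subset_iff)
  have w: "B w (p @ ws) \<in> carrier N"
    using Cons.prems by (intro B_closed) auto
  have "S p (w # ws) = B w (p @ ws) \<oplus>\<^bsub>N\<^esub> (\<ominus>\<^bsub>N\<^esub> (\<Oplus>\<^bsub>N\<^esub>j\<in>{..<length ws}. signed N j (?f j)))"
    using Cons by simp
  also have "\<ominus>\<^bsub>N\<^esub> (\<Oplus>\<^bsub>N\<^esub>j\<in>{..<length ws}. signed N j (?f j))
      = (\<Oplus>\<^bsub>N\<^esub>j\<in>{..<length ws}. \<ominus>\<^bsub>N\<^esub> signed N j (?f j))"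
    using f by (intro N.finsum_a_inv[symmetric]) auto
  also have "\<dots> = (\<Oplus>\<^bsub>N\<^esub>j\<in>{..<length ws}. signed N (Suc j) (?f j))"
    using f by (intro N.finsum_cong') (auto simp: N.signed_Suc)
  also have "B w (p @ ws) \<oplus>\<^bsub>N\<^esub> \<dots> = (\<Oplus>\<^bsub>N\<^esub>j\<in>{..<Suc (length ws)}.
      signed N j (B ((w # ws) ! j) (p @ take j (w # ws) @ drop (Suc j) (w # ws))))"
    using f w by (subst N.finsum_lessThan_Suc_shift) (auto simp: less_Suc_eq_0_disj, simp add: signed_def)
  finally show ?case by simp
qed simp

end

locale insertion_module = insertion M N m B + RN: module R N
  for R :: "('a, 'r) ring_scheme" and M :: "('b, 'm) ring_scheme" and N :: "('a, 'c, 'n) module_scheme"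
    and m B
begin

text \<open>\<open>M\<close> is a bare abelian group in this locale, so the map \<open>t\<close>
  plays the role of scalar multiplication by \<open>s\<close> on \<open>M\<close>.\<close>

lemma S_smult_prefix:
  assumes s: "s \<in> carrier R"
    and B: "\<And>w xs u ys. \<lbrakk>w \<in> carrier M; u \<in> carrier M; Suc (length xs + length ys) = m;
        set xs \<subseteq> carrier M; set ys \<subseteq> carrier M\<rbrakk>
      \<Longrightarrow> t u \<in> carrier M \<and> B w (xs @ t u # ys) = s \<odot>\<^bsub>N\<^esub> B w (xs @ u # ys)"
    and "Suc (length p + length q + length ws) = Suc m"
    "set p \<subseteq> carrier M" "set q \<subseteq> carrier M" "set ws \<subseteq> carrier M" "u \<in> carrier M"
  shows "S (p @ t u # q) ws = s \<odot>\<^bsub>N\<^esub> S (p @ u # q) ws"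
  using assms(3-)
proof (induction ws arbitrary: q)
  case Nil
  then show ?case using s by simp
next
  case (Cons w ws)
  have "B w (p @ t u # q @ ws) = s \<odot>\<^bsub>N\<^esub> B w (p @ u # q @ ws)"
    using Cons.prems B[of w u p "q @ ws"] by simp
  moreover have "S (p @ t u # q @ [w]) ws = s \<odot>\<^bsub>N\<^esub> S (p @ u # q @ [w]) ws"
    using Cons.prems by (intro Cons.IH) auto
  moreover have "B w (p @ u # q @ ws) \<in> carrier N" "S (p @ u # q @ [w]) ws \<in> carrier N"
    using Cons.prems by (auto intro!: B_closed S_closed)
  ultimately show ?case
    using Cons.prems s by (simp add: RN.smult_r_distr RN.smult_r_minus)
qed

text \<open>\<open>C\<close> measures how far \<open>B\<close> is from linear in the distinguished
  entry: it is zero for the contraction and \<open>ds \<and> u \<and> vs\<close> for the derivative.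
  It enters once, with the sign of the position where \<open>u\<close> is singled out.\<close>

lemma S_smult:
  assumes s: "s \<in> carrier R"
    and B: "\<And>w xs u ys. \<lbrakk>w \<in> carrier M; u \<in> carrier M; Suc (length xs + length ys) = m;
        set xs \<subseteq> carrier M; set ys \<subseteq> carrier M\<rbrakk>
      \<Longrightarrow> t u \<in> carrier M \<and> B w (xs @ t u # ys) = s \<odot>\<^bsub>N\<^esub> B w (xs @ u # ys)"
    and C: "\<And>u ws. \<lbrakk>u \<in> carrier M; length ws = m; set ws \<subseteq> carrier M\<rbrakk>
      \<Longrightarrow> C u ws \<in> carrier N \<and> B (t u) ws = s \<odot>\<^bsub>N\<^esub> B u ws \<oplus>\<^bsub>N\<^esub> C u ws"
    and "Suc (length p + length xs + length ys) = Suc m"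
    "set p \<subseteq> carrier M" "set xs \<subseteq> carrier M" "set ys \<subseteq> carrier M" "u \<in> carrier M"
  shows "S p (xs @ t u # ys) = s \<odot>\<^bsub>N\<^esub> S p (xs @ u # ys) \<oplus>\<^bsub>N\<^esub> signed N (length xs) (C u (p @ xs @ ys))"
  using assms(4-)
proof (induction xs arbitrary: p)
  case Nil
  have "S (p @ t u # []) ys = s \<odot>\<^bsub>N\<^esub> S (p @ u # []) ys"
    using Nil by (intro S_smult_prefix[OF s B]) auto
  moreover have "B (t u) (p @ ys) = s \<odot>\<^bsub>N\<^esub> B u (p @ ys) \<oplus>\<^bsub>N\<^esub> C u (p @ ys)" "C u (p @ ys) \<in> carrier N"
    using Nil C[of u "p @ ys"] by auto
  moreover have "B u (p @ ys) \<in> carrier N" "S (p @ [u]) ys \<in> carrier N"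
    using Nil by (auto intro!: B_closed S_closed)
  ultimately show ?case
    using s by (simp add: RN.smult_r_distr RN.smult_r_minus signed_def N.a_ac)
next
  case (Cons x xs)
  have "B x (p @ xs @ t u # ys) = s \<odot>\<^bsub>N\<^esub> B x (p @ xs @ u # ys)"
    using Cons.prems B[of x u "p @ xs" ys] by simp
  moreover have "S (p @ [x]) (xs @ t u # ys) = s \<odot>\<^bsub>N\<^esub> S (p @ [x]) (xs @ u # ys) \<oplus>\<^bsub>N\<^esub>
      signed N (length xs) (C u (p @ x # xs @ ys))"
    using Cons.prems Cons.IH[of "p @ [x]"] by simp
  moreover have "B x (p @ xs @ u # ys) \<in> carrier N" "S (p @ [x]) (xs @ u # ys) \<in> carrier N"
    "C u (p @ x # xs @ ys) \<in> carrier N"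
    using Cons.prems C[of u "p @ x # xs @ ys"] by (auto intro!: B_closed S_closed)
  ultimately show ?case
    using s by (simp add: RN.smult_r_distr RN.smult_r_minus N.signed_Suc N.minus_add N.a_ac)
qed

end

subsection \<open>Contraction by a linear form\<close>

lemma ring_module_simps [simp]:
  "carrier (ring_module R) = carrier R" "\<zero>\<^bsub>ring_module R\<^esub> = \<zero>\<^bsub>R\<^esub>"
  "x \<oplus>\<^bsub>ring_module R\<^esub> y = x \<oplus>\<^bsub>R\<^esub> y" "r \<odot>\<^bsub>ring_module R\<^esub> x = r \<otimes>\<^bsub>R\<^esub> x"
  by (simp_all add: ring_module_def)

lemma (in cring) ring_module_module: "module R (ring_module R)"
proof (rule moduleI)
  show "abelian_group (ring_module R)"
    by (rule abelian_groupI) (auto simp: a_ac intro: l_neg exI[of _ "\<ominus> _"])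
qed (auto simp: is_cring l_distr r_distr m_assoc)

lemma (in cring) minus_one_pow: "(\<ominus> \<one>) [^] (j::nat) = signed R j \<one>"
  by (induction j) (auto simp: signed_def l_minus r_minus)

locale linear_form = module R M for R :: "('a, 'r) ring_scheme" (structure) and M :: "('a, 'b, 'm) module_scheme" (structure) +
  fixes g :: "'b \<Rightarrow> 'a"
  assumes g: "g \<in> module_hom R M (ring_module R)"
begin

lemma g_closed [simp]: "x \<in> carrier M \<Longrightarrow> g x \<in> carrier R"
  and g_add: "\<lbrakk>x \<in> carrier M; y \<in> carrier M\<rbrakk> \<Longrightarrow> g (x \<oplus>\<^bsub>M\<^esub> y) = g x \<oplus>\<^bsub>R\<^esub> g y"
  and g_smult: "\<lbrakk>r \<in> carrier R; x \<in> carrier M\<rbrakk> \<Longrightarrow> g (r \<odot>\<^bsub>M\<^esub> x) = r \<otimes>\<^bsub>R\<^esub> g x"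
  using module_homD[OF g] by auto

abbreviation con_sum :: "nat \<Rightarrow> 'b list \<Rightarrow> 'b list \<Rightarrow> ('b list \<Rightarrow> 'a) set" where
  "con_sum m \<equiv> alt_sum (E m) (\<lambda>w vs. g w \<odot>\<^bsub>E m\<^esub> W vs)"

lemma con_insertion: "insertion M (E m) m (\<lambda>w vs. g w \<odot>\<^bsub>E m\<^esub> W vs)"
proof -
  interpret E: module R "E m" by (rule ext_module)
  interpret W: alternating M "E m" m W by (rule wedge_alternating)
  show ?thesis
  proof (intro insertion.intro insertion_axioms.intro)
    fix w assume w: "w \<in> carrier M"
    show "alternating M (E m) m (\<lambda>vs. g w \<odot>\<^bsub>E m\<^esub> W vs)"
      by unfold_locales
        (use w in \<open>auto simp: W.additive W.adjacent E.smult_r_distr wedge_closed\<close>)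
  qed (simp_all add: g_add E.smult_l_distr wedge_closed M.abelian_group_axioms E.abelian_group_axioms)
qed

lemma con_sum_finsum:
  assumes "length ws = Suc m" "set ws \<subseteq> carrier M"
  shows "(\<Oplus>\<^bsub>E m\<^esub>j\<in>{..<Suc m}. ((\<ominus>\<^bsub>R\<^esub> \<one>\<^bsub>R\<^esub>) [^]\<^bsub>R\<^esub> j \<otimes>\<^bsub>R\<^esub> g (ws ! j)) \<odot>\<^bsub>E m\<^esub>
      W (take j ws @ drop (Suc j) ws)) = con_sum m [] ws"
proof -
  interpret E: module R "E m" by (rule ext_module)
  interpret insertion M "E m" m "\<lambda>w vs. g w \<odot>\<^bsub>E m\<^esub> W vs" by (rule con_insertion)
  have c: "W (take j ws @ drop (Suc j) ws) \<in> carrier (E m)" "ws ! j \<in> carrier M" if "j < Suc m" for j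
    using assms that by (auto intro!: wedge_closed dest!: in_set_takeD in_set_dropD)
  have "((\<ominus>\<^bsub>R\<^esub> \<one>\<^bsub>R\<^esub>) [^]\<^bsub>R\<^esub> j \<otimes>\<^bsub>R\<^esub> g (ws ! j)) \<odot>\<^bsub>E m\<^esub> W (take j ws @ drop (Suc j) ws)
      = signed (E m) j (g (ws ! j) \<odot>\<^bsub>E m\<^esub> W (take j ws @ drop (Suc j) ws))" if "j < Suc m" for j
    using c[OF that] by (simp add: R.minus_one_pow signed_def R.l_minus E.smult_l_minus)
  then have "(\<Oplus>\<^bsub>E m\<^esub>j\<in>{..<Suc m}. ((\<ominus>\<^bsub>R\<^esub> \<one>\<^bsub>R\<^esub>) [^]\<^bsub>R\<^esub> j \<otimes>\<^bsub>R\<^esub> g (ws ! j)) \<odot>\<^bsub>E m\<^esub>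
      W (take j ws @ drop (Suc j) ws))
      = (\<Oplus>\<^bsub>E m\<^esub>j\<in>{..<Suc m}. signed (E m) j (g (ws ! j) \<odot>\<^bsub>E m\<^esub> W (take j ws @ drop (Suc j) ws)))"
    using c by (intro E.finsum_cong') auto
  also have "\<dots> = con_sum m [] ws"
    using assms S_finsum[of "[]" ws] by simp
  finally show ?thesis .
qed

lemma con_sum_smult:
  assumes "s \<in> carrier R" "u \<in> carrier M" "length xs + length ys = m" "set xs \<subseteq> carrier M" "set ys \<subseteq> carrier M"
  shows "con_sum m [] (xs @ (s \<odot>\<^bsub>M\<^esub> u) # ys) = s \<odot>\<^bsub>E m\<^esub> con_sum m [] (xs @ u # ys)"
proof -
  interpret E: module R "E m" by (rule ext_module)
  interpret insertion M "E m" m "\<lambda>w vs. g w \<odot>\<^bsub>E m\<^esub> W vs" by (rule con_insertion)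
  interpret insertion_module R M "E m" m "\<lambda>w vs. g w \<odot>\<^bsub>E m\<^esub> W vs" by unfold_locales
  have "con_sum m [] (xs @ (s \<odot>\<^bsub>M\<^esub> u) # ys) = s \<odot>\<^bsub>E m\<^esub> con_sum m [] (xs @ u # ys)
      \<oplus>\<^bsub>E m\<^esub> signed (E m) (length xs) \<zero>\<^bsub>E m\<^esub>"
    using assms
    by (intro S_smult[where C = "\<lambda>_ _. \<zero>\<^bsub>E m\<^esub>" and t = "\<lambda>u. s \<odot>\<^bsub>M\<^esub> u"])
      (auto simp: wedge_smult[of _ _ m] wedge_closed E.smult_assoc1[symmetric] g_smult R.m_comm)
  moreover have "con_sum m [] (xs @ u # ys) \<in> carrier (E m)"
    using assms by (intro S_closed) auto
  ultimately show ?thesis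
    using assms by (simp add: signed_def)
qed

text \<open>The existence half of the definite description in \<open>contraction\<close>.\<close>

lemma contraction_ex:
  "\<exists>h. h \<in> extensional (carrier (E (Suc m))) \<and> h \<in> module_hom R (E (Suc m)) (E m) \<and>
    (\<forall>ws\<in>tuples M (Suc m). h (W ws) = con_sum m [] ws)"
proof -
  interpret E: module R "E m" by (rule ext_module)
  interpret E': module R "E (Suc m)" by (rule ext_module)
  interpret insertion M "E m" m "\<lambda>w vs. g w \<odot>\<^bsub>E m\<^esub> W vs" by (rule con_insertion)
  interpret S: alternating M "E m" "Suc m" "con_sum m []" by (rule S_alternating)
  have "\<exists>h. abelian_group_hom (E (Suc m)) (E m) h \<and>
    (\<forall>r\<in>carrier R. \<forall>ws. length ws = Suc m \<and> set ws \<subseteq> carrier M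
      \<longrightarrow> h (r \<odot>\<^bsub>E (Suc m)\<^esub> W ws) = r \<odot>\<^bsub>E m\<^esub> con_sum m [] ws)"
  proof (rule ext_lift)
    fix r assume r: "r \<in> carrier R"
    show "alternating M (E m) (Suc m) (\<lambda>ws. r \<odot>\<^bsub>E m\<^esub> con_sum m [] ws)"
      by unfold_locales
        (use r in \<open>auto simp: S.additive S.adjacent S.closed E.smult_r_distr\<close>)
  qed (auto simp: E.smult_l_distr E.smult_assoc1 S.closed con_sum_smult E.abelian_group_axioms)
  then obtain h where h: "abelian_group_hom (E (Suc m)) (E m) h"
    and hW: "\<And>r ws. \<lbrakk>r \<in> carrier R; length ws = Suc m; set ws \<subseteq> carrier M\<rbrakk>
      \<Longrightarrow> h (r \<odot>\<^bsub>E (Suc m)\<^esub> W ws) = r \<odot>\<^bsub>E m\<^esub> con_sum m [] ws" by blast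
  interpret h: abelian_group_hom "E (Suc m)" "E m" h by (rule h)
  \<comment> \<open>\<open>ext_lift\<close> supplies an additive map only; linearity is recovered on
    generators, where the value is visibly linear in the coefficient.\<close>
  have lin: "h (r \<odot>\<^bsub>E (Suc m)\<^esub> x) = r \<odot>\<^bsub>E m\<^esub> h x" if "r \<in> carrier R" "x \<in> carrier (E (Suc m))" for r x
    using that(2)
  proof (induction rule: ext_induct)
    case (gen s ws)
    then show ?case
      using that hW S.closed by (simp add: E'.smult_assoc1[symmetric] E.smult_assoc1[symmetric] wedge_closed)
  qed (use that in \<open>auto simp: E.smult_r_distr E'.smult_r_distr\<close>)
  show ?thesis
  proof (intro exI conjI ballI)
    let ?h = "restrict h (carrier (E (Suc m)))"
    show "?h \<in> module_hom R (E (Suc m)) (E m)"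
      by (auto simp: module_hom_def lin)
    fix ws assume "ws \<in> tuples M (Suc m)"
    then show "?h (W ws) = con_sum m [] ws"
      using hW[of "\<one>\<^bsub>R\<^esub>" ws] by (simp add: tuples_iff wedge_closed S.closed)
  qed simp
qed

text \<open>The uniqueness half of the descriptions in \<open>contraction\<close> and
  \<open>ext_one_map\<close>: the products \<open>W ws\<close> generate the exterior power as a
  module.\<close>

lemma module_hom_ext_eqI:
  assumes "h \<in> module_hom R (E m) N" "h' \<in> module_hom R (E m) N" "module R N"
    "h \<in> extensional (carrier (E m))" "h' \<in> extensional (carrier (E m))"
    "\<And>ws. ws \<in> tuples M m \<Longrightarrow> h (W ws) = h' (W ws)"
  shows "h = h'"
proof (rule extensionalityI)
  interpret h: abelian_group_hom "E m" N h
    using module_hom_additive[OF assms(1) ext_module assms(3)] .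
  interpret h': abelian_group_hom "E m" N h'
    using module_hom_additive[OF assms(2) ext_module assms(3)] .
  fix x assume "x \<in> carrier (E m)"
  then show "h x = h' x"
    by (induction rule: ext_induct)
      (use assms(6) in \<open>auto simp: module_homD(3)[OF assms(1)] module_homD(3)[OF assms(2)] wedge_closed tuples_iff\<close>)
qed (fact assms)+

lemma contraction:
  shows "contraction R M g (Suc m) \<in> module_hom R (E (Suc m)) (E m)"
    and "\<And>ws. \<lbrakk>length ws = Suc m; set ws \<subseteq> carrier M\<rbrakk> \<Longrightarrow> contraction R M g (Suc m) (W ws) = con_sum m [] ws"
proof -
  let ?P = "\<lambda>h. h \<in> extensional (carrier (E (Suc m))) \<and> h \<in> module_hom R (E (Suc m)) (E m) \<and>
    (\<forall>ws\<in>tuples M (Suc m). h (W ws) = con_sum m [] ws)"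
  have "\<exists>!h. ?P h"
    using contraction_ex[of m] by (auto intro!: module_hom_ext_eqI[where m = "Suc m" and N = "E m"] ext_module)
  moreover have "contraction R M g (Suc m) = (THE h. ?P h)"
  proof -
    have "(\<forall>ws\<in>tuples M (Suc m). h (W ws) =
        (\<Oplus>\<^bsub>E m\<^esub>j\<in>{..<Suc m}. ((\<ominus>\<^bsub>R\<^esub> \<one>\<^bsub>R\<^esub>) [^]\<^bsub>R\<^esub> j \<otimes>\<^bsub>R\<^esub> g (ws ! j)) \<odot>\<^bsub>E m\<^esub>
          W (take j ws @ drop (Suc j) ws))) \<longleftrightarrow> (\<forall>ws\<in>tuples M (Suc m). h (W ws) = con_sum m [] ws)" for h
      by (intro ball_cong refl) (simp add: con_sum_finsum tuples_iff)
    then show ?thesis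
      unfolding contraction_def by simp
  qed
  ultimately have "?P (contraction R M g (Suc m))"
    using theI'[of ?P] by simp
  then show "contraction R M g (Suc m) \<in> module_hom R (E (Suc m)) (E m)"
    "\<And>ws. \<lbrakk>length ws = Suc m; set ws \<subseteq> carrier M\<rbrakk> \<Longrightarrow> contraction R M g (Suc m) (W ws) = con_sum m [] ws"
    by (auto simp: tuples_iff)
qed

end

section \<open>Natural numbers as scalars\<close>

context cring
begin

text \<open>The eigenvalues are natural numbers; as ring elements they act on every module that
  occurs.\<close>

definition nat_scalar :: "nat \<Rightarrow> 'a" where "nat_scalar n = [n] \<cdot> \<one>"

lemma nat_scalar_closed [simp]: "nat_scalar n \<in> carrier R"
  by (simp add: nat_scalar_def)

lemma nat_scalar_add: "nat_scalar (m + n) = nat_scalar m \<oplus> nat_scalar n"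
  by (simp add: nat_scalar_def add.nat_pow_mult)

lemma nat_scalar_0 [simp]: "nat_scalar 0 = \<zero>"
  by (simp add: nat_scalar_def)

lemma nat_scalar_Suc: "nat_scalar (Suc n) = nat_scalar n \<oplus> \<one>"
  by (simp add: nat_scalar_def)

lemma nat_scalar_mult: "f \<in> carrier R \<Longrightarrow> nat_scalar n \<otimes> f = [n] \<cdot> f"
  by (simp add: nat_scalar_def add_pow_ldistr)

end

subsection \<open>The exterior derivative\<close>

lemma alternating_Cons:
  assumes "alternating M N (Suc m) f" "w \<in> carrier M"
  shows "alternating M N m (\<lambda>vs. f (w # vs))"
proof -
  interpret alternating M N "Suc m" f by fact
  show ?thesis
  proof
    fix xs ys u v
    assume "Suc (length xs + length ys) = m" "set xs \<subseteq> carrier M" "set ys \<subseteq> carrier M"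
      "u \<in> carrier M" "v \<in> carrier M"
    then show "f (w # xs @ (u \<oplus>\<^bsub>M\<^esub> v) # ys) = f (w # xs @ u # ys) \<oplus>\<^bsub>N\<^esub> f (w # xs @ v # ys)"
      using additive[of "w # xs" ys u v] assms(2) by simp
  next
    fix xs ys u
    assume "Suc (Suc (length xs + length ys)) = m" "set xs \<subseteq> carrier M" "set ys \<subseteq> carrier M"
      "u \<in> carrier M"
    then show "f (w # xs @ u # u # ys) = \<zero>\<^bsub>N\<^esub>"
      using adjacent[of "w # xs" ys u] assms(2) by simp
  qed (use assms(2) closed in auto)
qed

lemma (in abelian_group) signed_signed [simp]: "x \<in> carrier G \<Longrightarrow> signed G j (signed G j x) = x"
  by (simp add: signed_def)

context differentials
begin

abbreviation E where "E m \<equiv> ext_power R \<Omega> m"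
abbreviation W where "W \<equiv> wedge R \<Omega>"

text \<open>The additive map \<open>w \<mapsto> dw \<and> v\<^sub>1 \<and> \<dots> \<and> v\<^sub>n\<close>.\<close>

lemma d_insertion_ex:
  assumes "length vs = n" "set vs \<subseteq> carrier \<Omega>"
  shows "\<exists>h. abelian_group_hom \<Omega> (E (Suc (Suc n))) h \<and>
    (\<forall>r\<in>carrier R. \<forall>f\<in>carrier R. h (r \<odot>\<^bsub>\<Omega>\<^esub> d f) = W (d r # d f # vs))"
proof (rule kaehler_lift)
  interpret E: module R "E (Suc (Suc n))" by (rule \<Omega>.ext_module)
  interpret W: alternating \<Omega> "E (Suc (Suc n))" "Suc (Suc n)" W by (rule \<Omega>.wedge_alternating)
  note add1 = W.additive[of "[]", simplified] and add2 = W.additive[of "[_]", simplified]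
  note smult1 = \<Omega>.wedge_smult[of "[]" _ "Suc (Suc n)", simplified]
    and smult2 = \<Omega>.wedge_smult[of "[_]" _ "Suc (Suc n)", simplified]
  note zero2 = W.zero_slot[of "[_]", simplified]
  note swap = W.swap[of "[]", simplified]
  show "abelian_group (E (Suc (Suc n)))" by (rule E.abelian_group_axioms)
  fix r f g assume rfg: "r \<in> carrier R" "f \<in> carrier R" "g \<in> carrier R"
  have c: "W (a # b # vs) \<in> carrier (E (Suc (Suc n)))" if "a \<in> carrier \<Omega>" "b \<in> carrier \<Omega>" for a b
    using assms that by (intro W.closed) auto
  \<comment> \<open>Expanding \<open>d (r f)\<close> and \<open>d (r g)\<close> on the right gives,
    besides the two wanted terms, \<open>r\<close> times \<open>df \<and> dg\<close> and
    \<open>r\<close> times \<open>dg \<and> df\<close>, which cancel by a swap.\<close>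
  show "W (d r # d (f \<otimes> g) # vs) = W (d (r \<otimes> f) # d g # vs) \<oplus>\<^bsub>E (Suc (Suc n))\<^esub> W (d (r \<otimes> g) # d f # vs)"
    using rfg assms swap[of vs "d f" "d g"]
    by (simp add: d_mult add1 add2 smult1 smult2 c E.smult_r_minus E.minus_add E.a_ac E.r_neg
        E.r_neg1 E.r_neg2)
qed (use assms in \<open>auto intro!: \<Omega>.wedge_closed simp: d_add d_const
    alternating.additive[OF \<Omega>.wedge_alternating, of "[]", simplified]
    alternating.additive[OF \<Omega>.wedge_alternating, of "[_]", simplified]
    alternating.zero_slot[OF \<Omega>.wedge_alternating, of "[_]", simplified]\<close>)

text \<open>The argument \<open>w\<close> stands outside the choice, so that one and the same map is
  used for all \<open>w\<close> and additivity in \<open>w\<close> is preserved.\<close>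

definition d_insertion where
  "d_insertion w vs = (SOME h. abelian_group_hom \<Omega> (E (Suc (Suc (length vs)))) h \<and>
    (\<forall>r\<in>carrier R. \<forall>f\<in>carrier R. h (r \<odot>\<^bsub>\<Omega>\<^esub> d f) = W (d r # d f # vs))) w"

lemma d_insertion:
  assumes "set vs \<subseteq> carrier \<Omega>"
  shows "abelian_group_hom \<Omega> (E (Suc (Suc (length vs)))) (\<lambda>w. d_insertion w vs)"
    and "\<And>r f. \<lbrakk>r \<in> carrier R; f \<in> carrier R\<rbrakk> \<Longrightarrow> d_insertion (r \<odot>\<^bsub>\<Omega>\<^esub> d f) vs = W (d r # d f # vs)"
  using someI_ex[OF d_insertion_ex[OF refl assms]] unfolding d_insertion_def by auto

context
  fixes n :: nat
begin

interpretation E: module R "E (Suc (Suc n))" by (rule \<Omega>.ext_module)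

interpretation W: alternating \<Omega> "E (Suc (Suc n))" "Suc (Suc n)" W by (rule \<Omega>.wedge_alternating)

lemma d_insertion_hom:
  "\<lbrakk>length vs = n; set vs \<subseteq> carrier \<Omega>\<rbrakk> \<Longrightarrow> abelian_group_hom \<Omega> (E (Suc (Suc n))) (\<lambda>w. d_insertion w vs)"
  using d_insertion(1)[of vs] by simp

lemma d_insertion_closed:
  assumes "length vs = n" "set vs \<subseteq> carrier \<Omega>" "w \<in> carrier \<Omega>"
  shows "d_insertion w vs \<in> carrier (E (Suc (Suc n)))"
  using abelian_group_hom.hom_closed[OF d_insertion_hom] assms by blast

lemma d_insertion_add:
  assumes "length vs = n" "set vs \<subseteq> carrier \<Omega>" "v \<in> carrier \<Omega>" "w \<in> carrier \<Omega>"
  shows "d_insertion (v \<oplus>\<^bsub>\<Omega>\<^esub> w) vs = d_insertion v vs \<oplus>\<^bsub>E (Suc (Suc n))\<^esub> d_insertion w vs"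
  using abelian_group_hom.hom_add[OF d_insertion_hom[OF assms(1,2)]] assms by blast

lemma d_insertion_zero:
  assumes "length vs = n" "set vs \<subseteq> carrier \<Omega>"
  shows "d_insertion \<zero>\<^bsub>\<Omega>\<^esub> vs = \<zero>\<^bsub>E (Suc (Suc n))\<^esub>"
  using abelian_group_hom.hom_zero[OF d_insertion_hom[OF assms]] .

text \<open>This is \<open>d d = 0\<close>: write \<open>df\<close> as \<open>1 df\<close> and use
  \<open>d 1 = 0\<close>.\<close>

lemma d_insertion_d:
  assumes "length vs = n" "set vs \<subseteq> carrier \<Omega>" "f \<in> carrier R"
  shows "d_insertion (d f) vs = \<zero>\<^bsub>E (Suc (Suc n))\<^esub>"
  using d_insertion(2)[of vs \<one> f] W.zero_slot[of "[]" "d f # vs"] assms by (simp add: d_one)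

lemma d_insertion_slot_smult:
  assumes "Suc (length xs + length ys) = n" "set xs \<subseteq> carrier \<Omega>" "set ys \<subseteq> carrier \<Omega>"
    "u \<in> carrier \<Omega>" "s \<in> carrier R" "w \<in> carrier \<Omega>"
  shows "d_insertion w (xs @ (s \<odot>\<^bsub>\<Omega>\<^esub> u) # ys) = s \<odot>\<^bsub>E (Suc (Suc n))\<^esub> d_insertion w (xs @ u # ys)"
  using assms(6)
proof (induction rule: kaehler_induct)
  case (gen r f)
  then show ?case
    using assms \<Omega>.wedge_smult[of "d r # d f # xs" ys "Suc (Suc n)" s u] by (simp add: d_insertion(2))
qed (use assms in \<open>simp_all add: d_insertion_zero d_insertion_add d_insertion_closed E.smult_r_distr\<close>)

text \<open>The rule \<open>d (s w) = s dw + ds \<and> w\<close>. Both sides are additive in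
  \<open>w\<close>, so it is checked for \<open>w = r df\<close>, where it is the Leibniz rule for
  \<open>d (s r)\<close>.\<close>

lemma d_insertion_smult:
  assumes "length vs = n" "set vs \<subseteq> carrier \<Omega>" "s \<in> carrier R" "w \<in> carrier \<Omega>"
  shows "d_insertion (s \<odot>\<^bsub>\<Omega>\<^esub> w) vs = s \<odot>\<^bsub>E (Suc (Suc n))\<^esub> d_insertion w vs
    \<oplus>\<^bsub>E (Suc (Suc n))\<^esub> W (d s # w # vs)"
  using assms(4)
proof (induction rule: kaehler_induct)
  case zero
  then show ?case
    using assms W.zero_slot[of "[d s]" vs] by (simp add: d_insertion_zero)
next
  case (gen r f)
  have "d_insertion ((s \<otimes> r) \<odot>\<^bsub>\<Omega>\<^esub> d f) vs = W (d (s \<otimes> r) # d f # vs)"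
    using assms gen by (intro d_insertion(2)) auto
  also have "\<dots> = s \<odot>\<^bsub>E (Suc (Suc n))\<^esub> W (d r # d f # vs) \<oplus>\<^bsub>E (Suc (Suc n))\<^esub> r \<odot>\<^bsub>E (Suc (Suc n))\<^esub> W (d s # d f # vs)"
    using assms gen W.additive[of "[]" "d f # vs"] \<Omega>.wedge_smult[of "[]" "d f # vs" "Suc (Suc n)"]
    by (simp add: d_mult)
  also have "r \<odot>\<^bsub>E (Suc (Suc n))\<^esub> W (d s # d f # vs) = W (d s # (r \<odot>\<^bsub>\<Omega>\<^esub> d f) # vs)"
    using assms gen \<Omega>.wedge_smult[of "[d s]" vs "Suc (Suc n)" r "d f"] by simp
  finally show ?case
    using assms gen by (simp add: d_insertion(2) \<Omega>.smult_assoc1)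
next
  case (add a b)
  have "W (d s # (a \<oplus>\<^bsub>\<Omega>\<^esub> b) # vs) = W (d s # a # vs) \<oplus>\<^bsub>E (Suc (Suc n))\<^esub> W (d s # b # vs)"
    using assms add W.additive[of "[d s]" vs a b] by simp
  with add assms show ?case
    by (simp add: d_insertion_add d_insertion_closed \<Omega>.smult_r_distr E.smult_r_distr E.a_ac \<Omega>.wedge_closed)
qed

lemma d_insertion_insertion: "insertion \<Omega> (E (Suc (Suc n))) n d_insertion"
proof (intro insertion.intro insertion_axioms.intro)
  fix w assume w: "w \<in> carrier \<Omega>"
  show "alternating \<Omega> (E (Suc (Suc n))) n (d_insertion w)"
  proof
    fix xs ys u v
    assume as: "Suc (length xs + length ys) = n" "set xs \<subseteq> carrier \<Omega>" "set ys \<subseteq> carrier \<Omega>"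
      "u \<in> carrier \<Omega>" "v \<in> carrier \<Omega>"
    show "d_insertion w (xs @ (u \<oplus>\<^bsub>\<Omega>\<^esub> v) # ys)
        = d_insertion w (xs @ u # ys) \<oplus>\<^bsub>E (Suc (Suc n))\<^esub> d_insertion w (xs @ v # ys)"
      using w
    proof (induction rule: kaehler_induct)
      case (gen r f)
      then show ?case
        using as W.additive[of "d r # d f # xs" ys u v] by (simp add: d_insertion(2))
    qed (use as in \<open>simp_all add: d_insertion_zero d_insertion_add d_insertion_closed E.a_ac\<close>)
  next
    fix xs ys u
    assume as: "Suc (Suc (length xs + length ys)) = n" "set xs \<subseteq> carrier \<Omega>" "set ys \<subseteq> carrier \<Omega>"
      "u \<in> carrier \<Omega>"
    show "d_insertion w (xs @ u # u # ys) = \<zero>\<^bsub>E (Suc (Suc n))\<^esub>"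
      using w
    proof (induction rule: kaehler_induct)
      case (gen r f)
      then show ?case
        using as W.adjacent[of "d r # d f # xs" ys u] by (simp add: d_insertion(2))
    qed (use as in \<open>simp_all add: d_insertion_zero d_insertion_add d_insertion_closed\<close>)
  qed (use w in \<open>simp add: d_insertion_closed\<close>)
qed (simp_all add: d_insertion_add \<Omega>.abelian_group_axioms E.abelian_group_axioms)

end

text \<open>\<open>D\<close> is the alternating sum of the \<open>dw\<^sub>j \<and> w\<^sub>1 \<and> \<dots> \<and> w\<^sub>m\<close> with \<open>w\<^sub>j\<close> omitted, so that
  the derivative of \<open>r w\<^sub>1 \<and> \<dots> \<and> w\<^sub>m\<close> is \<open>dr \<and> w\<^sub>1 \<and> \<dots> \<and> w\<^sub>m + r D w\<close>.\<close>

lemma ext_d_correction: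
  "\<exists>D. alternating \<Omega> (E (Suc m)) m D \<and>
    (\<forall>s\<in>carrier R. \<forall>u\<in>carrier \<Omega>. \<forall>xs ys. Suc (length xs + length ys) = m \<longrightarrow> set xs \<subseteq> carrier \<Omega> \<longrightarrow>
      set ys \<subseteq> carrier \<Omega> \<longrightarrow>
      D (xs @ (s \<odot>\<^bsub>\<Omega>\<^esub> u) # ys) = s \<odot>\<^bsub>E (Suc m)\<^esub> D (xs @ u # ys) \<oplus>\<^bsub>E (Suc m)\<^esub> W (d s # xs @ u # ys)) \<and>
    (\<forall>fs. length fs = m \<longrightarrow> set fs \<subseteq> carrier R \<longrightarrow> D (map d fs) = \<zero>\<^bsub>E (Suc m)\<^esub>)"
proof (cases m)
  \<comment> \<open>An empty product has no factors to differentiate, so the correction is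
    zero.\<close>
  case 0
  interpret E: module R "E (Suc m)" by (rule \<Omega>.ext_module)
  have "alternating \<Omega> (E (Suc m)) m (\<lambda>_. \<zero>\<^bsub>E (Suc m)\<^esub>)"
    by unfold_locales auto
  then show ?thesis using 0 by (intro exI[of _ "\<lambda>_. \<zero>\<^bsub>E (Suc m)\<^esub>"]) auto
next
  case (Suc n)
  interpret E: module R "E (Suc (Suc n))" by (rule \<Omega>.ext_module)
  interpret insertion \<Omega> "E (Suc (Suc n))" n d_insertion by (rule d_insertion_insertion)
  interpret insertion_module R \<Omega> "E (Suc (Suc n))" n d_insertion by unfold_locales
  let ?D = "alt_sum (E (Suc (Suc n))) d_insertion"
  show ?thesis unfolding Suc
  proof (intro exI[of _ "?D []"] conjI ballI allI impI)
    show "alternating \<Omega> (E (Suc (Suc n))) (Suc n) (?D [])" by (rule S_alternating)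
  next
    fix s u xs ys
    assume as: "s \<in> carrier R" "u \<in> carrier \<Omega>" "Suc (length xs + length ys) = Suc n"
      "set xs \<subseteq> carrier \<Omega>" "set ys \<subseteq> carrier \<Omega>"
    \<comment> \<open>The defect is produced with \<open>u\<close> right after \<open>ds\<close> and
      the sign of its position; moving \<open>u\<close> back to its slot behind the fixed first
      factor \<open>ds\<close> absorbs that sign.\<close>
    interpret Ws: alternating \<Omega> "E (Suc (Suc n))" "Suc n" "\<lambda>vs. W (d s # vs)"
      using as by (intro alternating_Cons \<Omega>.wedge_alternating) auto
    have "?D [] (xs @ (s \<odot>\<^bsub>\<Omega>\<^esub> u) # ys) = s \<odot>\<^bsub>E (Suc (Suc n))\<^esub> ?D [] (xs @ u # ys)
        \<oplus>\<^bsub>E (Suc (Suc n))\<^esub> signed (E (Suc (Suc n))) (length xs) (W (d s # u # [] @ xs @ ys))"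
      using as by (intro S_smult[where t = "\<lambda>u. s \<odot>\<^bsub>\<Omega>\<^esub> u" and C = "\<lambda>u vs. W (d s # u # vs)"])
        (auto simp: d_insertion_slot_smult d_insertion_smult \<Omega>.wedge_closed)
    then show "?D [] (xs @ (s \<odot>\<^bsub>\<Omega>\<^esub> u) # ys) = s \<odot>\<^bsub>E (Suc (Suc n))\<^esub> ?D [] (xs @ u # ys)
        \<oplus>\<^bsub>E (Suc (Suc n))\<^esub> W (d s # xs @ u # ys)"
      using as by (simp add: Ws.move_front Ws.closed)
  next
    fix fs assume fs: "length fs = Suc n" "set fs \<subseteq> carrier R"
    have "?D (map d p) (map d fs) = \<zero>\<^bsub>E (Suc (Suc n))\<^esub>"
      if "length p + length fs = Suc n" "set p \<subseteq> carrier R" "set fs \<subseteq> carrier R" for p fs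
      using that
    proof (induction fs arbitrary: p)
      case (Cons f fs)
      have "?D (map d (p @ [f])) (map d fs) = \<zero>\<^bsub>E (Suc (Suc n))\<^esub>"
        using Cons.prems by (intro Cons.IH) auto
      moreover have "d_insertion (d f) (map d p @ map d fs) = \<zero>\<^bsub>E (Suc (Suc n))\<^esub>"
        using Cons.prems by (intro d_insertion_d) auto
      ultimately show ?case by simp
    qed simp
    from this[of "[]" fs] fs show "?D [] (map d fs) = \<zero>\<^bsub>E (Suc (Suc n))\<^esub>" by simp
  qed
qed

text \<open>On arbitrary factors the value is \<open>dr \<and> ws\<close> plus
  \<open>r D ws\<close>. Moving a scalar \<open>s\<close> from an entry into \<open>r\<close> turns
  \<open>dr\<close> into \<open>d (r s)\<close>; the additional Leibniz term \<open>r ds\<close> is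
  exactly what the defect of \<open>D\<close> supplies. The formula is recorded for exact factors
  only, where \<open>D\<close> vanishes.\<close>

lemma ext_d_ex:
  "\<exists>h. abelian_group_hom (E m) (E (Suc m)) h \<and>
    (\<forall>r\<in>carrier R. \<forall>fs. length fs = m \<longrightarrow> set fs \<subseteq> carrier R \<longrightarrow>
      h (r \<odot>\<^bsub>E m\<^esub> W (map d fs)) = W (d r # map d fs))"
proof -
  interpret E: module R "E (Suc m)" by (rule \<Omega>.ext_module)
  interpret W: alternating \<Omega> "E (Suc m)" "Suc m" W by (rule \<Omega>.wedge_alternating)
  obtain D where "alternating \<Omega> (E (Suc m)) m D"
    and smult: "\<And>s u xs ys. \<lbrakk>s \<in> carrier R; u \<in> carrier \<Omega>; Suc (length xs + length ys) = m;
        set xs \<subseteq> carrier \<Omega>; set ys \<subseteq> carrier \<Omega>\<rbrakk> \<Longrightarrow>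
      D (xs @ (s \<odot>\<^bsub>\<Omega>\<^esub> u) # ys) = s \<odot>\<^bsub>E (Suc m)\<^esub> D (xs @ u # ys) \<oplus>\<^bsub>E (Suc m)\<^esub> W (d s # xs @ u # ys)"
    and Dd: "\<And>fs. \<lbrakk>length fs = m; set fs \<subseteq> carrier R\<rbrakk> \<Longrightarrow> D (map d fs) = \<zero>\<^bsub>E (Suc m)\<^esub>"
    using ext_d_correction[of m] by metis
  then interpret D: alternating \<Omega> "E (Suc m)" m D by simp
  have "\<exists>h. abelian_group_hom (E m) (E (Suc m)) h \<and>
    (\<forall>r\<in>carrier R. \<forall>ws. length ws = m \<and> set ws \<subseteq> carrier \<Omega> \<longrightarrow>
      h (r \<odot>\<^bsub>E m\<^esub> W ws) = W (d r # ws) \<oplus>\<^bsub>E (Suc m)\<^esub> r \<odot>\<^bsub>E (Suc m)\<^esub> D ws)"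
  proof (rule \<Omega>.ext_lift)
    fix r assume r: "r \<in> carrier R"
    interpret Wr: alternating \<Omega> "E (Suc m)" m "\<lambda>vs. W (d r # vs)"
      using r by (intro alternating_Cons \<Omega>.wedge_alternating) auto
    show "alternating \<Omega> (E (Suc m)) m (\<lambda>ws. W (d r # ws) \<oplus>\<^bsub>E (Suc m)\<^esub> r \<odot>\<^bsub>E (Suc m)\<^esub> D ws)"
    proof
      fix xs ys u v
      assume as: "Suc (length xs + length ys) = m" "set xs \<subseteq> carrier \<Omega>" "set ys \<subseteq> carrier \<Omega>"
        "u \<in> carrier \<Omega>" "v \<in> carrier \<Omega>"
      have "W (d r # xs @ x # ys) \<in> carrier (E (Suc m))" "D (xs @ x # ys) \<in> carrier (E (Suc m))"
        if "x \<in> carrier \<Omega>" for x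
        using as that Wr.closed[of "xs @ x # ys"] D.closed[of "xs @ x # ys"] by simp_all
      then show "W (d r # xs @ (u \<oplus>\<^bsub>\<Omega>\<^esub> v) # ys) \<oplus>\<^bsub>E (Suc m)\<^esub> r \<odot>\<^bsub>E (Suc m)\<^esub> D (xs @ (u \<oplus>\<^bsub>\<Omega>\<^esub> v) # ys)
        = W (d r # xs @ u # ys) \<oplus>\<^bsub>E (Suc m)\<^esub> r \<odot>\<^bsub>E (Suc m)\<^esub> D (xs @ u # ys) \<oplus>\<^bsub>E (Suc m)\<^esub>
          (W (d r # xs @ v # ys) \<oplus>\<^bsub>E (Suc m)\<^esub> r \<odot>\<^bsub>E (Suc m)\<^esub> D (xs @ v # ys))"
        using as r by (simp add: Wr.additive D.additive E.smult_r_distr E.a_ac)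
    qed (use r in \<open>simp_all add: Wr.closed D.closed Wr.adjacent D.adjacent\<close>)
  next
    fix r s u xs ys
    assume as: "r \<in> carrier R" "s \<in> carrier R" "u \<in> carrier \<Omega>" "Suc (length xs + length ys) = m"
      "set xs \<subseteq> carrier \<Omega>" "set ys \<subseteq> carrier \<Omega>"
    have "W (d a # xs @ u # ys) \<in> carrier (E (Suc m))" if "a \<in> carrier R" for a
      using as that by (intro W.closed) auto
    moreover have "D (xs @ u # ys) \<in> carrier (E (Suc m))"
      using as by (intro D.closed) auto
    moreover have "W (d r # xs @ (s \<odot>\<^bsub>\<Omega>\<^esub> u) # ys) = s \<odot>\<^bsub>E (Suc m)\<^esub> W (d r # xs @ u # ys)"
      using as \<Omega>.wedge_smult[of "d r # xs" ys "Suc m" s u] by simp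
    moreover have "W (d (r \<otimes> s) # xs @ u # ys) = r \<odot>\<^bsub>E (Suc m)\<^esub> W (d s # xs @ u # ys)
        \<oplus>\<^bsub>E (Suc m)\<^esub> s \<odot>\<^bsub>E (Suc m)\<^esub> W (d r # xs @ u # ys)"
      using as W.additive[of "[]" "xs @ u # ys" "r \<odot>\<^bsub>\<Omega>\<^esub> d s" "s \<odot>\<^bsub>\<Omega>\<^esub> d r"]
        \<Omega>.wedge_smult[of "[]" "xs @ u # ys" "Suc m"]
      by (simp add: d_mult)
    ultimately show "W (d r # xs @ (s \<odot>\<^bsub>\<Omega>\<^esub> u) # ys) \<oplus>\<^bsub>E (Suc m)\<^esub> r \<odot>\<^bsub>E (Suc m)\<^esub> D (xs @ (s \<odot>\<^bsub>\<Omega>\<^esub> u) # ys)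
        = W (d (r \<otimes> s) # xs @ u # ys) \<oplus>\<^bsub>E (Suc m)\<^esub> (r \<otimes> s) \<odot>\<^bsub>E (Suc m)\<^esub> D (xs @ u # ys)"
      using as by (simp add: smult E.smult_r_distr E.smult_assoc1 E.a_ac)
  next
    fix r s ws
    assume as: "r \<in> carrier R" "s \<in> carrier R" "length ws = m" "set ws \<subseteq> carrier \<Omega>"
    then have "W (d a # ws) \<in> carrier (E (Suc m))" if "a \<in> carrier R" for a
      using that by (intro W.closed) auto
    then show "W (d (r \<oplus> s) # ws) \<oplus>\<^bsub>E (Suc m)\<^esub> (r \<oplus> s) \<odot>\<^bsub>E (Suc m)\<^esub> D ws
      = W (d r # ws) \<oplus>\<^bsub>E (Suc m)\<^esub> r \<odot>\<^bsub>E (Suc m)\<^esub> D ws \<oplus>\<^bsub>E (Suc m)\<^esub> (W (d s # ws) \<oplus>\<^bsub>E (Suc m)\<^esub> s \<odot>\<^bsub>E (Suc m)\<^esub> D ws)"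
      using as W.additive[of "[]" ws "d r" "d s"]
      by (simp add: d_add D.closed E.smult_l_distr E.a_ac)
  qed (rule E.abelian_group_axioms)
  then obtain h where h: "abelian_group_hom (E m) (E (Suc m)) h"
    "\<And>r ws. \<lbrakk>r \<in> carrier R; length ws = m; set ws \<subseteq> carrier \<Omega>\<rbrakk> \<Longrightarrow>
      h (r \<odot>\<^bsub>E m\<^esub> W ws) = W (d r # ws) \<oplus>\<^bsub>E (Suc m)\<^esub> r \<odot>\<^bsub>E (Suc m)\<^esub> D ws"
    by blast
  have "h (r \<odot>\<^bsub>E m\<^esub> W (map d fs)) = W (d r # map d fs)"
    if "r \<in> carrier R" "length fs = m" "set fs \<subseteq> carrier R" for r fs
  proof -
    have "W (d r # map d fs) \<in> carrier (E (Suc m))"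
      using that by (intro W.closed) auto
    moreover have "set (map d fs) \<subseteq> carrier \<Omega>"
      using that by auto
    ultimately show ?thesis
      using that by (simp add: h(2) Dd)
  qed
  with h(1) show ?thesis by blast
qed

definition ext_d where
  "ext_d m = (SOME h. abelian_group_hom (E m) (E (Suc m)) h \<and>
    (\<forall>r\<in>carrier R. \<forall>fs. length fs = m \<longrightarrow> set fs \<subseteq> carrier R \<longrightarrow>
      h (r \<odot>\<^bsub>E m\<^esub> W (map d fs)) = W (d r # map d fs)))"

lemma ext_d_hom: "abelian_group_hom (E m) (E (Suc m)) (ext_d m)"
  and ext_d_gen: "\<lbrakk>r \<in> carrier R; length fs = m; set fs \<subseteq> carrier R\<rbrakk>
    \<Longrightarrow> ext_d m (r \<odot>\<^bsub>E m\<^esub> W (map d fs)) = W (d r # map d fs)"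
  using someI_ex[OF ext_d_ex[of m]] unfolding ext_d_def by auto

subsection \<open>Cartan's formula\<close>

lemma d_zero: "d \<zero> = \<zero>\<^bsub>\<Omega>\<^esub>"
  using d_add[of \<zero> \<zero>] \<Omega>.M.add.r_cancel_one'[of "d \<zero>" "d \<zero>"] by simp

text \<open>Eigenvalues come under \<open>d\<close> in the proof of Cartan's formula and must behave
  as constants there.\<close>

lemma d_nat_scalar [simp]: "d (nat_scalar n) = \<zero>\<^bsub>\<Omega>\<^esub>"
  by (induction n) (simp_all add: nat_scalar_Suc d_add d_one d_zero)

end

locale differentials_form = differentials R k + linear_form R "kaehler R k" g
  for R :: "('a, 'r) ring_scheme" (structure) and k g
begin

text \<open>Differentiating the coefficient of each term of the contraction gives two terms: the one
  with \<open>df\<close> puts the omitted factor back and contributes its eigenvalue, the one with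
  \<open>dr\<close> is the matching term of the contraction of \<open>dr \<and> p \<and> fs\<close>
  restricted to the positions in \<open>fs\<close>. The prefix \<open>p\<close> is general for the
  sake of the recursion.\<close>

lemma ext_d_con_sum:
  assumes "length p + length fs = Suc m" "set p \<subseteq> carrier R" "set fs \<subseteq> carrier R" "r \<in> carrier R"
    "list_all2 (\<lambda>f n. g (d f) = nat_scalar n \<otimes> f) fs ns"
  shows "ext_d m (r \<odot>\<^bsub>E m\<^esub> con_sum m (map d p) (map d fs)) =
    con_sum (Suc m) (d r # map d p) (map d fs) \<oplus>\<^bsub>E (Suc m)\<^esub>
    signed (E (Suc m)) (length p) ((nat_scalar (sum_list ns) \<otimes> r) \<odot>\<^bsub>E (Suc m)\<^esub> W (map d p @ map d fs))"
  using assms(5,1-4)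
proof (induction fs ns arbitrary: p rule: list_all2_induct)
  case Nil
  interpret E: module R "E m" by (rule \<Omega>.ext_module)
  interpret E': module R "E (Suc m)" by (rule \<Omega>.ext_module)
  have "W (map d p) \<in> carrier (E (Suc m))"
    using Nil by (intro \<Omega>.wedge_closed) auto
  then show ?case
    using Nil abelian_group_hom.hom_zero[OF ext_d_hom[of m]] by (simp add: signed_def)
next
  case (Cons f fs n ns)
  let ?E = "E (Suc m)"
  interpret E: module R "E m" by (rule \<Omega>.ext_module)
  interpret E': module R ?E by (rule \<Omega>.ext_module)
  interpret h: abelian_group_hom "E m" ?E "ext_d m" by (rule ext_d_hom)
  interpret W: alternating \<Omega> ?E "Suc m" W by (rule \<Omega>.wedge_alternating)
  interpret C: insertion \<Omega> "E m" m "\<lambda>w vs. g w \<odot>\<^bsub>E m\<^esub> W vs" by (rule con_insertion)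
  interpret C': insertion \<Omega> ?E "Suc m" "\<lambda>w vs. g w \<odot>\<^bsub>?E\<^esub> W vs" by (rule con_insertion)
  let ?vs = "map d p @ map d fs" and ?ws = "map d p @ d f # map d fs"
  let ?c = "con_sum m (map d p @ [d f]) (map d fs)"
  let ?c' = "con_sum (Suc m) (d r # map d p @ [d f]) (map d fs)"
  let ?N = "nat_scalar n" and ?N' = "nat_scalar (sum_list ns)"
  have f: "f \<in> carrier R" "g (d f) = ?N \<otimes> f" and r: "r \<in> carrier R"
    and vs: "length ?vs = m" "set ?vs \<subseteq> carrier \<Omega>" and ws: "length ?ws = Suc m" "set ?ws \<subseteq> carrier \<Omega>"
    and fs: "set fs \<subseteq> carrier R" and p: "set p \<subseteq> carrier R" and len: "length p + length fs = m"
    using Cons by auto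
  have c: "?c \<in> carrier (E m)" using vs f len fs by (intro C.S_closed) auto
  have c': "?c' \<in> carrier ?E" using vs f r len fs by (intro C'.S_closed) auto
  have Wvs: "W ?vs \<in> carrier (E m)" and Wws: "W ?ws \<in> carrier ?E"
    using \<Omega>.wedge_closed[OF vs] \<Omega>.wedge_closed[OF ws] by simp_all
  have Wrvs: "W (d a # ?vs) \<in> carrier ?E" if "a \<in> carrier R" for a
    using vs that by (intro \<Omega>.wedge_closed) auto
  have "ext_d m (r \<odot>\<^bsub>E m\<^esub> con_sum m (map d p) (map d (f # fs)))
      = ext_d m ((r \<otimes> (?N \<otimes> f)) \<odot>\<^bsub>E m\<^esub> W ?vs) \<oplus>\<^bsub>?E\<^esub> (\<ominus>\<^bsub>?E\<^esub> ext_d m (r \<odot>\<^bsub>E m\<^esub> ?c))"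
    using r f c Wvs by (simp add: E.smult_r_distr E.smult_r_minus E.smult_assoc1)
  also have "ext_d m ((r \<otimes> (?N \<otimes> f)) \<odot>\<^bsub>E m\<^esub> W ?vs) = W (d (r \<otimes> (?N \<otimes> f)) # ?vs)"
    using r f fs p len ext_d_gen[of "r \<otimes> (?N \<otimes> f)" "p @ fs" m] by simp
  \<comment> \<open>\<open>?N\<close> passes through \<open>d\<close> as a constant, so Leibniz
    leaves only the terms in \<open>df\<close> and \<open>dr\<close>.\<close>
  also have "d (r \<otimes> (?N \<otimes> f)) = (?N \<otimes> r) \<odot>\<^bsub>\<Omega>\<^esub> d f \<oplus>\<^bsub>\<Omega>\<^esub> (?N \<otimes> f) \<odot>\<^bsub>\<Omega>\<^esub> d r"
    using r f by (simp add: d_mult \<Omega>.smult_r_distr \<Omega>.smult_assoc1[symmetric] m_ac \<Omega>.M.a_comm)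
  also have "W ((\<dots>) # ?vs) = (?N \<otimes> r) \<odot>\<^bsub>?E\<^esub> W (d f # ?vs) \<oplus>\<^bsub>?E\<^esub> (?N \<otimes> f) \<odot>\<^bsub>?E\<^esub> W (d r # ?vs)"
    using r f vs W.additive[of "[]" ?vs "(?N \<otimes> r) \<odot>\<^bsub>\<Omega>\<^esub> d f" "(?N \<otimes> f) \<odot>\<^bsub>\<Omega>\<^esub> d r"]
      \<Omega>.wedge_smult[of "[]" ?vs "Suc m"] by simp
  \<comment> \<open>Returning \<open>df\<close> to its slot past the entries of \<open>p\<close>
    produces the sign \<open>(-1)\<close> to the power \<open>length p\<close> demanded by the
    claim.\<close>
  also have "W (d f # ?vs) = signed ?E (length p) (W ?ws)"
    using ws len f W.move_front[of "map d p" "map d fs" "d f"] by simp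
  also have "ext_d m (r \<odot>\<^bsub>E m\<^esub> ?c) = ?c' \<oplus>\<^bsub>?E\<^esub>
      signed ?E (Suc (length p)) ((?N' \<otimes> r) \<odot>\<^bsub>?E\<^esub> W ?ws)"
    using Cons.IH[of "p @ [f]"] f r fs p len by simp
  finally show ?case
    using r f c' Wws Wrvs[of r]
    by (simp add: signed_def nat_scalar_add l_distr E'.smult_l_distr E'.smult_r_minus E'.minus_add E'.a_ac)
qed

text \<open>The left-hand side is the Lie derivative of \<open>x\<close> along the Euler field.\<close>

lemma cartan:
  assumes "length fs = Suc m" "set fs \<subseteq> carrier R" "r \<in> carrier R" "g (d r) = nat_scalar n \<otimes> r"
    "list_all2 (\<lambda>f n. g (d f) = nat_scalar n \<otimes> f) fs ns"
  defines "x \<equiv> r \<odot>\<^bsub>E (Suc m)\<^esub> W (map d fs)"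
  shows "contraction R \<Omega> g (Suc (Suc m)) (ext_d (Suc m) x) \<oplus>\<^bsub>E (Suc m)\<^esub>
      ext_d m (contraction R \<Omega> g (Suc m) x) = nat_scalar (n + sum_list ns) \<odot>\<^bsub>E (Suc m)\<^esub> x"
proof -
  let ?E = "E (Suc m)"
  interpret E: module R "E m" by (rule \<Omega>.ext_module)
  interpret E': module R ?E by (rule \<Omega>.ext_module)
  interpret C': insertion \<Omega> ?E "Suc m" "\<lambda>w vs. g w \<odot>\<^bsub>?E\<^esub> W vs" by (rule con_insertion)
  let ?ws = "map d fs"
  have ws: "length ?ws = Suc m" "set ?ws \<subseteq> carrier \<Omega>"
    using assms(1-3) by auto
  then have W: "W ?ws \<in> carrier ?E" by (intro \<Omega>.wedge_closed) auto
  have c: "con_sum (Suc m) [d r] ?ws \<in> carrier ?E"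
    using ws assms(3) by (intro C'.S_closed) auto
  have "contraction R \<Omega> g (Suc (Suc m)) (ext_d (Suc m) x) = con_sum (Suc m) [] (d r # ?ws)"
    using assms(1-3) ws by (simp add: x_def ext_d_gen contraction(2))
  then have 1: "contraction R \<Omega> g (Suc (Suc m)) (ext_d (Suc m) x)
      = (nat_scalar n \<otimes> r) \<odot>\<^bsub>?E\<^esub> W ?ws \<oplus>\<^bsub>?E\<^esub> (\<ominus>\<^bsub>?E\<^esub> con_sum (Suc m) [d r] ?ws)"
    using assms(4) by simp
  have "contraction R \<Omega> g (Suc m) x = r \<odot>\<^bsub>E m\<^esub> con_sum m [] ?ws"
    using assms(3) ws W module_homD(3)[OF contraction(1)] by (simp add: x_def contraction(2))
  then have 2: "ext_d m (contraction R \<Omega> g (Suc m) x) = con_sum (Suc m) [d r] ?ws \<oplus>\<^bsub>?E\<^esub>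
      (nat_scalar (sum_list ns) \<otimes> r) \<odot>\<^bsub>?E\<^esub> W ?ws"
    using ext_d_con_sum[of "[]" fs m r ns] assms(1-3,5) by (simp add: signed_def)
  \<comment> \<open>The sum with prefix \<open>d r\<close> enters \<open>1\<close> and
    \<open>2\<close> with opposite signs; the eigenvalue of \<open>r\<close> from \<open>1\<close>
    and those of \<open>fs\<close> from \<open>2\<close> remain.\<close>
  show ?thesis
    unfolding 1 2 unfolding x_def using assms(3) W c
    by (simp add: nat_scalar_add l_distr E'.smult_l_distr E'.smult_assoc1 E'.a_ac E'.r_neg E'.r_neg1 E'.r_neg2)
qed

end

subsection \<open>Gradings by eigenspaces\<close>

lemma (in abelian_group) subgroup_finsum:
  assumes "subgroup H (add_monoid G)" "\<And>i. i \<in> S \<Longrightarrow> f i \<in> H"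
  shows "finsum G f S \<in> H"
  using assms(2)
proof (induction S rule: infinite_finite_induct)
  case (insert i S)
  then have "f \<in> S \<rightarrow> carrier G" "f i \<in> carrier G"
    using subgroup.subset[OF assms(1)] by auto
  with insert subgroup.m_closed[OF assms(1)] show ?case by simp
qed (use subgroup.one_closed[OF assms(1)] in \<open>simp_all add: finsum_infinite\<close>)

lemma (in abelian_group) subgroup_a_inv:
  "\<lbrakk>subgroup H (add_monoid G); x \<in> H\<rbrakk> \<Longrightarrow> \<ominus> x \<in> H"
  using subgroup.m_inv_closed by (fastforce simp: a_inv_def)

lemma (in abelian_group) generate_additive_subgroup:
  "S \<subseteq> carrier G \<Longrightarrow> subgroup (generate (add_monoid G) S) (add_monoid G)"
  using add.generate_is_subgroup by simp

lemma (in abelian_group) generate_minimal: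
  "\<lbrakk>subgroup H (add_monoid G); S \<subseteq> H\<rbrakk> \<Longrightarrow> generate (add_monoid G) S \<subseteq> H"
  using add.generate_subgroup_incl by blast

lemma (in abelian_group_hom) subgroup_vimage:
  assumes "subgroup K (add_monoid H)"
  shows "subgroup {x \<in> carrier G. h x \<in> K} (add_monoid G)"
  using subgroup.one_closed[OF assms] subgroup.m_closed[OF assms] H.subgroup_a_inv[OF assms]
  by (intro G.add.subgroupI) (auto simp: a_inv_def[symmetric])

context module
begin

lemma nat_scalar_smult_subgroup:
  assumes "subgroup H (add_monoid M)" "x \<in> H"
  shows "nat_scalar n \<odot>\<^bsub>M\<^esub> x \<in> H"
proof (induction n)
  case 0
  then show ?case using assms subgroup.subset subgroup.one_closed by fastforce
next
  case (Suc n)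
  then show ?case
    using assms subgroup.subset[OF assms(1)] subgroup.m_closed[OF assms(1)]
    by (auto simp: nat_scalar_Suc smult_l_distr)
qed

end

text \<open>Instances are the Lie derivative on an exterior power and the Euler derivation on the
  maximal ideal. \<open>\<theta>\<close> is only additive, because neither of these commutes with
  scalars. Distinct eigenvalues differ by a positive integer up to sign, hence by an invertible
  scalar.\<close>

locale eigen_graded = module R M for R :: "('a, 'r) ring_scheme" (structure) and M :: "('a, 'b, 'm) module_scheme" (structure) +
  fixes \<theta> :: "'b \<Rightarrow> 'b" and Mg :: "nat \<Rightarrow> 'b set"
  assumes hom: "abelian_group_hom M M \<theta>"
    and subgroup: "subgroup (Mg e) (add_monoid M)"
    and eigen: "x \<in> Mg e \<Longrightarrow> \<theta> x = nat_scalar e \<odot>\<^bsub>M\<^esub> x"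
    and span: "carrier M \<subseteq> generate (add_monoid M) (\<Union>e. Mg e)"
    and invertible: "n > 0 \<Longrightarrow> \<exists>u\<in>carrier R. u \<otimes>\<^bsub>R\<^esub> nat_scalar n = \<one>\<^bsub>R\<^esub>"
begin

sublocale \<theta>: abelian_group_hom M M \<theta> by (rule hom)

lemma Mg_closed: "x \<in> Mg e \<Longrightarrow> x \<in> carrier M"
  using subgroup.subset[OF subgroup] by auto

lemma finsum_support:
  assumes "\<And>e. c e \<in> Mg e" "finite S" "{e. c e \<noteq> \<zero>\<^bsub>M\<^esub>} \<subseteq> S"
  shows "finsum M c {e. c e \<noteq> \<zero>\<^bsub>M\<^esub>} = finsum M c S"
  using assms(2,3) Mg_closed[OF assms(1)] by (intro M.add.finprod_mono_neutral_cong_left) auto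

lemma decomposition:
  assumes "x \<in> carrier M"
  obtains c where "\<And>e. c e \<in> Mg e" "finite {e. c e \<noteq> \<zero>\<^bsub>M\<^esub>}" "x = finsum M c {e. c e \<noteq> \<zero>\<^bsub>M\<^esub>}"
proof -
  let ?P = "\<lambda>x. \<exists>c. (\<forall>e. c e \<in> Mg e) \<and> finite {e. c e \<noteq> \<zero>\<^bsub>M\<^esub>} \<and> x = finsum M c {e. c e \<noteq> \<zero>\<^bsub>M\<^esub>}"
  have zero: "\<zero>\<^bsub>M\<^esub> \<in> Mg e" for e
    using subgroup.one_closed[OF subgroup] by simp
  have hom: "?P x" if "x \<in> Mg e" for x e
  proof -
    let ?c = "\<lambda>i. if i = e then x else \<zero>\<^bsub>M\<^esub>"
    have "finsum M ?c {i. ?c i \<noteq> \<zero>\<^bsub>M\<^esub>} = finsum M ?c {e}"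
      using Mg_closed[OF that] by (intro M.add.finprod_mono_neutral_cong_left) auto
    then show ?thesis
      using that zero Mg_closed[OF that] finite_subset[of "{i. ?c i \<noteq> \<zero>\<^bsub>M\<^esub>}" "{e}"]
      by (intro exI[of _ ?c]) auto
  qed
  from assms span have "x \<in> generate (add_monoid M) (\<Union>e. Mg e)" by auto
  then have "?P x"
  proof (induction x rule: generate.induct)
    case one
    show ?case using hom[OF zero] by simp
  next
    case (incl x)
    then show ?case using hom by auto
  next
    case (inv x)
    then obtain e where "inv\<^bsub>add_monoid M\<^esub> x \<in> Mg e"
      using subgroup.m_inv_closed[OF subgroup] by blast
    then show ?case by (rule hom)
  next
    case (eng x y)
    then obtain c c' where c: "\<And>e. c e \<in> Mg e" "finite {e. c e \<noteq> \<zero>\<^bsub>M\<^esub>}" "x = finsum M c {e. c e \<noteq> \<zero>\<^bsub>M\<^esub>}"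
      and c': "\<And>e. c' e \<in> Mg e" "finite {e. c' e \<noteq> \<zero>\<^bsub>M\<^esub>}" "y = finsum M c' {e. c' e \<noteq> \<zero>\<^bsub>M\<^esub>}"
      by blast
    let ?c = "\<lambda>e. c e \<oplus>\<^bsub>M\<^esub> c' e"
    let ?S = "{e. c e \<noteq> \<zero>\<^bsub>M\<^esub>} \<union> {e. c' e \<noteq> \<zero>\<^bsub>M\<^esub>}"
    note cl = Mg_closed[OF c(1)] Mg_closed[OF c'(1)]
    have "finsum M c {e. c e \<noteq> \<zero>\<^bsub>M\<^esub>} = finsum M c ?S"
      using c(2) c'(2) by (intro finsum_support[OF c(1)]) auto
    moreover have "finsum M c' {e. c' e \<noteq> \<zero>\<^bsub>M\<^esub>} = finsum M c' ?S"
      using c(2) c'(2) by (intro finsum_support[OF c'(1)]) auto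
    moreover have "finsum M ?c {e. ?c e \<noteq> \<zero>\<^bsub>M\<^esub>} = finsum M ?c ?S"
      using c(2) c'(2) cl by (intro M.add.finprod_mono_neutral_cong_left) auto
    moreover have "finsum M ?c ?S = finsum M c ?S \<oplus>\<^bsub>M\<^esub> finsum M c' ?S"
      using cl by (intro M.finsum_addf) auto
    moreover have "finite {e. ?c e \<noteq> \<zero>\<^bsub>M\<^esub>}"
      by (rule finite_subset[of _ ?S]) (use c(2) c'(2) in auto)
    ultimately show ?case
      using c c' subgroup.m_closed[OF subgroup] by (intro exI[of _ ?c]) auto
  qed
  then show thesis using that by blast
qed

text \<open>Applying \<open>\<theta> - e\<^sub>0\<close> removes one component and multiplies the others by the nonzero
  scalars \<open>e - e\<^sub>0\<close>.\<close>

lemma components_mem: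
  assumes B: "subgroup B (add_monoid M)" "\<And>x. x \<in> B \<Longrightarrow> \<theta> x \<in> B"
    and tf: "\<And>n x. \<lbrakk>n > 0; x \<in> carrier M; nat_scalar n \<odot>\<^bsub>M\<^esub> x \<in> B\<rbrakk> \<Longrightarrow> x \<in> B"
    and "finite S" "\<And>e. e \<in> S \<Longrightarrow> c e \<in> Mg e" "finsum M c S \<in> B" "e \<in> S"
  shows "c e \<in> B"
  using assms(4-)
proof (induction S arbitrary: c e rule: finite_induct)
  case (insert e0 S)
  \<comment> \<open>These are the components of \<open>\<theta> x - e0 x\<close>; the scalar
    \<open>e - e0\<close> is written by cases because \<open>nat_scalar\<close> takes natural
    numbers.\<close>
  let ?c = "\<lambda>e. if e0 \<le> e then nat_scalar (e - e0) \<odot>\<^bsub>M\<^esub> c e else \<ominus>\<^bsub>M\<^esub> (nat_scalar (e0 - e) \<odot>\<^bsub>M\<^esub> c e)"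
  note minus = M.subgroup_a_inv[OF B(1)] and plus = subgroup.m_closed[OF B(1), simplified]
  have cl: "c e \<in> carrier M" if "e \<in> insert e0 S" for e
    using insert.prems(1)[OF that] by (rule Mg_closed)
  have c_in: "?c e \<in> Mg e" if "e \<in> S" for e
    using insert.prems(1)[of e] that subgroup
    by (auto intro!: nat_scalar_smult_subgroup M.subgroup_a_inv)
  have \<theta>c: "\<theta> (c e) = ?c e \<oplus>\<^bsub>M\<^esub> nat_scalar e0 \<odot>\<^bsub>M\<^esub> c e" if e: "e \<in> S" for e
  proof (cases "e0 \<le> e")
    case True
    then have "nat_scalar e = nat_scalar (e - e0) \<oplus>\<^bsub>R\<^esub> nat_scalar e0"
      by (simp flip: R.nat_scalar_add)
    with True show ?thesis
      using insert.prems(1)[of e] e cl[of e] by (simp add: eigen smult_l_distr)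
  next
    case False
    then have "nat_scalar e0 = nat_scalar (e0 - e) \<oplus>\<^bsub>R\<^esub> nat_scalar e"
      by (simp flip: R.nat_scalar_add)
    with False show ?thesis
      using insert.prems(1)[of e] e cl[of e] by (simp add: eigen smult_l_distr M.r_neg1)
  qed
  let ?x = "finsum M c (insert e0 S)"
  have sum: "?x = c e0 \<oplus>\<^bsub>M\<^esub> finsum M c S"
    using insert cl by (intro M.finsum_insert) auto
  have s: "finsum M c S \<in> carrier M" "finsum M ?c S \<in> carrier M"
    using cl Mg_closed[OF c_in] by (auto intro!: M.finsum_closed)
  have \<theta>sum: "\<theta> (finsum M c S) = finsum M (\<lambda>e. \<theta> (c e)) S"
    using insert(1) cl[OF insertI2]
  proof (induction S rule: finite_induct)
    case (insert i S)
    then have "finsum M c (insert i S) = c i \<oplus>\<^bsub>M\<^esub> finsum M c S"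
      "finsum M (\<lambda>e. \<theta> (c e)) (insert i S) = \<theta> (c i) \<oplus>\<^bsub>M\<^esub> finsum M (\<lambda>e. \<theta> (c e)) S"
      by (auto intro!: M.finsum_insert)
    moreover have "finsum M c S \<in> carrier M" using insert by (auto intro!: M.finsum_closed)
    ultimately show ?case using insert by simp
  qed simp
  also have "\<dots> = finsum M (\<lambda>e. ?c e \<oplus>\<^bsub>M\<^esub> nat_scalar e0 \<odot>\<^bsub>M\<^esub> c e) S"
    using \<theta>c cl by (intro M.finsum_cong') (auto intro!: M.a_closed)
  also have "\<dots> = finsum M ?c S \<oplus>\<^bsub>M\<^esub> finsum M (\<lambda>e. nat_scalar e0 \<odot>\<^bsub>M\<^esub> c e) S"
    using cl by (intro M.finsum_addf) (auto intro!: M.a_inv_closed)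
  also have "finsum M (\<lambda>e. nat_scalar e0 \<odot>\<^bsub>M\<^esub> c e) S = nat_scalar e0 \<odot>\<^bsub>M\<^esub> finsum M c S"
    using cl insert(1) by (intro finsum_smult_ldistr[symmetric]) auto
  finally have "\<theta> ?x = nat_scalar e0 \<odot>\<^bsub>M\<^esub> ?x \<oplus>\<^bsub>M\<^esub> finsum M ?c S"
    using sum s cl[of e0] insert.prems(1)[of e0] by (simp add: eigen smult_r_distr M.a_ac)
  moreover have "nat_scalar e0 \<odot>\<^bsub>M\<^esub> ?x \<in> B"
    using nat_scalar_smult_subgroup[OF B(1) insert.prems(2)] .
  moreover have "\<theta> ?x \<in> B" using B(2) insert.prems(2) by blast
  ultimately have "finsum M ?c S \<in> B"
    using plus[OF minus, of "nat_scalar e0 \<odot>\<^bsub>M\<^esub> ?x" "\<theta> ?x"] s subgroup.subset[OF B(1)]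
    by (auto simp: M.r_neg1)
  then have cB: "?c e \<in> B" if "e \<in> S" for e
    using insert.IH[of ?c] c_in that by blast
  have S: "c e \<in> B" if e: "e \<in> S" for e
  proof (cases "e0 \<le> e")
    case True
    then show ?thesis
      using tf[of "e - e0" "c e"] cB[OF e] cl[of e] e insert(2) by (cases "e = e0") auto
  next
    case False
    then have "nat_scalar (e0 - e) \<odot>\<^bsub>M\<^esub> c e \<in> B"
      using minus[OF cB[OF e]] cl[of e] e by simp
    then show ?thesis using tf[of "e0 - e" "c e"] False cl[of e] e by simp
  qed
  \<comment> \<open>The removed component is recovered by subtracting the others, now known to be in
    \<open>B\<close>, from the total.\<close>
  have "c e0 = ?x \<oplus>\<^bsub>M\<^esub> (\<ominus>\<^bsub>M\<^esub> finsum M c S)"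
    using sum s cl[of e0] by (simp add: M.a_assoc M.r_neg)
  then have "c e0 \<in> B"
    using plus[OF insert.prems(2) minus] M.subgroup_finsum[of B S c, OF B(1) S] by simp
  with S insert.prems(3) show ?case by blast
qed simp

lemma nat_scalar_cancel:
  assumes "n > 0" "x \<in> carrier M" "nat_scalar n \<odot>\<^bsub>M\<^esub> x = \<zero>\<^bsub>M\<^esub>"
  shows "x = \<zero>\<^bsub>M\<^esub>"
proof -
  obtain u where u: "u \<in> carrier R" "u \<otimes>\<^bsub>R\<^esub> nat_scalar n = \<one>\<^bsub>R\<^esub>" using invertible assms by blast
  then have "x = (u \<otimes>\<^bsub>R\<^esub> nat_scalar n) \<odot>\<^bsub>M\<^esub> x"
    using assms by simp
  also have "\<dots> = u \<odot>\<^bsub>M\<^esub> (nat_scalar n \<odot>\<^bsub>M\<^esub> x)"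
    using assms u by (intro smult_assoc1) auto
  finally show ?thesis using assms u by simp
qed

lemma unique_decomposition:
  assumes "x \<in> carrier M"
  shows "\<exists>!c. (\<forall>d. c d \<in> Mg d) \<and> finite {d. c d \<noteq> \<zero>\<^bsub>M\<^esub>} \<and> x = finsum M c {d. c d \<noteq> \<zero>\<^bsub>M\<^esub>}"
proof (rule ex_ex1I)
  show "\<exists>c. (\<forall>d. c d \<in> Mg d) \<and> finite {d. c d \<noteq> \<zero>\<^bsub>M\<^esub>} \<and> x = finsum M c {d. c d \<noteq> \<zero>\<^bsub>M\<^esub>}"
    using decomposition[OF assms] by metis
next
  fix c c'
  assume "(\<forall>d. c d \<in> Mg d) \<and> finite {d. c d \<noteq> \<zero>\<^bsub>M\<^esub>} \<and> x = finsum M c {d. c d \<noteq> \<zero>\<^bsub>M\<^esub>}"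
    "(\<forall>d. c' d \<in> Mg d) \<and> finite {d. c' d \<noteq> \<zero>\<^bsub>M\<^esub>} \<and> x = finsum M c' {d. c' d \<noteq> \<zero>\<^bsub>M\<^esub>}"
  then have c: "\<And>e. c e \<in> Mg e" "finite {e. c e \<noteq> \<zero>\<^bsub>M\<^esub>}" "x = finsum M c {e. c e \<noteq> \<zero>\<^bsub>M\<^esub>}"
    and c': "\<And>e. c' e \<in> Mg e" "finite {e. c' e \<noteq> \<zero>\<^bsub>M\<^esub>}" "x = finsum M c' {e. c' e \<noteq> \<zero>\<^bsub>M\<^esub>}"
    by blast+
  let ?S = "{e. c e \<noteq> \<zero>\<^bsub>M\<^esub>} \<union> {e. c' e \<noteq> \<zero>\<^bsub>M\<^esub>}"
  note cl = Mg_closed[OF c(1)] Mg_closed[OF c'(1)]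
  have x: "finsum M c ?S = x" "finsum M c' ?S = x"
    using finsum_support[OF c(1), of ?S] finsum_support[OF c'(1), of ?S] c(2,3) c'(2,3) by auto
  let ?D = "\<lambda>e. c e \<oplus>\<^bsub>M\<^esub> (\<ominus>\<^bsub>M\<^esub> c' e)"
  have "finsum M ?D ?S = finsum M c ?S \<oplus>\<^bsub>M\<^esub> finsum M (\<lambda>e. \<ominus>\<^bsub>M\<^esub> c' e) ?S"
    using cl by (intro M.finsum_addf) auto
  also have "finsum M (\<lambda>e. \<ominus>\<^bsub>M\<^esub> c' e) ?S = \<ominus>\<^bsub>M\<^esub> finsum M c' ?S"
    using cl c(2) c'(2) by (intro M.finsum_a_inv) auto
  finally have D0: "finsum M ?D ?S = \<zero>\<^bsub>M\<^esub>"
    using x assms by (simp add: M.r_neg)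
  have triv: "subgroup {\<zero>\<^bsub>M\<^esub>} (add_monoid M)"
    using M.add.triv_subgroup by simp
  have D: "?D e \<in> Mg e" for e
    using subgroup.m_closed[OF subgroup c(1) M.subgroup_a_inv[OF subgroup c'(1)]] by simp
  \<comment> \<open>For \<open>B = {0}\<close> membership of all components is uniqueness: the
    differences of two decompositions sum to zero, so each of them vanishes.\<close>
  have "?D e \<in> {\<zero>\<^bsub>M\<^esub>}" if "e \<in> ?S" for e
    by (rule components_mem[where S = ?S and c = ?D])
      (use that c(2) c'(2) nat_scalar_cancel D D0 triv in auto)
  then have "c e = c' e" if "e \<in> ?S" for e
    using that M.minus_equality[of "c e" "\<ominus>\<^bsub>M\<^esub> c' e", OF _ M.a_inv_closed[OF cl(2)] cl(1)]
      M.minus_minus[OF cl(2)] by (metis singletonD)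
  then have "c e = c' e" for e
    by (cases "e \<in> ?S") auto
  then show "c = c'" by (intro ext)
qed

lemma graded:
  assumes "\<And>i j r x. \<lbrakk>r \<in> Rg i; x \<in> Mg j\<rbrakk> \<Longrightarrow> r \<odot>\<^bsub>M\<^esub> x \<in> Mg (i + j)"
  shows "graded_module R Rg M Mg"
  unfolding graded_module_def
  using module_axioms subgroup unique_decomposition assms by auto

end

section \<open>Additive maps on generated subgroups\<close>

lemma hom_eq_on_generate:
  assumes "abelian_group_hom G H h" "abelian_group_hom G H h'" "S \<subseteq> carrier G"
    "\<And>s. s \<in> S \<Longrightarrow> h s = h' s" "x \<in> generate (add_monoid G) S"
  shows "h x = h' x"
proof -
  interpret h: abelian_group_hom G H h by fact
  interpret h': abelian_group_hom G H h' by fact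
  have "subgroup {x \<in> carrier G. h x = h' x} (add_monoid G)"
    by (rule h.G.add.subgroupI) (auto simp: a_inv_def[symmetric])
  with assms(3-5) h.G.generate_minimal[of "{x \<in> carrier G. h x = h' x}" S] show ?thesis by auto
qed

lemma hom_generate_subset:
  assumes "abelian_group_hom G H h" "subgroup K (add_monoid H)" "S \<subseteq> carrier G"
    "\<And>s. s \<in> S \<Longrightarrow> h s \<in> K" "x \<in> generate (add_monoid G) S"
  shows "h x \<in> K"
proof -
  interpret h: abelian_group_hom G H h by fact
  have "generate (add_monoid G) S \<subseteq> {x \<in> carrier G. h x \<in> K}"
    using h.subgroup_vimage[OF assms(2)] assms(3,4) by (intro h.G.generate_minimal) auto
  with assms(5) show ?thesis by auto
qed

lemma additive_hom_comp:
  assumes "abelian_group_hom G H h" "abelian_group_hom H K h'"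
  shows "abelian_group_hom G K (\<lambda>x. h' (h x))"
proof -
  interpret h: abelian_group_hom G H h by fact
  interpret h': abelian_group_hom H K h' by fact
  show ?thesis by (intro additive_homI) (simp_all add: h.G.abelian_group_axioms h'.H.abelian_group_axioms)
qed

lemma additive_hom_add:
  assumes "abelian_group_hom G H h" "abelian_group_hom G H h'"
  shows "abelian_group_hom G H (\<lambda>x. h x \<oplus>\<^bsub>H\<^esub> h' x)"
proof -
  interpret h: abelian_group_hom G H h by fact
  interpret h': abelian_group_hom G H h' by fact
  show ?thesis
    by (intro additive_homI) (simp_all add: h.G.abelian_group_axioms h.H.abelian_group_axioms h.H.a_ac)
qed

context module
begin

lemma smult_hom: "r \<in> carrier R \<Longrightarrow> abelian_group_hom M M (\<lambda>x. r \<odot>\<^bsub>M\<^esub> x)"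
  by (intro additive_homI) (simp_all add: M.abelian_group_axioms smult_r_distr)

lemma smult_coefficient_hom: "x \<in> carrier M \<Longrightarrow> abelian_group_hom R M (\<lambda>r. r \<odot>\<^bsub>M\<^esub> x)"
  by (intro additive_homI) (simp_all add: M.abelian_group_axioms R.abelian_group_axioms smult_l_distr)

lemma wedge_slot_hom:
  assumes "Suc (length p + length ws) = m" "set p \<subseteq> carrier M" "set ws \<subseteq> carrier M" "r \<in> carrier R"
  shows "abelian_group_hom M (E m) (\<lambda>w. r \<odot>\<^bsub>E m\<^esub> W (p @ w # ws))"
proof -
  interpret E: module R "E m" by (rule ext_module)
  interpret W: alternating M "E m" m W by (rule wedge_alternating)
  have "abelian_group_hom M (E m) (\<lambda>w. W (p @ w # ws))"
  proof (rule additive_homI)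
    fix w assume "w \<in> carrier M"
    then show "W (p @ w # ws) \<in> carrier (E m)" using assms by (intro W.closed) auto
  qed (simp_all add: M.abelian_group_axioms E.abelian_group_axioms W.additive assms)
  from additive_hom_comp[OF this E.smult_hom[OF assms(4)]] show ?thesis .
qed

text \<open>Entries are replaced by elements of \<open>G\<close> one at a time from the left: each
  slot is additive, and the scalar of a generator \<open>t g\<close> is moved into the coefficient
  \<open>r\<close>. The target \<open>H\<close> is only a subgroup, so arbitrary coefficients
  \<open>r\<close> have to be carried along.\<close>

lemma ext_span:
  assumes G: "G \<subseteq> carrier M"
    "carrier M \<subseteq> generate (add_monoid M) {r \<odot>\<^bsub>M\<^esub> g |r g. r \<in> carrier R \<and> g \<in> G}"
    and H: "subgroup H (add_monoid (E m))"
    "\<And>r ws. \<lbrakk>r \<in> carrier R; length ws = m; set ws \<subseteq> G\<rbrakk> \<Longrightarrow> r \<odot>\<^bsub>E m\<^esub> W ws \<in> H"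
    and x: "x \<in> carrier (E m)"
  shows "x \<in> H"
proof -
  interpret E: module R "E m" by (rule ext_module)
  have *: "r \<odot>\<^bsub>E m\<^esub> W (p @ ws) \<in> H"
    if "length p + length ws = m" "set p \<subseteq> G" "set ws \<subseteq> carrier M" "r \<in> carrier R" for r p ws
    using that
  proof (induction ws arbitrary: r p)
    case Nil
    then show ?case using H(2) by simp
  next
    case (Cons w ws)
    have hom: "abelian_group_hom M (E m) (\<lambda>w. r \<odot>\<^bsub>E m\<^esub> W (p @ w # ws))"
      using Cons.prems G by (intro wedge_slot_hom) auto
    show ?case
    proof (rule hom_generate_subset[OF hom H(1)])
      show "w \<in> generate (add_monoid M) {r \<odot>\<^bsub>M\<^esub> g |r g. r \<in> carrier R \<and> g \<in> G}"
        using Cons.prems G by auto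
      fix s assume "s \<in> {r \<odot>\<^bsub>M\<^esub> g |r g. r \<in> carrier R \<and> g \<in> G}"
      then obtain t g where s: "s = t \<odot>\<^bsub>M\<^esub> g" "t \<in> carrier R" "g \<in> G" by blast
      have "r \<odot>\<^bsub>E m\<^esub> W (p @ s # ws) = (r \<otimes>\<^bsub>R\<^esub> t) \<odot>\<^bsub>E m\<^esub> W ((p @ [g]) @ ws)"
      proof -
        have "W (p @ g # ws) \<in> carrier (E m)"
          using Cons.prems G s by (intro wedge_closed) auto
        moreover have "W (p @ s # ws) = t \<odot>\<^bsub>E m\<^esub> W (p @ g # ws)"
          unfolding s(1) using Cons.prems G s by (intro wedge_smult) auto
        ultimately show ?thesis
          using Cons.prems s by (simp add: E.smult_assoc1)
      qed
      also have "\<dots> \<in> H"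
        using Cons.prems s by (intro Cons.IH) auto
      finally show "r \<odot>\<^bsub>E m\<^esub> W (p @ s # ws) \<in> H" .
    qed (use G in auto)
  qed
  from x show ?thesis
  proof (induction rule: ext_induct)
    case zero
    show ?case using subgroup.one_closed[OF H(1)] by simp
  next
    case (gen r ws)
    then show ?case using *[of "[]" ws r] by simp
  next
    case (add a b)
    then show ?case using subgroup.m_closed[OF H(1)] by simp
  qed
qed

end

subsection \<open>Graded algebras with an Euler derivation\<close>

text \<open>Collects what the argument uses of the coordinate ring. The last assumption says that
  \<open>xs\<close> generates \<open>R\<close> as a \<open>k\<close>-algebra, in the form of an
  induction principle.\<close>

locale euler_algebra = differentials R k for R :: "('a, 'r) ring_scheme" (structure) and k +
  fixes Rg :: "nat \<Rightarrow> 'a set" and Eu :: "'a \<Rightarrow> 'a" and xs :: "'a list"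
  assumes Rg_subgroup: "subgroup (Rg i) (add_monoid R)"
    and Rg_mult: "\<lbrakk>a \<in> Rg i; b \<in> Rg j\<rbrakk> \<Longrightarrow> a \<otimes> b \<in> Rg (i + j)"
    and Rg_0: "Rg 0 = k"
    and Rg_span: "carrier R \<subseteq> generate (add_monoid R) (\<Union>e. Rg e)"
    and one_const: "\<one> \<in> k"
    and Eu_hom: "abelian_group_hom R R Eu"
    and Eu_mult: "\<lbrakk>f \<in> carrier R; g \<in> carrier R\<rbrakk> \<Longrightarrow> Eu (f \<otimes> g) = f \<otimes> Eu g \<oplus> g \<otimes> Eu f"
    and Eu_eigen: "f \<in> Rg e \<Longrightarrow> Eu f = nat_scalar e \<otimes> f"
    and nat_invertible: "n > 0 \<Longrightarrow> \<exists>u\<in>carrier R. u \<otimes> nat_scalar n = \<one>"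
    and vars: "set xs \<subseteq> Rg 1"
    and generated: "\<lbrakk>T \<subseteq> carrier R; k \<subseteq> T; set xs \<subseteq> T; \<And>a b. \<lbrakk>a \<in> T; b \<in> T\<rbrakk> \<Longrightarrow> a \<oplus> b \<in> T;
      \<And>a b. \<lbrakk>a \<in> T; b \<in> T\<rbrakk> \<Longrightarrow> a \<otimes> b \<in> T\<rbrakk> \<Longrightarrow> carrier R \<subseteq> T"
begin

sublocale Eu: abelian_group_hom R R Eu by (rule Eu_hom)

lemma Rg_closed: "a \<in> Rg i \<Longrightarrow> a \<in> carrier R"
  using subgroup.subset[OF Rg_subgroup] by auto

lemma Rg_UN: "(\<Union>e. Rg e) \<subseteq> carrier R"
  using Rg_closed by auto

lemma nat_scalar_Rg:
  assumes "a \<in> Rg i"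
  shows "nat_scalar n \<otimes> a \<in> Rg i"
  using Rg_closed[OF assms] subgroup.one_closed[OF Rg_subgroup] subgroup.m_closed[OF Rg_subgroup _ assms]
  by (induction n) (simp_all add: nat_scalar_Suc l_distr)

lemma d_hom: "abelian_group_hom R \<Omega> d"
  by (intro additive_homI) (simp_all add: \<Omega>.abelian_group_axioms abelian_group_axioms d_add)

abbreviation \<Omega>g where "\<Omega>g \<equiv> kaehler_deg R Rg k"

lemma kaehler_gens: "{r \<odot>\<^bsub>\<Omega>\<^esub> d f |r f i j. r \<in> Rg i \<and> f \<in> Rg j \<and> i + j = e} \<subseteq> carrier \<Omega>"
  using Rg_closed by auto

lemma \<Omega>g_subgroup: "subgroup (\<Omega>g e) (add_monoid \<Omega>)"
  unfolding kaehler_deg_def by (rule \<Omega>.generate_additive_subgroup[OF kaehler_gens])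

lemma \<Omega>g_closed: "w \<in> \<Omega>g e \<Longrightarrow> w \<in> carrier \<Omega>"
  using subgroup.subset[OF \<Omega>g_subgroup] by auto

lemma \<Omega>g_gen: "\<lbrakk>r \<in> Rg i; f \<in> Rg j\<rbrakk> \<Longrightarrow> r \<odot>\<^bsub>\<Omega>\<^esub> d f \<in> \<Omega>g (i + j)"
  unfolding kaehler_deg_def by (auto intro!: generate.incl)

lemma \<Omega>g_d: "f \<in> Rg j \<Longrightarrow> d f \<in> \<Omega>g j"
  using \<Omega>g_gen[of \<one> 0 f j] one_const Rg_closed[of f j] by (simp add: Rg_0)

lemma \<Omega>g_mult:
  assumes "r \<in> Rg i" "w \<in> \<Omega>g j"
  shows "r \<odot>\<^bsub>\<Omega>\<^esub> w \<in> \<Omega>g (i + j)"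
proof (rule hom_generate_subset[OF \<Omega>.smult_hom \<Omega>g_subgroup kaehler_gens])
  fix s assume "s \<in> {r \<odot>\<^bsub>\<Omega>\<^esub> d f |r f i l. r \<in> Rg i \<and> f \<in> Rg l \<and> i + l = j}"
  then obtain t f a b where s: "s = t \<odot>\<^bsub>\<Omega>\<^esub> d f" "t \<in> Rg a" "f \<in> Rg b" "a + b = j" by blast
  then have "r \<odot>\<^bsub>\<Omega>\<^esub> s = (r \<otimes> t) \<odot>\<^bsub>\<Omega>\<^esub> d f"
    using assms(1) Rg_closed by (simp add: \<Omega>.smult_assoc1)
  also have "\<dots> \<in> \<Omega>g (i + a + b)"
    using s assms(1) by (intro \<Omega>g_gen Rg_mult) auto
  finally show "r \<odot>\<^bsub>\<Omega>\<^esub> s \<in> \<Omega>g (i + j)" using s(4) by (simp add: add.assoc)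
qed (use assms Rg_closed in \<open>simp_all add: kaehler_deg_def\<close>)

lemma \<Omega>_span_homogeneous:
  "carrier \<Omega> \<subseteq> generate (add_monoid \<Omega>) {r \<odot>\<^bsub>\<Omega>\<^esub> w |r w. r \<in> carrier R \<and> w \<in> d ` (\<Union>e. Rg e)}"
    (is "_ \<subseteq> generate _ ?G")
proof
  have G: "?G \<subseteq> carrier \<Omega>" using Rg_closed by auto
  fix w assume "w \<in> carrier \<Omega>"
  then show "w \<in> generate (add_monoid \<Omega>) ?G"
  proof (induction rule: kaehler_induct)
    case zero
    then show ?case using generate.one[of "add_monoid \<Omega>"] by simp
  next
    case (gen r f)
    show ?case
    proof (rule hom_generate_subset[OF additive_hom_comp[OF d_hom \<Omega>.smult_hom[OF gen(1)]]
          \<Omega>.generate_additive_subgroup[OF G] Rg_UN])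
      show "f \<in> generate (add_monoid R) (\<Union>e. Rg e)" using gen Rg_span by auto
      fix s assume "s \<in> (\<Union>e. Rg e)"
      then have "r \<odot>\<^bsub>\<Omega>\<^esub> d s \<in> ?G" using gen(1) by blast
      then show "r \<odot>\<^bsub>\<Omega>\<^esub> d s \<in> generate (add_monoid \<Omega>) ?G" by (rule generate.incl)
    qed
  next
    case (add a b)
    then show ?case using generate.eng[of _ "add_monoid \<Omega>"] by simp
  qed
qed

text \<open>The elements whose differential lies in the span contain \<open>k\<close> and
  \<open>xs\<close> and are closed under sums and, by Leibniz, products; hence they are all of
  \<open>R\<close>. This bounds the number of generators by \<open>length xs\<close>.\<close>

lemma \<Omega>_span_vars:
  "carrier \<Omega> \<subseteq> generate (add_monoid \<Omega>) {r \<odot>\<^bsub>\<Omega>\<^esub> w |r w. r \<in> carrier R \<and> w \<in> d ` set xs}"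
    (is "_ \<subseteq> generate _ ?G")
proof
  let ?H = "generate (add_monoid \<Omega>) ?G"
  have x: "set xs \<subseteq> carrier R" using vars Rg_closed by auto
  then have G: "?G \<subseteq> carrier \<Omega>" by auto
  then have H: "subgroup ?H (add_monoid \<Omega>)" by (rule \<Omega>.generate_additive_subgroup)
  note Hadd = subgroup.m_closed[OF H, simplified] and Hz = subgroup.one_closed[OF H, simplified]
  have Hs: "r \<odot>\<^bsub>\<Omega>\<^esub> w \<in> ?H" if "r \<in> carrier R" "w \<in> ?H" for r w
  proof (rule hom_generate_subset[OF \<Omega>.smult_hom[OF that(1)] H G _ that(2)])
    fix s assume "s \<in> ?G"
    then obtain t v where s: "s = t \<odot>\<^bsub>\<Omega>\<^esub> v" "t \<in> carrier R" "v \<in> d ` set xs" by blast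
    then have "r \<odot>\<^bsub>\<Omega>\<^esub> s = (r \<otimes> t) \<odot>\<^bsub>\<Omega>\<^esub> v"
      using x that(1) by (subst \<Omega>.smult_assoc1) auto
    then have "r \<odot>\<^bsub>\<Omega>\<^esub> s \<in> ?G" using s that(1) by blast
    then show "r \<odot>\<^bsub>\<Omega>\<^esub> s \<in> ?H" by (rule generate.incl)
  qed
  have "carrier R \<subseteq> {f \<in> carrier R. d f \<in> ?H}"
  proof (rule generated)
    show "set xs \<subseteq> {f \<in> carrier R. d f \<in> ?H}"
    proof
      fix y assume y: "y \<in> set xs"
      then have "\<one> \<odot>\<^bsub>\<Omega>\<^esub> d y \<in> ?H" by (intro generate.incl) auto
      with x y show "y \<in> {f \<in> carrier R. d f \<in> ?H}" by auto
    qed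
  qed (use const_subset in \<open>auto simp: d_const Hz d_add d_mult Hadd Hs\<close>)
  then have d: "d f \<in> ?H" if "f \<in> carrier R" for f using that by auto
  fix w assume "w \<in> carrier \<Omega>"
  then show "w \<in> ?H"
    by (induction rule: kaehler_induct) (simp_all add: Hz Hs Hadd d)
qed

section \<open>The linear form induced by the Euler derivation\<close>

abbreviation eu where "eu \<equiv> euler_map R Rg k"

text \<open>Resolves the definite description in \<open>euler_map\<close>, whose specification
  determines the map on differentials of homogeneous elements only.\<close>

lemma euler_map_spec:
  "eu \<in> graded_hom R \<Omega> \<Omega>g (ring_module R) Rg \<and> (\<forall>f\<in>carrier R. eu (d f) = Eu f)"
proof -
  let ?P = "\<lambda>g. g \<in> extensional (carrier \<Omega>) \<and> g \<in> graded_hom R \<Omega> \<Omega>g (ring_module R) Rg \<and>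
    (\<forall>e. \<forall>f\<in>Rg e. g (d f) = [e] \<cdot> f)"
  \<comment> \<open>Both sides are additive in \<open>f\<close> and agree on homogeneous elements,
    which span \<open>R\<close>.\<close>
  have det: "g (d f) = Eu f" if g: "?P g" and f: "f \<in> carrier R" for g f
  proof (rule hom_eq_on_generate[of R R "\<lambda>f. g (d f)"])
    have "abelian_group_hom \<Omega> (ring_module R) g"
      using g by (intro module_hom_additive[OF _ kaehler_module ring_module_module]) (auto simp: graded_hom_def)
    then have "abelian_group_hom R (ring_module R) (\<lambda>f. g (d f))"
      by (rule additive_hom_comp[OF d_hom])
    then interpret a: abelian_group_hom R "ring_module R" "\<lambda>f. g (d f)" .
    show "abelian_group_hom R R (\<lambda>f. g (d f))"
      using a.hom_closed a.hom_add by (intro additive_homI) (auto simp: abelian_group_axioms)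
    show "f \<in> generate (add_monoid R) (\<Union>e. Rg e)" using f Rg_span by auto
  qed (use g Rg_closed in \<open>auto simp: Eu_hom Eu_eigen nat_scalar_mult\<close>)
  \<comment> \<open>Sending \<open>r df\<close> to \<open>r Eu f\<close> respects the relations:
    \<open>Eu\<close> is a derivation, and it kills \<open>k\<close> because constants have
    eigenvalue 0.\<close>
  have "\<exists>h. abelian_group_hom \<Omega> R h \<and> (\<forall>r\<in>carrier R. \<forall>f\<in>carrier R. h (r \<odot>\<^bsub>\<Omega>\<^esub> d f) = r \<otimes> Eu f)"
  proof (rule kaehler_lift)
    fix r c assume "r \<in> carrier R" "c \<in> k"
    then show "r \<otimes> Eu c = \<zero>"
      using Eu_eigen[of c 0] const_subset by (auto simp: Rg_0)
  qed (auto simp: abelian_group_axioms l_distr r_distr Eu_mult m_assoc)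
  then obtain h where h: "abelian_group_hom \<Omega> R h"
    and hd: "\<And>r f. \<lbrakk>r \<in> carrier R; f \<in> carrier R\<rbrakk> \<Longrightarrow> h (r \<odot>\<^bsub>\<Omega>\<^esub> d f) = r \<otimes> Eu f" by blast
  interpret h: abelian_group_hom \<Omega> R h by fact
  have lin: "h (r \<odot>\<^bsub>\<Omega>\<^esub> w) = r \<otimes> h w" if "r \<in> carrier R" "w \<in> carrier \<Omega>" for r w
    using that(2)
    by (induction rule: kaehler_induct)
      (use that(1) in \<open>simp_all add: hd \<Omega>.smult_assoc1[symmetric] m_assoc \<Omega>.smult_r_distr r_distr\<close>)
  have gr: "h w \<in> Rg e" if "w \<in> \<Omega>g e" for w e
  proof (rule hom_generate_subset[OF h Rg_subgroup kaehler_gens])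
    fix s assume "s \<in> {r \<odot>\<^bsub>\<Omega>\<^esub> d f |r f i l. r \<in> Rg i \<and> f \<in> Rg l \<and> i + l = e}"
    then show "h s \<in> Rg e"
      using Rg_closed by (auto simp: hd Eu_eigen intro!: Rg_mult nat_scalar_Rg)
  qed (use that in \<open>simp add: kaehler_deg_def\<close>)
  let ?h = "restrict h (carrier \<Omega>)"
  have "?P ?h"
    using gr \<Omega>g_closed Rg_closed hd[OF one_closed]
    by (auto simp: graded_hom_def module_hom_def lin Eu_eigen nat_scalar_mult)
  moreover have "g = ?h" if g: "?P g" for g
  proof (rule extensionalityI[of _ "carrier \<Omega>"])
    fix w assume w: "w \<in> carrier \<Omega>"
    have gl: "g \<in> module_hom R \<Omega> (ring_module R)" using g by (auto simp: graded_hom_def)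
    note gs = module_homD[OF gl, simplified]
    interpret g: abelian_group_hom \<Omega> "ring_module R" g
      by (rule module_hom_additive[OF gl kaehler_module ring_module_module])
    have "g w = h w"
      using w
    proof (induction rule: kaehler_induct)
      case zero
      then show ?case using g.hom_zero by simp
    qed (use gs det[OF g] hd in auto)
    then show "g w = ?h w" using w by simp
  qed (use g in auto)
  ultimately have "\<exists>!g. ?P g" by blast
  then have "?P eu"
    unfolding euler_map_def by (rule theI')
  with det show ?thesis by blast
qed

sublocale differentials_form R k eu
  using euler_map_spec by unfold_locales (simp add: graded_hom_def)

lemma eu_d: "f \<in> carrier R \<Longrightarrow> eu (d f) = Eu f"
  using euler_map_spec by blast

lemma eu_graded: "w \<in> \<Omega>g e \<Longrightarrow> eu w \<in> Rg e"
  using euler_map_spec by (auto simp: graded_hom_def)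

subsection \<open>Gradings of the exterior powers\<close>

abbreviation Eg where "Eg m \<equiv> ext_deg R \<Omega> \<Omega>g m"
abbreviation \<gamma> where "\<gamma> m \<equiv> contraction R \<Omega> eu m"

lemma ext_deg_gens:
  "{W ws |ws ds. length ws = m \<and> length ds = m \<and> (\<forall>i<m. ws ! i \<in> \<Omega>g (ds ! i)) \<and> sum_list ds = e}
    = {W ws |ws ds. length ws = m \<and> list_all2 (\<lambda>w e. w \<in> \<Omega>g e) ws ds \<and> sum_list ds = e}"
  by (auto simp: list_all2_conv_all_nth) metis+

lemma homogeneous_list_closed: "list_all2 (\<lambda>w e. w \<in> \<Omega>g e) ws ds \<Longrightarrow> set ws \<subseteq> carrier \<Omega>"
  by (induction rule: list_all2_induct) (auto dest: \<Omega>g_closed)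

lemma homogeneous_list_closed': "list_all2 (\<lambda>f e. f \<in> Rg e) fs ds \<Longrightarrow> set fs \<subseteq> carrier R"
  by (induction rule: list_all2_induct) (auto dest: Rg_closed)

lemma Eg_gens_closed:
  "{W ws |ws ds. length ws = m \<and> list_all2 (\<lambda>w e. w \<in> \<Omega>g e) ws ds \<and> sum_list ds = e} \<subseteq> carrier (E m)"
  using homogeneous_list_closed by (auto intro!: \<Omega>.wedge_closed)

lemma Eg_eq: "Eg m e = generate (add_monoid (E m))
    {W ws |ws ds. length ws = m \<and> list_all2 (\<lambda>w e. w \<in> \<Omega>g e) ws ds \<and> sum_list ds = e}"
  unfolding ext_deg_def ext_deg_gens ..

lemma Eg_subgroup: "subgroup (Eg m e) (add_monoid (E m))"
proof -
  interpret E: module R "E m" by (rule \<Omega>.ext_module)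
  show ?thesis unfolding Eg_eq by (rule E.generate_additive_subgroup[OF Eg_gens_closed])
qed

lemma Eg_closed: "x \<in> Eg m e \<Longrightarrow> x \<in> carrier (E m)"
  using subgroup.subset[OF Eg_subgroup] by auto

lemma Eg_gen: "\<lbrakk>length ws = m; list_all2 (\<lambda>w e. w \<in> \<Omega>g e) ws ds\<rbrakk> \<Longrightarrow> W ws \<in> Eg m (sum_list ds)"
  unfolding Eg_eq by (auto intro!: generate.incl)

text \<open>The scalar is absorbed by the first factor, which is why the exponent has to be
  positive.\<close>

lemma Eg_mult:
  assumes "r \<in> Rg i" "x \<in> Eg (Suc m) j"
  shows "r \<odot>\<^bsub>E (Suc m)\<^esub> x \<in> Eg (Suc m) (i + j)"
proof -
  interpret E: module R "E (Suc m)" by (rule \<Omega>.ext_module)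
  show ?thesis
  proof (rule hom_generate_subset[OF E.smult_hom Eg_subgroup Eg_gens_closed])
    fix s assume "s \<in> {W ws |ws ds. length ws = Suc m \<and> list_all2 (\<lambda>w e. w \<in> \<Omega>g e) ws ds \<and> sum_list ds = j}"
    then obtain w ws e ds where s: "s = W (w # ws)" "length ws = m" "w \<in> \<Omega>g e"
      "list_all2 (\<lambda>w e. w \<in> \<Omega>g e) ws ds" "e + sum_list ds = j"
      by (fastforce simp: length_Suc_conv list_all2_Cons1)
    then have "r \<odot>\<^bsub>E (Suc m)\<^esub> s = W ((r \<odot>\<^bsub>\<Omega>\<^esub> w) # ws)"
      using assms Rg_closed \<Omega>g_closed homogeneous_list_closed
        \<Omega>.wedge_smult[of "[]" ws "Suc m" r w] by simp
    also have "\<dots> \<in> Eg (Suc m) (sum_list ((i + e) # ds))"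
      using s assms by (intro Eg_gen) (auto intro!: \<Omega>g_mult)
    finally show "r \<odot>\<^bsub>E (Suc m)\<^esub> s \<in> Eg (Suc m) (i + j)" using s by (simp add: add.assoc)
  qed (use assms Rg_closed in \<open>simp_all add: Eg_eq\<close>)
qed

lemma Eg_span: "carrier (E (Suc m)) \<subseteq> generate (add_monoid (E (Suc m))) (\<Union>e. Eg (Suc m) e)"
proof
  interpret E: module R "E (Suc m)" by (rule \<Omega>.ext_module)
  let ?H = "generate (add_monoid (E (Suc m))) (\<Union>e. Eg (Suc m) e)"
  have H: "subgroup ?H (add_monoid (E (Suc m)))"
    using Eg_closed by (intro E.generate_additive_subgroup) auto
  fix x assume x: "x \<in> carrier (E (Suc m))"
  show "x \<in> ?H"
  proof (rule \<Omega>.ext_span[OF _ \<Omega>_span_homogeneous H _ x])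
    fix r ws assume r: "r \<in> carrier R" and ws: "length ws = Suc m" "set ws \<subseteq> d ` (\<Union>e. Rg e)"
    have "\<exists>ds. list_all2 (\<lambda>w e. w \<in> \<Omega>g e) ws ds"
      using ws(2)
    proof (induction ws)
      case (Cons w ws)
      then obtain ds f e where "list_all2 (\<lambda>w e. w \<in> \<Omega>g e) ws ds" "w = d f" "f \<in> Rg e" by auto
      then show ?case by (intro exI[of _ "e # ds"]) (simp add: \<Omega>g_d)
    qed (intro exI[of _ "[]"], simp)
    then obtain ds where ds: "list_all2 (\<lambda>w e. w \<in> \<Omega>g e) ws ds" ..
    have W: "W ws \<in> carrier (E (Suc m))"
      using ws homogeneous_list_closed[OF ds] by (intro \<Omega>.wedge_closed)
    show "r \<odot>\<^bsub>E (Suc m)\<^esub> W ws \<in> ?H"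
    proof (rule hom_generate_subset[OF E.smult_coefficient_hom[OF W] H Rg_UN])
      show "r \<in> generate (add_monoid R) (\<Union>e. Rg e)" using r Rg_span by auto
      fix s assume "s \<in> (\<Union>e. Rg e)"
      then obtain i where "s \<in> Rg i" by auto
      then have "s \<odot>\<^bsub>E (Suc m)\<^esub> W ws \<in> Eg (Suc m) (i + sum_list ds)"
        using ws ds by (intro Eg_mult Eg_gen)
      then show "s \<odot>\<^bsub>E (Suc m)\<^esub> W ws \<in> ?H" by (auto intro: generate.incl)
    qed
  qed (use Rg_closed in auto)
qed

text \<open>Cartan's formula speaks of homogeneous coefficients and exact homogeneous factors, while
  the grading is generated by products of arbitrary homogeneous differentials. Rewriting the latter
  as sums of the former must preserve the total degree.\<close>

lemma Eg_span_d:
  "Eg m e \<subseteq> generate (add_monoid (E m)) {r \<odot>\<^bsub>E m\<^esub> W (map d fs) |r fs i ns.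
    r \<in> Rg i \<and> length fs = m \<and> list_all2 (\<lambda>f e. f \<in> Rg e) fs ns \<and> i + sum_list ns = e}"
    (is "_ \<subseteq> generate _ (?T e)")
proof -
  interpret E: module R "E m" by (rule \<Omega>.ext_module)
  have T: "?T e \<subseteq> carrier (E m)" for e
  proof
    fix x assume "x \<in> ?T e"
    then obtain r fs i ns where x: "x = r \<odot>\<^bsub>E m\<^esub> W (map d fs)" "r \<in> Rg i" "length fs = m"
      "list_all2 (\<lambda>f e. f \<in> Rg e) fs ns" by blast
    then have "W (map d fs) \<in> carrier (E m)"
      using homogeneous_list_closed' by (intro \<Omega>.wedge_closed) fastforce+
    then show "x \<in> carrier (E m)" using x Rg_closed by simp
  qed
  have sub: "subgroup (generate (add_monoid (E m)) (?T e)) (add_monoid (E m))" for e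
    by (rule E.generate_additive_subgroup[OF T])
  \<comment> \<open>The invariant is the total degree: that of the coefficient, of the factors
    already made exact, and of those still to be treated. Replacing \<open>w\<close> by
    \<open>t df\<close> moves the degree of \<open>t\<close> into the coefficient.\<close>
  have *: "r \<odot>\<^bsub>E m\<^esub> W (map d fs @ ws) \<in> generate (add_monoid (E m)) (?T (i + sum_list ns + sum_list ds))"
    if "list_all2 (\<lambda>w e. w \<in> \<Omega>g e) ws ds" "r \<in> Rg i" "list_all2 (\<lambda>f e. f \<in> Rg e) fs ns"
      "length fs + length ws = m" for r i fs ns ws ds
    using that
  proof (induction ws ds arbitrary: r i fs ns rule: list_all2_induct)
    case Nil
    then show ?case by (auto intro!: generate.incl)
  next
    case (Cons w ws n ds)
    note fsc = homogeneous_list_closed'[OF Cons.prems(2)] and wsc = homogeneous_list_closed[OF Cons.hyps(2)]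
    have fsc': "set (map d fs) \<subseteq> carrier \<Omega>" using fsc by auto
    have "abelian_group_hom \<Omega> (E m) (\<lambda>w. r \<odot>\<^bsub>E m\<^esub> W (map d fs @ w # ws))"
      using Cons.prems fsc' wsc Rg_closed by (intro \<Omega>.wedge_slot_hom) auto
    then show ?case
    proof (rule hom_generate_subset[OF _ sub kaehler_gens])
      fix s assume "s \<in> {r \<odot>\<^bsub>\<Omega>\<^esub> d f |r f i j. r \<in> Rg i \<and> f \<in> Rg j \<and> i + j = n}"
      then obtain t f a b where s: "s = t \<odot>\<^bsub>\<Omega>\<^esub> d f" "t \<in> Rg a" "f \<in> Rg b" "a + b = n" by blast
      note cl = Rg_closed[OF s(2)] Rg_closed[OF s(3)] Rg_closed[OF Cons.prems(1)]
      have "W (map d fs @ d f # ws) \<in> carrier (E m)"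
        using Cons.prems fsc' wsc cl by (intro \<Omega>.wedge_closed) auto
      moreover have "W (map d fs @ s # ws) = t \<odot>\<^bsub>E m\<^esub> W (map d fs @ d f # ws)"
        unfolding s(1) using Cons.prems fsc' wsc cl by (intro \<Omega>.wedge_smult) auto
      ultimately have "r \<odot>\<^bsub>E m\<^esub> W (map d fs @ s # ws) = (r \<otimes> t) \<odot>\<^bsub>E m\<^esub> W (map d (fs @ [f]) @ ws)"
        using cl by (simp add: E.smult_assoc1)
      also have "\<dots> \<in> generate (add_monoid (E m)) (?T (i + a + sum_list (ns @ [b]) + sum_list ds))"
        using Cons.prems s by (intro Cons.IH Rg_mult) (auto intro!: list_all2_appendI)
      finally show "r \<odot>\<^bsub>E m\<^esub> W (map d fs @ s # ws)
          \<in> generate (add_monoid (E m)) (?T (i + sum_list ns + sum_list (n # ds)))"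
        unfolding s(4)[symmetric] by (simp add: ac_simps)
    qed (use Cons.hyps in \<open>simp add: kaehler_deg_def\<close>)
  qed
  show ?thesis
    unfolding Eg_eq
  proof (rule E.generate_minimal[OF sub], rule subsetI)
    fix x assume "x \<in> {W ws |ws ds. length ws = m \<and> list_all2 (\<lambda>w e. w \<in> \<Omega>g e) ws ds \<and> sum_list ds = e}"
    then obtain ws ds where x: "x = W ws" "length ws = m" "list_all2 (\<lambda>w e. w \<in> \<Omega>g e) ws ds" "sum_list ds = e"
      by blast
    have "\<one> \<odot>\<^bsub>E m\<^esub> W (map d [] @ ws) \<in> generate (add_monoid (E m)) (?T (0 + sum_list [] + sum_list ds))"
      using x one_const by (intro *) (auto simp: Rg_0)
    moreover have "W ws \<in> carrier (E m)"
      using x homogeneous_list_closed by (intro \<Omega>.wedge_closed) auto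
    ultimately show "x \<in> generate (add_monoid (E m)) (?T e)" using x by simp
  qed
qed

end

lemma a_kernel_iff: "x \<in> a_kernel M N h \<longleftrightarrow> x \<in> carrier M \<and> h x = \<zero>\<^bsub>N\<^esub>"
  by (simp add: a_kernel_def kernel_def)

context euler_algebra
begin

subsection \<open>The Lie derivative along the Euler field\<close>

lemma \<gamma>_hom: "abelian_group_hom (E (Suc m)) (E m) (\<gamma> (Suc m))"
  by (rule module_hom_additive[OF contraction(1) \<Omega>.ext_module \<Omega>.ext_module])

lemma \<gamma>_smult: "\<lbrakk>r \<in> carrier R; x \<in> carrier (E (Suc m))\<rbrakk> \<Longrightarrow> \<gamma> (Suc m) (r \<odot>\<^bsub>E (Suc m)\<^esub> x) = r \<odot>\<^bsub>E m\<^esub> \<gamma> (Suc m) x"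
  using module_homD(3)[OF contraction(1)] .

text \<open>The index is shifted: \<open>lie m\<close> acts on \<open>E (Suc m)\<close>, so that
  both neighbouring exterior powers exist without subtraction.\<close>

definition lie where
  "lie m x = \<gamma> (Suc (Suc m)) (ext_d (Suc m) x) \<oplus>\<^bsub>E (Suc m)\<^esub> ext_d m (\<gamma> (Suc m) x)"

lemma lie_hom: "abelian_group_hom (E (Suc m)) (E (Suc m)) (lie m)"
  unfolding lie_def
  by (intro additive_hom_add additive_hom_comp[OF ext_d_hom \<gamma>_hom] additive_hom_comp[OF \<gamma>_hom ext_d_hom])

text \<open>Both sides are additive in \<open>x\<close>, and on the generators from
  \<open>Eg_span_d\<close> the claim is Cartan's formula.\<close>

lemma lie_eigen:
  assumes "x \<in> Eg (Suc m) e"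
  shows "lie m x = nat_scalar e \<odot>\<^bsub>E (Suc m)\<^esub> x"
proof -
  interpret E: module R "E (Suc m)" by (rule \<Omega>.ext_module)
  let ?T = "{r \<odot>\<^bsub>E (Suc m)\<^esub> W (map d fs) |r fs i ns.
    r \<in> Rg i \<and> length fs = Suc m \<and> list_all2 (\<lambda>f e. f \<in> Rg e) fs ns \<and> i + sum_list ns = e}"
  have *: "lie m s = nat_scalar e \<odot>\<^bsub>E (Suc m)\<^esub> s \<and> s \<in> carrier (E (Suc m))" if "s \<in> ?T" for s
  proof -
    from that obtain r fs i ns where s: "s = r \<odot>\<^bsub>E (Suc m)\<^esub> W (map d fs)" "r \<in> Rg i" "length fs = Suc m"
      "list_all2 (\<lambda>f e. f \<in> Rg e) fs ns" "i + sum_list ns = e" by blast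
    note r = Rg_closed[OF s(2)] and fs = homogeneous_list_closed'[OF s(4)]
    have "list_all2 (\<lambda>f n. eu (d f) = nat_scalar n \<otimes> f) fs ns"
      using s(4) by (rule list_all2_mono) (simp add: eu_d Rg_closed Eu_eigen)
    with s r fs have "lie m s = nat_scalar e \<odot>\<^bsub>E (Suc m)\<^esub> s"
      unfolding lie_def s(1) s(5)[symmetric]
      by (intro cartan) (simp_all add: eu_d Eu_eigen)
    moreover have "W (map d fs) \<in> carrier (E (Suc m))"
      using s fs by (intro \<Omega>.wedge_closed) auto
    ultimately show ?thesis using s(1) r by simp
  qed
  show ?thesis
  proof (rule hom_eq_on_generate[OF lie_hom E.smult_hom[OF nat_scalar_closed], of ?T])
    show "x \<in> generate (add_monoid (E (Suc m))) ?T" using assms Eg_span_d by auto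
  qed (use * in blast)+
qed

lemma E_eigen: "eigen_graded R (E (Suc m)) (lie m) (Eg (Suc m))"
proof -
  interpret E: module R "E (Suc m)" by (rule \<Omega>.ext_module)
  show ?thesis
    by (intro eigen_graded.intro \<Omega>.ext_module eigen_graded_axioms.intro lie_hom Eg_subgroup lie_eigen
        Eg_span nat_invertible)
qed

lemma E_graded: "graded_module R Rg (E (Suc m)) (Eg (Suc m))"
  by (rule eigen_graded.graded[OF E_eigen Eg_mult])

text \<open>Each term trades a factor of degree \<open>n\<close> for the scalar \<open>eu w\<close>
  of the same degree.\<close>

lemma con_sum_graded:
  assumes "list_all2 (\<lambda>w e. w \<in> \<Omega>g e) p ns" "list_all2 (\<lambda>w e. w \<in> \<Omega>g e) ws ds"
    "length p + length ws = Suc (Suc m)"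
  shows "con_sum (Suc m) p ws \<in> Eg (Suc m) (sum_list ns + sum_list ds)"
  using assms(2,1,3)
proof (induction ws ds arbitrary: p ns rule: list_all2_induct)
  case Nil
  then show ?case using subgroup.one_closed[OF Eg_subgroup] by simp
next
  case (Cons w ws n ds)
  interpret E: module R "E (Suc m)" by (rule \<Omega>.ext_module)
  have "eu w \<odot>\<^bsub>E (Suc m)\<^esub> W (p @ ws) \<in> Eg (Suc m) (n + sum_list (ns @ ds))"
    using Cons.prems Cons.hyps by (intro Eg_mult eu_graded Eg_gen) (auto intro!: list_all2_appendI)
  moreover have "con_sum (Suc m) (p @ [w]) ws \<in> Eg (Suc m) (sum_list (ns @ [n]) + sum_list ds)"
    using Cons.prems Cons.hyps by (intro Cons.IH) (auto intro!: list_all2_appendI)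
  ultimately show ?case
    using subgroup.m_closed[OF Eg_subgroup _ E.subgroup_a_inv[OF Eg_subgroup]]
    by (simp add: ac_simps)
qed

lemma \<gamma>_graded:
  assumes "x \<in> Eg (Suc (Suc m)) e"
  shows "\<gamma> (Suc (Suc m)) x \<in> Eg (Suc m) e"
proof (rule hom_generate_subset[OF \<gamma>_hom Eg_subgroup Eg_gens_closed])
  fix s assume "s \<in> {W ws |ws ds. length ws = Suc (Suc m) \<and> list_all2 (\<lambda>w e. w \<in> \<Omega>g e) ws ds \<and> sum_list ds = e}"
  then obtain ws ds where s: "s = W ws" "length ws = Suc (Suc m)" "list_all2 (\<lambda>w e. w \<in> \<Omega>g e) ws ds" "sum_list ds = e"
    by blast
  then show "\<gamma> (Suc (Suc m)) s \<in> Eg (Suc m) e"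
    using con_sum_graded[of "[]" "[]" ws ds m] homogeneous_list_closed[OF s(3)] by (simp add: contraction(2))
qed (use assms in \<open>simp add: Eg_eq\<close>)

lemma \<gamma>_graded_hom:
  "\<gamma> (Suc (Suc m)) \<in> graded_hom R (E (Suc (Suc m))) (Eg (Suc (Suc m))) (E (Suc m)) (Eg (Suc m))"
  using contraction(1) \<gamma>_graded by (auto simp: graded_hom_def)

text \<open>On homogeneous elements both sides multiply by the degree, which \<open>\<gamma>\<close>
  preserves. This does not presuppose \<open>\<gamma> \<gamma> = 0\<close>, so that identity can be
  derived from it.\<close>

lemma \<gamma>_lie:
  assumes "x \<in> carrier (E (Suc (Suc m)))"
  shows "\<gamma> (Suc (Suc m)) (lie (Suc m) x) = lie m (\<gamma> (Suc (Suc m)) x)"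
proof (rule hom_eq_on_generate[OF additive_hom_comp[OF lie_hom \<gamma>_hom] additive_hom_comp[OF \<gamma>_hom lie_hom]])
  fix s assume "s \<in> (\<Union>e. Eg (Suc (Suc m)) e)"
  then obtain e where s: "s \<in> Eg (Suc (Suc m)) e" by blast
  then show "\<gamma> (Suc (Suc m)) (lie (Suc m) s) = lie m (\<gamma> (Suc (Suc m)) s)"
    using \<gamma>_smult[OF nat_scalar_closed Eg_closed] lie_eigen[OF \<gamma>_graded[OF s]] by (simp add: lie_eigen)
qed (use assms Eg_span Eg_closed in auto)

subsection \<open>Exactness\<close>

text \<open>Induction on \<open>m\<close>: as \<open>\<gamma>\<close> commutes with \<open>lie\<close>, \<open>\<gamma>\<gamma>h = h\<gamma>\<gamma>\<close> for the exterior
  derivative \<open>h\<close>, and the image of \<open>h\<close> generates.\<close>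

lemma \<gamma>_\<gamma>:
  "x \<in> carrier (E (Suc (Suc m))) \<Longrightarrow> \<gamma> (Suc m) (\<gamma> (Suc (Suc m)) x) = \<zero>\<^bsub>E m\<^esub>"
proof (induction m arbitrary: x)
  case 0
  interpret E0: module R "E 0" by (rule \<Omega>.ext_module)
  interpret E1: module R "E (Suc 0)" by (rule \<Omega>.ext_module)
  interpret g1: abelian_group_hom "E (Suc 0)" "E 0" "\<gamma> (Suc 0)" by (rule \<gamma>_hom)
  interpret g2: abelian_group_hom "E (Suc (Suc 0))" "E (Suc 0)" "\<gamma> (Suc (Suc 0))" by (rule \<gamma>_hom)
  have W0: "W [] \<in> carrier (E 0)" by (intro \<Omega>.wedge_closed) auto
  from 0 show ?case
  proof (induction rule: \<Omega>.ext_induct)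
    case (gen r ws)
    then obtain u v where ws: "ws = [u, v]" "u \<in> carrier \<Omega>" "v \<in> carrier \<Omega>"
      by (auto simp: length_Suc_conv)
    have W1: "W [w] \<in> carrier (E (Suc 0))" if "w \<in> carrier \<Omega>" for w
      using that by (intro \<Omega>.wedge_closed) auto
    have g1W: "\<gamma> (Suc 0) (W [w]) = eu w \<odot>\<^bsub>E 0\<^esub> W []" if "w \<in> carrier \<Omega>" for w
      using that W0 by (simp add: contraction(2))
    \<comment> \<open>The base case is computed by hand, as \<open>lie\<close> is not defined on
      \<open>E 0\<close>: the products \<open>eu u \<otimes> eu v\<close> and
      \<open>eu v \<otimes> eu u\<close> occur with opposite signs.\<close>
    have "\<gamma> (Suc (Suc 0)) (W ws) = eu u \<odot>\<^bsub>E (Suc 0)\<^esub> W [v] \<oplus>\<^bsub>E (Suc 0)\<^esub> (\<ominus>\<^bsub>E (Suc 0)\<^esub> (eu v \<odot>\<^bsub>E (Suc 0)\<^esub> W [u]))"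
      using ws W1 by (simp add: contraction(2))
    then have "\<gamma> (Suc 0) (\<gamma> (Suc (Suc 0)) (W ws)) = \<zero>\<^bsub>E 0\<^esub>"
      using ws W1 W0 by (simp add: \<gamma>_smult g1W E0.smult_assoc1[symmetric] m_comm E0.r_neg)
    then show ?case
      using gen by (simp add: \<gamma>_smult \<Omega>.wedge_closed)
  qed simp_all
next
  case (Suc m)
  interpret Em: module R "E (Suc m)" by (rule \<Omega>.ext_module)
  interpret Em2: module R "E (Suc (Suc m))" by (rule \<Omega>.ext_module)
  interpret Em3: module R "E (Suc (Suc (Suc m)))" by (rule \<Omega>.ext_module)
  interpret g2: abelian_group_hom "E (Suc (Suc m))" "E (Suc m)" "\<gamma> (Suc (Suc m))" by (rule \<gamma>_hom)
  interpret g3: abelian_group_hom "E (Suc (Suc (Suc m)))" "E (Suc (Suc m))" "\<gamma> (Suc (Suc (Suc m)))" by (rule \<gamma>_hom)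
  interpret h1: abelian_group_hom "E (Suc m)" "E (Suc (Suc m))" "ext_d (Suc m)" by (rule ext_d_hom)
  interpret h2: abelian_group_hom "E (Suc (Suc m))" "E (Suc (Suc (Suc m)))" "ext_d (Suc (Suc m))" by (rule ext_d_hom)
  interpret h0: abelian_group_hom "E m" "E (Suc m)" "ext_d m" by (rule ext_d_hom)
  have exact: "\<gamma> (Suc (Suc m)) (\<gamma> (Suc (Suc (Suc m))) (ext_d (Suc (Suc m)) y)) = \<zero>\<^bsub>E (Suc m)\<^esub>"
    if y: "y \<in> carrier (E (Suc (Suc m)))" for y
  proof -
    let ?a = "\<gamma> (Suc (Suc m)) (\<gamma> (Suc (Suc (Suc m))) (ext_d (Suc (Suc m)) y))"
    let ?b = "\<gamma> (Suc (Suc m)) (ext_d (Suc m) (\<gamma> (Suc (Suc m)) y))"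
    \<comment> \<open>\<open>?b\<close> occurs on both sides of \<open>\<gamma>_lie\<close>; the
      induction hypothesis kills the other summand of the right-hand side, so \<open>?a\<close> must
      vanish.\<close>
    have "\<gamma> (Suc (Suc m)) (lie (Suc m) y) = ?a \<oplus>\<^bsub>E (Suc m)\<^esub> ?b"
      using y by (simp add: lie_def)
    moreover have "lie m (\<gamma> (Suc (Suc m)) y) = ?b"
      using y Suc.IH[OF y] by (simp add: lie_def)
    ultimately have "?a \<oplus>\<^bsub>E (Suc m)\<^esub> ?b = ?b" using \<gamma>_lie[OF y] by simp
    then show ?thesis using y Em.M.add.r_cancel_one[of ?b ?a] by simp
  qed
  let ?H = "{x \<in> carrier (E (Suc (Suc (Suc m)))). \<gamma> (Suc (Suc m)) (\<gamma> (Suc (Suc (Suc m))) x) \<in> {\<zero>\<^bsub>E (Suc m)\<^esub>}}"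
  have "x \<in> ?H"
  proof (rule \<Omega>.ext_span[OF _ \<Omega>_span_homogeneous _ _ Suc.prems])
    show "subgroup ?H (add_monoid (E (Suc (Suc (Suc m)))))"
      using Em.M.add.triv_subgroup
      by (intro abelian_group_hom.subgroup_vimage[OF additive_hom_comp[OF \<gamma>_hom \<gamma>_hom]]) simp
  next
    fix r ws assume r: "r \<in> carrier R" and ws: "length ws = Suc (Suc (Suc m))" "set ws \<subseteq> d ` (\<Union>e. Rg e)"
    then obtain w vs where w: "ws = w # vs" "length vs = Suc (Suc m)" "w \<in> d ` (\<Union>e. Rg e)" "set vs \<subseteq> d ` (\<Union>e. Rg e)"
      by (auto simp: length_Suc_conv)
    from w(3) obtain f where f: "w = d f" "f \<in> carrier R" using Rg_closed by auto
    have "d ` (\<Union>e. Rg e) \<subseteq> d ` carrier R" using Rg_closed by auto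
    then have "vs \<in> lists (d ` carrier R)" using w(4) by auto
    then obtain fs where fs: "vs = map d fs" "set fs \<subseteq> carrier R" unfolding lists_image by auto
    \<comment> \<open>A product of exact factors \<open>df \<and> vs\<close> is the derivative of
      \<open>f vs\<close>.\<close>
    have y: "f \<odot>\<^bsub>E (Suc (Suc m))\<^esub> W vs \<in> carrier (E (Suc (Suc m)))"
      using f fs w(2) by (intro Em2.smult_closed \<Omega>.wedge_closed) auto
    have Wws: "W ws = ext_d (Suc (Suc m)) (f \<odot>\<^bsub>E (Suc (Suc m))\<^esub> W vs)"
      using w f fs by (simp add: ext_d_gen)
    then have W: "W ws \<in> carrier (E (Suc (Suc (Suc m))))" using y by simp
    have "\<gamma> (Suc (Suc m)) (\<gamma> (Suc (Suc (Suc m))) (W ws)) = \<zero>\<^bsub>E (Suc m)\<^esub>"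
      using exact[OF y] Wws by simp
    then show "r \<odot>\<^bsub>E (Suc (Suc (Suc m)))\<^esub> W ws \<in> ?H"
      using r W by (simp add: \<gamma>_smult)
  qed (use Rg_closed in auto)
  then show ?case by simp
qed

text \<open>In total degree 0 every factor \<open>df\<close> comes from \<open>f\<close> of degree
  0, that is from \<open>k\<close>, and so \<open>df = 0\<close>.\<close>

lemma Eg_0: "Eg (Suc m) 0 \<subseteq> {\<zero>\<^bsub>E (Suc m)\<^esub>}"
proof -
  interpret E: module R "E (Suc m)" by (rule \<Omega>.ext_module)
  have "{r \<odot>\<^bsub>E (Suc m)\<^esub> W (map d fs) |r fs i ns.
    r \<in> Rg i \<and> length fs = Suc m \<and> list_all2 (\<lambda>f e. f \<in> Rg e) fs ns \<and> i + sum_list ns = 0} \<subseteq> {\<zero>\<^bsub>E (Suc m)\<^esub>}"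
  proof
    fix s assume "s \<in> {r \<odot>\<^bsub>E (Suc m)\<^esub> W (map d fs) |r fs i ns.
      r \<in> Rg i \<and> length fs = Suc m \<and> list_all2 (\<lambda>f e. f \<in> Rg e) fs ns \<and> i + sum_list ns = 0}"
    then obtain r i f fs n ns where s: "s = r \<odot>\<^bsub>E (Suc m)\<^esub> W (d f # map d fs)" "r \<in> Rg i" "f \<in> Rg n"
      "length fs = m" "list_all2 (\<lambda>f e. f \<in> Rg e) fs ns" "n = 0"
      by (fastforce simp: length_Suc_conv list_all2_Cons1)
    have "d f = \<zero>\<^bsub>\<Omega>\<^esub>" using s Rg_0 by (simp add: d_const)
    moreover have "set (map d fs) \<subseteq> carrier \<Omega>" using homogeneous_list_closed'[OF s(5)] by auto
    ultimately have "W (d f # map d fs) = \<zero>\<^bsub>E (Suc m)\<^esub>"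
      using alternating.zero_slot[OF \<Omega>.wedge_alternating, of "[]" "map d fs" "Suc m"] s by simp
    then show "s \<in> {\<zero>\<^bsub>E (Suc m)\<^esub>}" using s Rg_closed by simp
  qed
  moreover have "subgroup {\<zero>\<^bsub>E (Suc m)\<^esub>} (add_monoid (E (Suc m)))"
    using E.M.add.triv_subgroup by simp
  ultimately show ?thesis
    by (intro order.trans[OF Eg_span_d E.generate_minimal])
qed

lemma ker_subset_image:
  assumes x: "x \<in> carrier (E (Suc m))" "\<gamma> (Suc m) x = \<zero>\<^bsub>E m\<^esub>"
  shows "x \<in> \<gamma> (Suc (Suc m)) ` carrier (E (Suc (Suc m)))"
proof -
  interpret E: eigen_graded R "E (Suc m)" "lie m" "Eg (Suc m)" by (rule E_eigen)
  interpret E0: module R "E m" by (rule \<Omega>.ext_module)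
  interpret E2: module R "E (Suc (Suc m))" by (rule \<Omega>.ext_module)
  interpret g1: abelian_group_hom "E (Suc m)" "E m" "\<gamma> (Suc m)" by (rule \<gamma>_hom)
  interpret g2: abelian_group_hom "E (Suc (Suc m))" "E (Suc m)" "\<gamma> (Suc (Suc m))" by (rule \<gamma>_hom)
  interpret h: abelian_group_hom "E (Suc m)" "E (Suc (Suc m))" "ext_d (Suc m)" by (rule ext_d_hom)
  interpret h0: abelian_group_hom "E m" "E (Suc m)" "ext_d m" by (rule ext_d_hom)
  let ?B = "{x \<in> carrier (E (Suc m)). \<gamma> (Suc m) x \<in> {\<zero>\<^bsub>E m\<^esub>}}"
  let ?I = "\<gamma> (Suc (Suc m)) ` carrier (E (Suc (Suc m)))"
  have B: "subgroup ?B (add_monoid (E (Suc m)))"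
    using E0.M.add.triv_subgroup by (intro g1.subgroup_vimage) simp
  have I: "subgroup ?I (add_monoid (E (Suc m)))"
    using group_hom.img_is_subgroup[OF g2.a_group_hom] by simp
  have lie: "lie m y = \<gamma> (Suc (Suc m)) (ext_d (Suc m) y)" if "y \<in> ?B" for y
    using that by (simp add: lie_def)
  obtain c where c: "\<And>e. c e \<in> Eg (Suc m) e" "finite {e. c e \<noteq> \<zero>\<^bsub>E (Suc m)\<^esub>}"
    "x = finsum (E (Suc m)) c {e. c e \<noteq> \<zero>\<^bsub>E (Suc m)\<^esub>}"
    using E.decomposition[OF x(1)] by blast
  have "c e \<in> ?I" if e: "c e \<noteq> \<zero>\<^bsub>E (Suc m)\<^esub>" for e
  proof -
    have "c e \<in> ?B"
    proof (rule E.components_mem[OF B, where S = "{e. c e \<noteq> \<zero>\<^bsub>E (Suc m)\<^esub>}"])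
      \<comment> \<open>On the kernel \<open>lie\<close> reduces to \<open>\<gamma>\<close> after
        the derivative, and \<open>\<gamma> \<gamma> = 0\<close> leads back into the kernel.\<close>
      fix y assume "y \<in> ?B"
      then show "lie m y \<in> ?B" using lie \<gamma>_\<gamma>[of "ext_d (Suc m) y" m] by simp
    next
      \<comment> \<open>By linearity of \<open>\<gamma>\<close> the kernel is closed under division
        by the invertible scalar \<open>n\<close>.\<close>
      fix n :: nat and y assume n: "n > 0" and y: "y \<in> carrier (E (Suc m))"
        and ny: "nat_scalar n \<odot>\<^bsub>E (Suc m)\<^esub> y \<in> ?B"
      obtain u where u: "u \<in> carrier R" "u \<otimes> nat_scalar n = \<one>" using nat_invertible[OF n] by blast
      have "\<gamma> (Suc m) y = (u \<otimes> nat_scalar n) \<odot>\<^bsub>E m\<^esub> \<gamma> (Suc m) y" using u y by simp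
      also have "\<dots> = u \<odot>\<^bsub>E m\<^esub> \<gamma> (Suc m) (nat_scalar n \<odot>\<^bsub>E (Suc m)\<^esub> y)"
        using u(1) y E0.smult_assoc1[OF u(1) nat_scalar_closed, of "\<gamma> (Suc m) y" n] by (simp add: \<gamma>_smult)
      finally show "y \<in> ?B" using y u ny by simp
    qed (use c x e in auto)
    then have he: "nat_scalar e \<odot>\<^bsub>E (Suc m)\<^esub> c e = \<gamma> (Suc (Suc m)) (ext_d (Suc m) (c e))"
      using lie[of "c e"] lie_eigen[OF c(1)[of e]] by simp
    have "e > 0"
      using Eg_0 c(1)[of 0] e by (cases e) auto
    then obtain u where u: "u \<in> carrier R" "u \<otimes> nat_scalar e = \<one>" using nat_invertible by blast
    note ce = Eg_closed[OF c(1)[of e]]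
    have "c e = u \<odot>\<^bsub>E (Suc m)\<^esub> \<gamma> (Suc (Suc m)) (ext_d (Suc m) (c e))"
      using E.smult_assoc1[OF u(1) nat_scalar_closed ce, of e] u(2) ce he by simp
    also have "\<dots> = \<gamma> (Suc (Suc m)) (u \<odot>\<^bsub>E (Suc (Suc m))\<^esub> ext_d (Suc m) (c e))"
      using u ce by (simp add: \<gamma>_smult)
    finally have "c e = \<gamma> (Suc (Suc m)) (u \<odot>\<^bsub>E (Suc (Suc m))\<^esub> ext_d (Suc m) (c e))" .
    moreover have "u \<odot>\<^bsub>E (Suc (Suc m))\<^esub> ext_d (Suc m) (c e) \<in> carrier (E (Suc (Suc m)))"
      using u ce by simp
    ultimately show ?thesis by (rule image_eqI)
  qed
  then show ?thesis
    unfolding c(3) by (intro E.subgroup_finsum[OF I]) auto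
qed

lemma exact:
  "\<gamma> (Suc (Suc (Suc m))) ` carrier (E (Suc (Suc (Suc m)))) = a_kernel (E (Suc (Suc m))) (E (Suc m)) (\<gamma> (Suc (Suc m)))"
  using ker_subset_image[of _ "Suc m"] \<gamma>_\<gamma>[of _ "Suc m"] abelian_group_hom.hom_closed[OF \<gamma>_hom]
  by (auto simp: a_kernel_def kernel_def)

text \<open>Pigeonhole: a product of \<open>Suc (length xs)\<close> factors taken from at most
  \<open>length xs\<close> differentials repeats one of them.\<close>

lemma ext_vanishes:
  assumes "x \<in> carrier (E (Suc (length xs)))"
  shows "x = \<zero>\<^bsub>E (Suc (length xs))\<^esub>"
proof -
  interpret E: module R "E (Suc (length xs))" by (rule \<Omega>.ext_module)
  have G: "d ` set xs \<subseteq> carrier \<Omega>" using vars Rg_closed by auto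
  have "x \<in> {\<zero>\<^bsub>E (Suc (length xs))\<^esub>}"
  proof (rule \<Omega>.ext_span[OF G \<Omega>_span_vars _ _ assms])
    show "subgroup {\<zero>\<^bsub>E (Suc (length xs))\<^esub>} (add_monoid (E (Suc (length xs))))"
      using E.M.add.triv_subgroup by simp
    fix r ws assume r: "r \<in> carrier R" and ws: "length ws = Suc (length xs)" "set ws \<subseteq> d ` set xs"
    have "card (set ws) \<le> length xs"
      using card_mono[OF _ ws(2)] card_image_le[of "set xs" d] card_length[of xs] by simp
    then have "\<not> distinct ws" using ws(1) distinct_card[of ws] by auto
    then have "W ws = \<zero>\<^bsub>E (Suc (length xs))\<^esub>"
      using ws G by (intro alternating.not_distinct[OF \<Omega>.wedge_alternating]) auto
    then show "r \<odot>\<^bsub>E (Suc (length xs))\<^esub> W ws \<in> {\<zero>\<^bsub>E (Suc (length xs))\<^esub>}" using r by simp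
  qed
  then show ?thesis by simp
qed

text \<open>Exactness already holds one step further left, where the module is zero.\<close>

lemma injective_top:
  assumes "length xs = Suc m"
  shows "a_kernel (E (Suc m)) (E m) (\<gamma> (Suc m)) = {\<zero>\<^bsub>E (Suc m)\<^esub>}"
proof -
  interpret g1: abelian_group_hom "E (Suc m)" "E m" "\<gamma> (Suc m)" by (rule \<gamma>_hom)
  interpret g2: abelian_group_hom "E (Suc (Suc m))" "E (Suc m)" "\<gamma> (Suc (Suc m))" by (rule \<gamma>_hom)
  have inj: "x = \<zero>\<^bsub>E (Suc m)\<^esub>" if x: "x \<in> carrier (E (Suc m))" "\<gamma> (Suc m) x = \<zero>\<^bsub>E m\<^esub>" for x
  proof -
    obtain y where "y \<in> carrier (E (Suc (Suc m)))" "x = \<gamma> (Suc (Suc m)) y"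
      using ker_subset_image[OF x] by blast
    moreover from this(1) have "y = \<zero>\<^bsub>E (Suc (Suc m))\<^esub>"
      using ext_vanishes[unfolded assms] by blast
    ultimately show ?thesis by (simp only: g2.hom_zero)
  qed
  show ?thesis
  proof (rule equalityI; rule subsetI)
    fix x assume "x \<in> a_kernel (E (Suc m)) (E m) (\<gamma> (Suc m))"
    then have "x = \<zero>\<^bsub>E (Suc m)\<^esub>" unfolding a_kernel_iff by (elim conjE) (rule inj)
    then show "x \<in> {\<zero>\<^bsub>E (Suc m)\<^esub>}" by (rule ssubst) (rule singletonI)
  next
    fix x assume "x \<in> {\<zero>\<^bsub>E (Suc m)\<^esub>}"
    then have "x = \<zero>\<^bsub>E (Suc m)\<^esub>" by (rule singletonD)
    then show "x \<in> a_kernel (E (Suc m)) (E m) (\<gamma> (Suc m))"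
      using g1.hom_zero g1.G.zero_closed unfolding a_kernel_iff by (metis (no_types))
  qed
qed

section \<open>The linear form on the first exterior power\<close>

abbreviation last_map where "last_map \<equiv> ext_one_map R \<Omega> eu"

lemma last_map:
  "last_map \<in> module_hom R (E (Suc 0)) (ring_module R)"
  "w \<in> carrier \<Omega> \<Longrightarrow> last_map (W [w]) = eu w"
proof -
  interpret E: module R "E (Suc 0)" by (rule \<Omega>.ext_module)
  let ?P = "\<lambda>h. h \<in> extensional (carrier (E 1)) \<and> h \<in> module_hom R (E 1) (ring_module R) \<and>
    (\<forall>w\<in>carrier \<Omega>. h (W [w]) = eu w)"
  have "\<exists>h. abelian_group_hom (E (Suc 0)) R h \<and>
    (\<forall>r\<in>carrier R. \<forall>ws. length ws = Suc 0 \<and> set ws \<subseteq> carrier \<Omega> \<longrightarrow> h (r \<odot>\<^bsub>E (Suc 0)\<^esub> W ws) = r \<otimes> eu (hd ws))"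
  proof (rule \<Omega>.ext_lift)
    fix r assume r: "r \<in> carrier R"
    \<comment> \<open>With a single entry the condition on equal neighbours is vacuous.\<close>
    show "alternating \<Omega> R (Suc 0) (\<lambda>ws. r \<otimes> eu (hd ws))"
      by unfold_locales (use r in \<open>auto simp: length_Suc_conv g_add r_distr\<close>)
  qed (auto simp: length_Suc_conv g_smult m_assoc l_distr abelian_group_axioms)
  then obtain h where h: "abelian_group_hom (E (Suc 0)) R h"
    and hW: "\<And>r w. \<lbrakk>r \<in> carrier R; w \<in> carrier \<Omega>\<rbrakk> \<Longrightarrow> h (r \<odot>\<^bsub>E (Suc 0)\<^esub> W [w]) = r \<otimes> eu w"
    by (metis (no_types, lifting) empty_set empty_subsetI insert_subset length_Cons list.sel(1) list.size(3) list.simps(15))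
  interpret h: abelian_group_hom "E (Suc 0)" R h by fact
  have W1: "W [w] \<in> carrier (E (Suc 0))" if "w \<in> carrier \<Omega>" for w
    using that by (intro \<Omega>.wedge_closed) auto
  have lin: "h (r \<odot>\<^bsub>E (Suc 0)\<^esub> x) = r \<otimes> h x" if "r \<in> carrier R" "x \<in> carrier (E (Suc 0))" for r x
    using that(2)
  proof (induction rule: \<Omega>.ext_induct)
    case (gen s ws)
    then obtain w where "ws = [w]" "w \<in> carrier \<Omega>" by (auto simp: length_Suc_conv)
    then show ?case
      using gen that W1 by (simp add: E.smult_assoc1[symmetric] hW m_assoc)
  qed (use that in \<open>simp_all add: E.smult_r_distr r_distr\<close>)
  have "?P (restrict h (carrier (E 1)))"
    using lin W1 hW[OF one_closed] by (auto simp: module_hom_def)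
  moreover have "f = f'" if "?P f" "?P f'" for f f'
    by (rule module_hom_ext_eqI[of f 1 "ring_module R" f'])
      (use that ring_module_module in \<open>auto simp: tuples_iff length_Suc_conv\<close>)
  ultimately have "\<exists>!h. ?P h" by blast
  then have "?P last_map"
    unfolding ext_one_map_def by (rule theI')
  then show "last_map \<in> module_hom R (E (Suc 0)) (ring_module R)"
    "w \<in> carrier \<Omega> \<Longrightarrow> last_map (W [w]) = eu w" by auto
qed

lemma last_map_hom: "abelian_group_hom (E (Suc 0)) (ring_module R) last_map"
  by (rule module_hom_additive[OF last_map(1) \<Omega>.ext_module ring_module_module])

text \<open>The empty tuple has no slots and hence no relations, so reading off its coefficient is
  well defined. This identifies \<open>R\<close> inside \<open>E 0\<close> and lets exactness be
  transported from the target \<open>E 0\<close> to the target \<open>R\<close>.\<close>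

lemma unit_wedge_inj:
  assumes "r \<in> carrier R" "r \<odot>\<^bsub>E 0\<^esub> W [] = \<zero>\<^bsub>E 0\<^esub>"
  shows "r = \<zero>"
proof -
  have "\<exists>h. abelian_group_hom (E 0) R h \<and>
    (\<forall>r\<in>carrier R. \<forall>ws. length ws = 0 \<and> set ws \<subseteq> carrier \<Omega> \<longrightarrow> h (r \<odot>\<^bsub>E 0\<^esub> W ws) = r)"
  proof (rule \<Omega>.ext_lift)
    fix r assume r: "r \<in> carrier R"
    show "alternating \<Omega> R 0 (\<lambda>ws. r)"
      by unfold_locales (use r in auto)
  qed (auto simp: abelian_group_axioms)
  then obtain h where h: "abelian_group_hom (E 0) R h" "h (r \<odot>\<^bsub>E 0\<^esub> W []) = r"
    using assms(1) by auto
  then show ?thesis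
    using abelian_group_hom.hom_zero[OF h(1)] assms(2) by simp
qed

text \<open>Under the identification of \<open>E 0\<close> with \<open>R\<close> the contraction of
  exponent 1 is the last map of the complex.\<close>

lemma \<gamma>_last_map:
  assumes "x \<in> carrier (E (Suc 0))"
  shows "\<gamma> (Suc 0) x = last_map x \<odot>\<^bsub>E 0\<^esub> W []"
proof -
  interpret E0: module R "E 0" by (rule \<Omega>.ext_module)
  interpret g: abelian_group_hom "E (Suc 0)" "E 0" "\<gamma> (Suc 0)" by (rule \<gamma>_hom)
  interpret l: abelian_group_hom "E (Suc 0)" "ring_module R" last_map by (rule last_map_hom)
  note l = module_homD[OF last_map(1), simplified]
  have W0: "W [] \<in> carrier (E 0)" by (intro \<Omega>.wedge_closed) auto
  show ?thesis using assms
  proof (induction rule: \<Omega>.ext_induct)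
    case zero
    then show ?case using W0 l.hom_zero by simp
  next
    case (gen r ws)
    then obtain w where w: "ws = [w]" "w \<in> carrier \<Omega>" by (auto simp: length_Suc_conv)
    have W1: "W [w] \<in> carrier (E (Suc 0))"
      using w by (intro \<Omega>.wedge_closed) auto
    show ?case
      using gen w W0 W1 by (simp add: \<gamma>_smult contraction(2) l last_map(2) E0.smult_assoc1)
  next
    case (add a b)
    then show ?case using W0 l by (simp add: E0.smult_l_distr)
  qed
qed

lemma exact_last:
  "\<gamma> (Suc (Suc 0)) ` carrier (E (Suc (Suc 0))) = {x \<in> carrier (E (Suc 0)). last_map x = \<zero>}"
proof -
  interpret E0: module R "E 0" by (rule \<Omega>.ext_module)
  have W0: "W [] \<in> carrier (E 0)" by (intro \<Omega>.wedge_closed) auto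
  have "last_map x = \<zero> \<longleftrightarrow> \<gamma> (Suc 0) x = \<zero>\<^bsub>E 0\<^esub>" if "x \<in> carrier (E (Suc 0))" for x
    unfolding \<gamma>_last_map[OF that]
  proof
    have "last_map x \<in> carrier R" using module_homD(1)[OF last_map(1) that] by simp
    then show "last_map x \<odot>\<^bsub>E 0\<^esub> W [] = \<zero>\<^bsub>E 0\<^esub> \<Longrightarrow> last_map x = \<zero>" by (rule unit_wedge_inj)
  qed (use W0 in simp)
  then show ?thesis
    using ker_subset_image[of _ 0] \<gamma>_\<gamma>[of _ 0] abelian_group_hom.hom_closed[OF \<gamma>_hom] by auto
qed

lemma last_map_graded:
  assumes "x \<in> Eg (Suc 0) e"
  shows "last_map x \<in> Rg e"
proof -
  interpret l: abelian_group_hom "E (Suc 0)" "ring_module R" last_map by (rule last_map_hom)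
  have l: "abelian_group_hom (E (Suc 0)) R last_map"
    using module_homD[OF last_map(1)] l.G.abelian_group_axioms
    by (intro additive_homI) (simp_all add: abelian_group_axioms)
  show ?thesis
  proof (rule hom_generate_subset[OF l Rg_subgroup Eg_gens_closed])
    fix s assume "s \<in> {W ws |ws ds. length ws = Suc 0 \<and> list_all2 (\<lambda>w e. w \<in> \<Omega>g e) ws ds \<and> sum_list ds = e}"
    then obtain w where "s = W [w]" "w \<in> \<Omega>g e"
      by (auto simp: length_Suc_conv list_all2_Cons1)
    then show "last_map s \<in> Rg e"
      by (simp add: last_map(2) \<Omega>g_closed eu_graded)
  qed (use assms in \<open>simp add: Eg_eq\<close>)
qed

subsection \<open>The maximal ideal\<close>

abbreviation \<mm> where "\<mm> \<equiv> Idl (set xs)"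
abbreviation max_mod where "max_mod \<equiv> (ring_module R)\<lparr>carrier := \<mm>\<rparr>"
abbreviation max_gr where "max_gr e \<equiv> \<mm> \<inter> Rg e"

lemma vars_closed: "set xs \<subseteq> carrier R"
  using vars Rg_closed by auto

lemma max_ideal: "ideal \<mm> R"
  by (rule genideal_ideal[OF vars_closed])

sublocale \<mm>: ideal \<mm> R by (rule max_ideal)

lemma max_mem: "x \<in> set xs \<Longrightarrow> x \<in> \<mm>"
  using genideal_self[OF vars_closed] by auto

lemma max_minimal:
  assumes "T \<subseteq> carrier R" "set xs \<subseteq> T" "\<zero> \<in> T" "\<And>a b. \<lbrakk>a \<in> T; b \<in> T\<rbrakk> \<Longrightarrow> a \<oplus> b \<in> T"
    "\<And>a. a \<in> T \<Longrightarrow> \<ominus> a \<in> T"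
    "\<And>r a. \<lbrakk>r \<in> carrier R; a \<in> T\<rbrakk> \<Longrightarrow> r \<otimes> a \<in> T"
  shows "\<mm> \<subseteq> T"
proof (rule genideal_minimal)
  show "ideal T R"
  proof (rule idealI)
    show "subgroup T (add_monoid R)"
      using assms by (intro add.subgroupI) (auto simp: a_inv_def[symmetric])
    show "a \<otimes> r \<in> T" if "a \<in> T" "r \<in> carrier R" for a r
      using that assms(1) assms(6)[of r a] m_comm[of r a] by auto
  qed (use assms in \<open>auto simp: ring_axioms\<close>)
qed (fact assms)

lemma max_mod_simps [simp]:
  "carrier max_mod = \<mm>" "\<zero>\<^bsub>max_mod\<^esub> = \<zero>" "x \<oplus>\<^bsub>max_mod\<^esub> y = x \<oplus> y" "r \<odot>\<^bsub>max_mod\<^esub> x = r \<otimes> x"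
  by (simp_all add: ring_module_def)

lemma max_module: "module R max_mod"
proof (rule moduleI)
  show "abelian_group max_mod"
  proof (rule abelian_groupI)
    fix x assume "x \<in> carrier max_mod"
    then show "\<exists>y\<in>carrier max_mod. y \<oplus>\<^bsub>max_mod\<^esub> x = \<zero>\<^bsub>max_mod\<^esub>"
      by (intro bexI[of _ "\<ominus> x"]) (auto simp: l_neg)
  qed (auto simp: a_ac)
qed (auto simp: is_cring l_distr r_distr m_assoc \<mm>.I_l_closed)

text \<open>Inverses in the additive monoid are defined relative to its carrier, so they first have
  to be compared between the ideal and the ring.\<close>

lemma max_subgroup_iff:
  "H \<subseteq> \<mm> \<Longrightarrow> subgroup H (add_monoid max_mod) \<longleftrightarrow> subgroup H (add_monoid R)"
proof -
  interpret mm: module R max_mod by (rule max_module)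
  assume H: "H \<subseteq> \<mm>"
  have "\<ominus>\<^bsub>max_mod\<^esub> x = \<ominus> x" if "x \<in> \<mm>" for x
    using that mm.M.minus_equality[of "\<ominus> x" x] by (simp add: l_neg)
  then have "x \<in> H \<Longrightarrow> inv\<^bsub>add_monoid max_mod\<^esub> x = inv\<^bsub>add_monoid R\<^esub> x" for x
    using H by (auto simp: a_inv_def)
  then show ?thesis
    using H \<mm>.a_subset by (auto simp: subgroup_def)
qed

lemma max_gr_subgroup: "subgroup (max_gr e) (add_monoid max_mod)"
  using \<mm>.a_subgroup Rg_subgroup add.subgroups_Inter_pair by (subst max_subgroup_iff) auto

text \<open>The span of the homogeneous elements of the ideal contains the variables and is stable
  under \<open>R\<close>: products are split into homogeneous parts in both arguments.\<close>

lemma max_span: "\<mm> \<subseteq> generate (add_monoid max_mod) (\<Union>e. max_gr e)"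
proof -
  interpret mm: module R max_mod by (rule max_module)
  let ?H = "generate (add_monoid max_mod) (\<Union>e. max_gr e)"
  have U: "(\<Union>e. max_gr e) \<subseteq> carrier max_mod" by auto
  have H: "subgroup ?H (add_monoid max_mod)" by (rule mm.generate_additive_subgroup[OF U])
  then have Hc: "?H \<subseteq> \<mm>" using subgroup.subset by fastforce
  have H': "subgroup ?H (add_monoid R)" using H Hc max_subgroup_iff by blast
  show ?thesis
  proof (rule max_minimal)
    show "set xs \<subseteq> ?H" using vars max_mem by (auto intro!: generate.incl)
    fix r a assume r: "r \<in> carrier R" and a: "a \<in> ?H"
    show "r \<otimes> a \<in> ?H"
    proof (rule hom_generate_subset[of max_mod max_mod "\<lambda>a. r \<otimes> a", OF _ H U _ a])
      show "abelian_group_hom max_mod max_mod (\<lambda>a. r \<otimes> a)"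
        using mm.smult_hom[OF r] by simp
      fix s assume "s \<in> (\<Union>e. max_gr e)"
      then obtain j where s: "s \<in> \<mm>" "s \<in> Rg j" by blast
      show "r \<otimes> s \<in> ?H"
      proof (rule hom_generate_subset[of R max_mod "\<lambda>r. r \<otimes> s", OF _ H Rg_UN])
        show "abelian_group_hom R max_mod (\<lambda>r. r \<otimes> s)"
          using mm.smult_coefficient_hom[of s] s by simp
        show "r \<in> generate (add_monoid R) (\<Union>e. Rg e)" using r Rg_span by auto
        fix t assume "t \<in> (\<Union>e. Rg e)"
        then obtain i where t: "t \<in> Rg i" by blast
        then have "t \<otimes> s \<in> max_gr (i + j)"
          using s Rg_mult Rg_closed \<mm>.I_l_closed by auto
        then show "t \<otimes> s \<in> ?H" by (auto intro: generate.incl)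
      qed
    qed
  qed (use Hc \<mm>.a_subset subgroup.one_closed[OF H'] subgroup.m_closed[OF H'] subgroup_a_inv[OF H'] in auto)
qed

lemma Eu_max: "x \<in> \<mm> \<Longrightarrow> Eu x \<in> \<mm>"
proof -
  have "\<mm> \<subseteq> {x \<in> \<mm>. Eu x \<in> \<mm>}"
  proof (rule max_minimal)
    show "set xs \<subseteq> {x \<in> \<mm>. Eu x \<in> \<mm>}"
    proof
      fix x assume x: "x \<in> set xs"
      then have "Eu x = nat_scalar 1 \<otimes> x" using vars by (intro Eu_eigen) auto
      with x show "x \<in> {x \<in> \<mm>. Eu x \<in> \<mm>}" using max_mem by (simp add: \<mm>.I_l_closed)
    qed
  qed (use \<mm>.a_subset in \<open>auto simp: Eu_mult subset_iff \<mm>.I_l_closed \<mm>.I_r_closed\<close>)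
  then show "x \<in> \<mm> \<Longrightarrow> Eu x \<in> \<mm>" by auto
qed

lemma max_graded: "graded_module R Rg max_mod max_gr"
proof -
  interpret mm: module R max_mod by (rule max_module)
  \<comment> \<open>The Euler derivation restricts to the maximal ideal and takes the role of the
    Lie derivative there.\<close>
  have "eigen_graded R max_mod Eu max_gr"
  proof (intro eigen_graded.intro max_module eigen_graded_axioms.intro max_gr_subgroup nat_invertible)
    show "abelian_group_hom max_mod max_mod Eu"
      using Eu_max by (intro additive_homI) (simp_all add: mm.M.abelian_group_axioms)
  qed (use max_span in \<open>auto simp: Eu_eigen\<close>)
  then show ?thesis
    by (rule eigen_graded.graded) (auto intro!: Rg_mult \<mm>.I_l_closed dest: Rg_closed)
qed

text \<open>A variable is hit because it has eigenvalue 1: \<open>W [d x]\<close> is sent to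
  \<open>Eu x = x\<close>. Conversely all values are combinations of elements
  \<open>Eu f\<close>.\<close>

lemma last_map_image: "last_map ` carrier (E (Suc 0)) = \<mm>"
proof
  interpret E: module R "E (Suc 0)" by (rule \<Omega>.ext_module)
  interpret l: abelian_group_hom "E (Suc 0)" "ring_module R" last_map by (rule last_map_hom)
  note l = module_homD[OF last_map(1), simplified]
  have Wc: "W [w] \<in> carrier (E (Suc 0))" if "w \<in> carrier \<Omega>" for w
    using that by (intro \<Omega>.wedge_closed) auto
  let ?I = "last_map ` carrier (E (Suc 0))"
  show "\<mm> \<subseteq> ?I"
  proof (rule max_minimal)
    show "set xs \<subseteq> ?I"
    proof
      fix x assume x: "x \<in> set xs"
      then have "x \<in> Rg 1" using vars by auto
      then have "last_map (W [d x]) = x" "d x \<in> carrier \<Omega>"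
        using Rg_closed by (auto simp: last_map(2) eu_d Eu_eigen nat_scalar_Suc)
      then show "x \<in> ?I" using Wc[of "d x"] by (metis imageI)
    qed
    show "\<zero> \<in> ?I" using l.hom_zero E.M.zero_closed by (metis imageI ring_module_simps(2))
    fix a assume "a \<in> ?I"
    then obtain y where y: "y \<in> carrier (E (Suc 0))" "a = last_map y" by blast
    have *: "r \<otimes> a \<in> ?I" if "r \<in> carrier R" for r
      using y l(3)[OF that y(1)] that by (intro image_eqI[of _ _ "r \<odot>\<^bsub>E (Suc 0)\<^esub> y"]) auto
    then show "r \<otimes> a \<in> ?I" if "r \<in> carrier R" for r using that by blast
    show "\<ominus> a \<in> ?I" using *[of "\<ominus> \<one>"] l(1)[OF y(1)] y(2) by (simp add: l_minus)
    fix b assume "b \<in> ?I"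
    then obtain z where z: "z \<in> carrier (E (Suc 0))" "b = last_map z" by blast
    then show "a \<oplus> b \<in> ?I"
      using y l(2)[OF y(1) z(1)] by (intro image_eqI[of _ _ "y \<oplus>\<^bsub>E (Suc 0)\<^esub> z"]) auto
  qed (use l(1) in auto)
  \<comment> \<open>\<open>Eu\<close> kills constants and fixes the variables, and Leibniz extends
    membership in the ideal to sums of products.\<close>
  have "carrier R \<subseteq> {f \<in> carrier R. Eu f \<in> \<mm>}"
  proof (rule generated)
    show "k \<subseteq> {f \<in> carrier R. Eu f \<in> \<mm>}"
      using const_subset Eu_eigen[of _ 0] Rg_0 by auto
    show "set xs \<subseteq> {f \<in> carrier R. Eu f \<in> \<mm>}"
      using vars_closed max_mem Eu_max by auto
  qed (auto simp: Eu_mult intro!: \<mm>.a_closed \<mm>.I_l_closed)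
  then have Eu: "Eu f \<in> \<mm>" if "f \<in> carrier R" for f using that by auto
  have eu: "eu w \<in> \<mm>" if "w \<in> carrier \<Omega>" for w
    using that
  proof (induction rule: kaehler_induct)
    case zero
    show ?case
      using abelian_group_hom.hom_zero[OF module_hom_additive[OF g kaehler_module ring_module_module]] by simp
  next
    case (gen r f)
    then show ?case by (simp add: g_smult eu_d Eu \<mm>.I_l_closed)
  next
    case (add a b)
    then show ?case by (simp add: g_add)
  qed
  have "last_map x \<in> \<mm>" if "x \<in> carrier (E (Suc 0))" for x
    using that
  proof (induction rule: \<Omega>.ext_induct)
    case zero
    then show ?case using l.hom_zero by simp
  next
    case (gen r ws)
    then obtain w where "ws = [w]" "w \<in> carrier \<Omega>" by (auto simp: length_Suc_conv)
    with gen Wc eu show ?case by (simp add: l last_map(2) \<mm>.I_l_closed)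
  next
    case (add a b)
    then show ?case by (simp add: l)
  qed
  then show "?I \<subseteq> \<mm>" by auto
qed

lemma last_map_graded_hom: "last_map \<in> graded_hom R (E (Suc 0)) (Eg (Suc 0)) max_mod max_gr"
  using module_homD[OF last_map(1), simplified] last_map_image last_map_graded Eg_closed
  by (fastforce simp: graded_hom_def module_hom_def)

theorem koszul_exact:
  assumes "length xs = Suc n"
  shows "graded_module R Rg max_mod max_gr \<and>
     (\<forall>m\<in>{1..n+1}. graded_module R Rg (E m) (Eg m)) \<and>
     (\<forall>m\<in>{2..n+1}. \<gamma> m \<in> graded_hom R (E m) (Eg m) (E (m - 1)) (Eg (m - 1))) \<and>
     last_map \<in> graded_hom R (E 1) (Eg 1) max_mod max_gr \<and>
     a_kernel (E (n + 1)) (E n) (\<gamma> (n + 1)) = {\<zero>\<^bsub>E (n + 1)\<^esub>} \<and>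
     (\<forall>m\<in>{2..n}. \<gamma> (m + 1) ` carrier (E (m + 1)) = a_kernel (E m) (E (m - 1)) (\<gamma> m)) \<and>
     \<gamma> 2 ` carrier (E 2) = a_kernel (E 1) max_mod last_map \<and>
     last_map ` carrier (E 1) = carrier max_mod"
proof (intro conjI ballI)
  fix m assume "m \<in> {1..n+1}"
  then show "graded_module R Rg (E m) (Eg m)" using E_graded[of "m - 1"] by simp
next
  fix m assume "m \<in> {2..n+1}"
  then obtain l where "m = Suc (Suc l)" by (metis Suc_le_D atLeastAtMost_iff numeral_2_eq_2 Suc_le_mono)
  then show "\<gamma> m \<in> graded_hom R (E m) (Eg m) (E (m - 1)) (Eg (m - 1))" using \<gamma>_graded_hom[of l] by simp
next
  fix m assume "m \<in> {2..n}"
  then obtain l where "m = Suc (Suc l)" by (metis Suc_le_D atLeastAtMost_iff numeral_2_eq_2 Suc_le_mono)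
  then show "\<gamma> (m + 1) ` carrier (E (m + 1)) = a_kernel (E m) (E (m - 1)) (\<gamma> m)" using exact[of l] by simp
next
  show "\<gamma> 2 ` carrier (E 2) = a_kernel (E 1) max_mod last_map"
    using exact_last by (simp add: a_kernel_def kernel_def numeral_2_eq_2)
qed (use max_graded last_map_graded_hom injective_top[OF assms] last_map_image in simp_all)

end

subsection \<open>Polynomials\<close>

lemma monom_deg_superset:
  "\<lbrakk>finite S; Poly_Mapping.keys t \<subseteq> S\<rbrakk> \<Longrightarrow> monom_deg t = (\<Sum>i\<in>S. Poly_Mapping.lookup t i)"
  unfolding monom_deg_def by (intro sum.mono_neutral_left) (auto simp: in_keys_iff)

lemma monom_deg_add: "monom_deg (s + t) = monom_deg s + monom_deg t"
proof -
  let ?S = "Poly_Mapping.keys s \<union> Poly_Mapping.keys t"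
  have "monom_deg (s + t) = (\<Sum>i\<in>?S. Poly_Mapping.lookup (s + t) i)"
    by (intro monom_deg_superset Poly_Mapping.keys_add) simp
  also have "\<dots> = monom_deg s + monom_deg t"
    by (simp add: lookup_add sum.distrib monom_deg_superset[of ?S])
  finally show ?thesis .
qed

lemma monom_deg_0_iff: "monom_deg t = 0 \<longleftrightarrow> t = 0"
  unfolding monom_deg_def by (auto simp: in_keys_iff intro!: poly_mapping_eqI)

lemma monom_deg_single [simp]: "monom_deg (Poly_Mapping.single i a) = a"
  by (cases "a = 0") (simp_all add: monom_deg_def)

text \<open>The monomials and summands stay within the keys of \<open>p\<close>, so that conditions
  on the support of \<open>p\<close>, such as membership in \<open>polys n\<close>, are available in
  every case.\<close>

lemma poly_mapping_induct [case_names zero single add]: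
  assumes "P 0"
    and "\<And>t c. \<lbrakk>t \<in> Poly_Mapping.keys p; c \<noteq> 0\<rbrakk> \<Longrightarrow> P (Poly_Mapping.single t c)"
    and "\<And>f g. \<lbrakk>Poly_Mapping.keys f \<subseteq> Poly_Mapping.keys p; Poly_Mapping.keys g \<subseteq> Poly_Mapping.keys p; P f; P g\<rbrakk>
      \<Longrightarrow> P (f + g)"
  shows "P (p :: 'a \<Rightarrow>\<^sub>0 'b::comm_monoid_add)"
proof -
  let ?m = "\<lambda>t. Poly_Mapping.single t (Poly_Mapping.lookup p t)"
  have "P (\<Sum>t\<in>A. ?m t) \<and> Poly_Mapping.keys (\<Sum>t\<in>A. ?m t) \<subseteq> Poly_Mapping.keys p"
    if "finite A" "A \<subseteq> Poly_Mapping.keys p" for A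
    using that
  proof (induction A rule: finite_induct)
    case (insert t A)
    then have t: "t \<in> Poly_Mapping.keys p" by simp
    then have m: "P (?m t)" "Poly_Mapping.keys (?m t) \<subseteq> Poly_Mapping.keys p"
      using assms(2)[of t "Poly_Mapping.lookup p t"] by (simp_all add: in_keys_iff)
    moreover have "Poly_Mapping.keys (\<Sum>t\<in>A. ?m t) \<subseteq> Poly_Mapping.keys p"
      using insert by simp
    ultimately have "Poly_Mapping.keys (?m t + (\<Sum>t\<in>A. ?m t)) \<subseteq> Poly_Mapping.keys p"
      by (intro order.trans[OF Poly_Mapping.keys_add]) simp
    then show ?case
      using assms(3)[of "?m t" "\<Sum>t\<in>A. ?m t"] m insert by simp
  qed (simp add: assms(1))
  from this[of "Poly_Mapping.keys p"] have "P (\<Sum>t\<in>Poly_Mapping.keys p. ?m t)" by simp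
  moreover have "(\<Sum>t\<in>Poly_Mapping.keys p. ?m t) = p"
    by (rule poly_mapping_eqI) (auto simp: lookup_sum lookup_single when_def in_keys_iff)
  ultimately show ?thesis by simp
qed

text \<open>This is the operator that sums \<open>X\<^sub>i\<close> times the partial derivative by
  \<open>X\<^sub>i\<close>, given by its eigenvalues on monomials.\<close>

definition euler_derivation :: "'k::field mpoly \<Rightarrow> 'k mpoly"
  where "euler_derivation p = Poly_Mapping.mapp (\<lambda>t c. of_nat (monom_deg t) * c) p"

lemma lookup_euler:
  "Poly_Mapping.lookup (euler_derivation p) t = of_nat (monom_deg t) * Poly_Mapping.lookup p t"
  by (auto simp: euler_derivation_def lookup_mapp when_def in_keys_iff)

lemma euler_add: "euler_derivation (p + q) = euler_derivation p + euler_derivation q"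
  by (rule poly_mapping_eqI) (simp add: lookup_euler lookup_add algebra_simps)

lemma euler_minus: "euler_derivation (p - q) = euler_derivation p - euler_derivation q"
  by (rule poly_mapping_eqI) (simp add: lookup_euler lookup_minus algebra_simps)

lemma euler_zero [simp]: "euler_derivation 0 = 0"
  by (rule poly_mapping_eqI) (simp add: lookup_euler)

lemma euler_single:
  "euler_derivation (Poly_Mapping.single t c) = Poly_Mapping.single t (of_nat (monom_deg t) * c)"
  by (rule poly_mapping_eqI) (simp add: lookup_euler lookup_single when_def)

text \<open>Both sides are biadditive; on monomials the rule is additivity of the degree.\<close>

lemma euler_mult: "euler_derivation (p * q) = p * euler_derivation q + q * euler_derivation p"
proof (induction p rule: poly_mapping_induct)
  case (single s a)
  show ?case
  proof (induction q rule: poly_mapping_induct)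
    case (single t b)
    show ?case
      by (simp add: mult_single euler_single monom_deg_add add.commute[of s t] flip: single_add)
        (simp add: algebra_simps)
  qed (simp_all add: euler_add algebra_simps)
qed (simp_all add: euler_add algebra_simps)

lemma keys_euler: "Poly_Mapping.keys (euler_derivation p) \<subseteq> Poly_Mapping.keys p"
  unfolding euler_derivation_def by (rule keys_mapp_subset)

lemma of_nat_times_lookup:
  "Poly_Mapping.lookup (of_nat d * (p :: 'k::field mpoly)) t = of_nat d * Poly_Mapping.lookup p t"
  by (induction d) (simp_all add: algebra_simps lookup_add)

lemma polys_simps [simp]:
  "p \<oplus>\<^bsub>polys n\<^esub> q = p + q" "p \<otimes>\<^bsub>polys n\<^esub> q = p * q" "\<zero>\<^bsub>polys n\<^esub> = 0" "\<one>\<^bsub>polys n\<^esub> = 1"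
  by (simp_all add: polys_def)

lemma polys_carrier: "p \<in> carrier (polys n) \<longleftrightarrow> (\<forall>t\<in>Poly_Mapping.keys p. Poly_Mapping.keys t \<subseteq> {0..n})"
  by (simp add: polys_def)

lemma polys_closed:
  assumes "p \<in> carrier (polys n)" "q \<in> carrier (polys n)"
  shows "p + q \<in> carrier (polys n)" "p * q \<in> carrier (polys n)" "- p \<in> carrier (polys n)"
proof -
  show "p + q \<in> carrier (polys n)"
    using assms Poly_Mapping.keys_add[of p q] unfolding polys_carrier by blast
  show "p * q \<in> carrier (polys n)"
    unfolding polys_carrier
  proof
    fix t assume "t \<in> Poly_Mapping.keys (p * q)"
    then obtain a b where "t = a + b" "a \<in> Poly_Mapping.keys p" "b \<in> Poly_Mapping.keys q"
      using keys_mult[of p q] by blast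
    then show "Poly_Mapping.keys t \<subseteq> {0..n}"
      using assms Poly_Mapping.keys_add[of a b] unfolding polys_carrier by blast
  qed
qed (use assms in \<open>simp add: polys_carrier in_keys_iff\<close>)

lemma polys_cring: "cring (polys n :: 'k::field mpoly ring)"
proof (rule cringI)
  show "abelian_group (polys n :: 'k mpoly ring)"
  proof (rule abelian_groupI)
    fix p :: "'k mpoly" assume p: "p \<in> carrier (polys n)"
    then show "\<exists>q\<in>carrier (polys n). q \<oplus>\<^bsub>polys n\<^esub> p = \<zero>\<^bsub>polys n\<^esub>"
      using polys_closed(3)[OF p p] by (intro bexI[of _ "- p"]) auto
  qed (auto simp: polys_closed ac_simps, simp add: polys_carrier)
  show "comm_monoid (polys n :: 'k mpoly ring)"
    by (rule comm_monoidI) (auto simp: polys_closed ac_simps polys_carrier[of 1])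
qed (simp add: algebra_simps)

lemma euler_closed: "p \<in> carrier (polys n) \<Longrightarrow> euler_derivation p \<in> carrier (polys n)"
  using keys_euler[of p] unfolding polys_carrier by blast

lemma homog_closed: "p \<in> homog n d \<Longrightarrow> p \<in> carrier (polys n)"
  by (simp add: homog_def)

lemma homog_single:
  "Poly_Mapping.keys t \<subseteq> {0..n} \<Longrightarrow> Poly_Mapping.single t c \<in> homog n (monom_deg t)"
  by (cases "c = 0") (auto simp: homog_def polys_carrier)

lemma homog_add: "\<lbrakk>p \<in> homog n d; q \<in> homog n d\<rbrakk> \<Longrightarrow> p + q \<in> homog n d"
  using Poly_Mapping.keys_add[of p q] polys_closed(1)[of p n q] unfolding homog_def by blast

lemma homog_uminus: "p \<in> homog n d \<Longrightarrow> - p \<in> homog n d"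
  using polys_closed(3) by (auto simp: homog_def in_keys_iff)

lemma homog_zero: "0 \<in> homog n d"
  by (simp add: homog_def polys_carrier)

lemma homog_mult:
  assumes "p \<in> homog n i" "q \<in> homog n j"
  shows "p * q \<in> homog n (i + j)"
  using assms polys_closed(2)[of p n q] keys_mult[of p q]
  by (fastforce simp: homog_def monom_deg_add)

lemma euler_homog: "p \<in> homog n d \<Longrightarrow> euler_derivation p = of_nat d * p"
  by (rule poly_mapping_eqI) (auto simp: homog_def lookup_euler of_nat_times_lookup in_keys_iff)

lemma homog_0: "homog n 0 = (range const_poly :: 'k::field mpoly set)"
proof
  show "homog n 0 \<subseteq> (range const_poly :: 'k mpoly set)"
  proof
    fix p :: "'k mpoly" assume p: "p \<in> homog n 0"
    have "p = const_poly (Poly_Mapping.lookup p 0)"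
      unfolding const_poly_def
    proof (rule poly_mapping_eqI)
      fix t show "Poly_Mapping.lookup p t
          = Poly_Mapping.lookup (Poly_Mapping.single 0 (Poly_Mapping.lookup p 0)) t"
        using p by (cases "t = 0") (auto simp: homog_def monom_deg_0_iff in_keys_iff lookup_single)
    qed
    then show "p \<in> range const_poly" by blast
  qed
  show "(range const_poly :: 'k mpoly set) \<subseteq> homog n 0"
    using homog_single[of 0 n] by (auto simp: const_poly_def monom_deg_def)
qed

lemma var_homog: "i \<le> n \<Longrightarrow> var i \<in> homog n 1"
  using homog_single[of "Poly_Mapping.single i 1" n 1] by (simp add: var_def)

lemma const_poly_closed: "const_poly c \<in> carrier (polys n)"
  using homog_0[of n] homog_closed[of "const_poly c" n 0] by auto

text \<open>Supports the induction on degree by which constants and variables generate the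
  coordinate ring.\<close>

lemma monomial_split:
  assumes "monom_deg t = Suc m"
  obtains i s where "i \<in> Poly_Mapping.keys t" "monom_deg s = m" "t = s + Poly_Mapping.single i 1"
    "Poly_Mapping.keys s \<subseteq> Poly_Mapping.keys t"
proof -
  have "t \<noteq> 0" using assms monom_deg_0_iff[of t] by auto
  then obtain i where i: "i \<in> Poly_Mapping.keys t"
    by (metis all_not_in_conv poly_mapping_eqI lookup_zero in_keys_iff)
  let ?s = "t - Poly_Mapping.single i 1"
  have "t = ?s + Poly_Mapping.single i 1"
    using i by (intro poly_mapping_eqI) (auto simp: lookup_add lookup_minus lookup_single when_def in_keys_iff)
  moreover from this have "monom_deg t = monom_deg ?s + 1"
    using monom_deg_add[of ?s "Poly_Mapping.single i 1"] by simp
  moreover have "Poly_Mapping.keys ?s \<subseteq> Poly_Mapping.keys t"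
    by (auto simp: in_keys_iff lookup_minus)
  ultimately show thesis using that[of i ?s] i assms by simp
qed

subsection \<open>Coordinate rings\<close>

locale homogeneous_ideal =
  fixes n :: nat and I :: "'k::field_char_0 mpoly set"
  assumes homog_ideal: "homog_ideal n I"
begin

abbreviation S where "S \<equiv> polys n :: 'k mpoly ring"
abbreviation \<pi> where "\<pi> p \<equiv> I +>\<^bsub>S\<^esub> p"
abbreviation RX where "RX \<equiv> coord_ring n I"

sublocale S: cring S by (rule polys_cring)

lemma ideal: "ideal I S"
proof -
  obtain A where "A \<subseteq> (\<Union>d. homog n d)" "I = Idl\<^bsub>S\<^esub> A"
    using homog_ideal unfolding homog_ideal_def by blast
  moreover from this(1) have "A \<subseteq> carrier S" by (auto dest: homog_closed)
  ultimately show ?thesis by (simp add: S.genideal_ideal)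
qed

sublocale I: ideal I S by (rule ideal)

sublocale \<pi>: ring_hom_cring S RX "(+>\<^bsub>S\<^esub>) I"
  unfolding coord_ring_def by (rule I.rcos_ring_hom_cring[OF S.is_cring])

lemma S_minus: "p \<in> carrier S \<Longrightarrow> \<ominus>\<^bsub>S\<^esub> p = - p"
  using S.minus_equality[of "- p" p] polys_closed(3)[of p n p] by simp

lemma \<pi>_eq_iff: "\<lbrakk>p \<in> carrier S; q \<in> carrier S\<rbrakk> \<Longrightarrow> \<pi> p = \<pi> q \<longleftrightarrow> p - q \<in> I"
  using S.quotient_eq_iff_same_a_r_cos[OF ideal, of p q] by (simp add: a_minus_def S_minus)

lemma RX_carrier: "carrier RX = \<pi> ` carrier S"
  by (auto simp: coord_ring_def FactRing_def A_RCOSETS_def')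

text \<open>By Leibniz the elements of \<open>I\<close> with Euler image in \<open>I\<close> form an
  ideal, and homogeneous generators belong to it since they are only multiplied by their degree.
  This is where homogeneity of \<open>I\<close> makes the derivation descend.\<close>

lemma euler_ideal: "p \<in> I \<Longrightarrow> euler_derivation p \<in> I"
proof -
  obtain A where A: "A \<subseteq> (\<Union>d. homog n d)" "I = Idl\<^bsub>S\<^esub> A"
    using homog_ideal unfolding homog_ideal_def by blast
  then have AS: "A \<subseteq> carrier S" using homog_closed by blast
  then have AI: "A \<subseteq> I" using A(2) S.genideal_self by blast
  have euler_smult: "euler_derivation (x * p) \<in> I"
    if "p \<in> I" "euler_derivation p \<in> I" "x \<in> carrier S" for x p
    using that I.I_l_closed[of p "euler_derivation x"] I.I_l_closed[of "euler_derivation p" x]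
      I.a_closed[of "x * euler_derivation p" "p * euler_derivation x"] euler_closed[of x n]
    by (simp add: euler_mult mult.commute[of "euler_derivation x" p])
  have "ideal {p \<in> I. euler_derivation p \<in> I} S"
  proof (rule idealI)
    show "subgroup {p \<in> I. euler_derivation p \<in> I} (add_monoid S)"
    proof (rule S.add.subgroupI)
      fix p assume "p \<in> {p \<in> I. euler_derivation p \<in> I}"
      then show "\<ominus>\<^bsub>S\<^esub> p \<in> {p \<in> I. euler_derivation p \<in> I}"
        using I.a_inv_closed[of p] I.a_inv_closed[of "euler_derivation p"] euler_minus[of 0 p] S_minus
        by (auto simp: euler_closed)
    next
      fix p q assume "p \<in> {p \<in> I. euler_derivation p \<in> I}" "q \<in> {p \<in> I. euler_derivation p \<in> I}"
      then show "p \<oplus>\<^bsub>S\<^esub> q \<in> {p \<in> I. euler_derivation p \<in> I}"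
        using I.a_closed[of p q] I.a_closed[of "euler_derivation p" "euler_derivation q"]
        by (simp add: euler_add)
    qed (use I.zero_closed in auto)
    fix p x assume "p \<in> {p \<in> I. euler_derivation p \<in> I}" "x \<in> carrier S"
    then show "x \<otimes>\<^bsub>S\<^esub> p \<in> {p \<in> I. euler_derivation p \<in> I}" "p \<otimes>\<^bsub>S\<^esub> x \<in> {p \<in> I. euler_derivation p \<in> I}"
      using euler_smult[of p x] I.I_l_closed[of p x] by (simp_all add: mult.commute)
  qed (rule S.ring_axioms)
  moreover have "A \<subseteq> {p \<in> I. euler_derivation p \<in> I}"
  proof
    fix p assume p: "p \<in> A"
    then obtain e where "p \<in> homog n e" using A by blast
    then have "euler_derivation p = of_nat e * p" by (rule euler_homog)
    also have "\<dots> \<in> I"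
      using I.I_l_closed[of p "of_nat e"] AI p const_poly_closed[of "of_nat e" n]
      by (auto simp: const_poly_def)
    finally show "p \<in> {p \<in> I. euler_derivation p \<in> I}" using AI p by blast
  qed
  ultimately have "I \<subseteq> {p \<in> I. euler_derivation p \<in> I}"
    unfolding A(2) by (rule S.genideal_minimal)
  then show "p \<in> I \<Longrightarrow> euler_derivation p \<in> I" by blast
qed

definition euler_RX where
  "euler_RX C = \<pi> (euler_derivation (SOME p. p \<in> carrier S \<and> \<pi> p = C))"

text \<open>Two representatives differ by an element of \<open>I\<close>, which
  \<open>euler_derivation\<close> keeps in \<open>I\<close>; the choice in \<open>euler_RX\<close>
  is therefore immaterial.\<close>

lemma euler_RX:
  assumes "p \<in> carrier S"
  shows "euler_RX (\<pi> p) = \<pi> (euler_derivation p)"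
proof -
  let ?q = "SOME q. q \<in> carrier S \<and> \<pi> q = \<pi> p"
  have q: "?q \<in> carrier S \<and> \<pi> ?q = \<pi> p"
    by (rule someI[of _ p]) (use assms in simp)
  then have "euler_derivation (?q - p) \<in> I"
    using assms \<pi>_eq_iff[of ?q p] by (intro euler_ideal) blast
  then show ?thesis
    unfolding euler_RX_def using q assms by (simp add: \<pi>_eq_iff euler_closed euler_minus)
qed

lemma \<pi>_add: "\<lbrakk>p \<in> carrier S; q \<in> carrier S\<rbrakk> \<Longrightarrow> \<pi> p \<oplus>\<^bsub>RX\<^esub> \<pi> q = \<pi> (p + q)"
  using \<pi>.hom_add[of p q] by simp

lemma \<pi>_mult: "\<lbrakk>p \<in> carrier S; q \<in> carrier S\<rbrakk> \<Longrightarrow> \<pi> p \<otimes>\<^bsub>RX\<^esub> \<pi> q = \<pi> (p * q)"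
  using \<pi>.hom_mult[of p q] by simp

lemma of_nat_closed: "of_nat m \<in> carrier S"
  using const_poly_closed[of "of_nat m" n] by (simp add: const_poly_def)

lemma RX_nat_scalar: "cring.nat_scalar RX m = \<pi> (of_nat m)"
proof (induction m)
  case 0
  then show ?case using \<pi>.hom_zero by (simp add: \<pi>.S.nat_scalar_0)
next
  case (Suc m)
  then show ?case
    using \<pi>.hom_one \<pi>.hom_add[of "of_nat m" 1] of_nat_closed[of m] of_nat_closed[of 1]
    by (simp add: \<pi>.S.nat_scalar_Suc add.commute)
qed

lemma coord_deg_subgroup: "subgroup (coord_deg n I d) (add_monoid RX)"
proof (rule \<pi>.S.add.subgroupI)
  fix a assume "a \<in> coord_deg n I d"
  then obtain p where p: "p \<in> homog n d" "a = \<pi> p" by (auto simp: coord_deg_def)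
  then have "\<ominus>\<^bsub>RX\<^esub> a = \<pi> (- p)"
    using \<pi>.hom_a_inv[of p] homog_closed[OF p(1)] by (simp add: S_minus)
  then show "\<ominus>\<^bsub>RX\<^esub> a \<in> coord_deg n I d"
    using homog_uminus[OF p(1)] by (auto simp: coord_deg_def)
next
  fix a b assume ab: "a \<in> coord_deg n I d" "b \<in> coord_deg n I d"
  show "a \<oplus>\<^bsub>RX\<^esub> b \<in> coord_deg n I d"
  proof -
    obtain p q where "p \<in> homog n d" "a = \<pi> p" "q \<in> homog n d" "b = \<pi> q"
      using ab by (auto simp: coord_deg_def)
    then show ?thesis
      unfolding coord_deg_def
      by (intro image_eqI[of _ _ "p + q"]) (simp_all add: \<pi>_add homog_closed homog_add)
  qed
qed (use homog_zero[of n d] in \<open>auto simp: coord_deg_def dest: homog_closed\<close>)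

lemma coord_span: "carrier RX \<subseteq> generate (add_monoid RX) (\<Union>d. coord_deg n I d)"
proof
  let ?H = "generate (add_monoid RX) (\<Union>d. coord_deg n I d)"
  fix x assume "x \<in> carrier RX"
  then obtain p where p: "p \<in> carrier S" "x = \<pi> p" by (auto simp: RX_carrier)
  have "p \<in> carrier S \<longrightarrow> \<pi> p \<in> ?H"
  proof (induction p rule: poly_mapping_induct)
    case zero
    show ?case using generate.one[of "add_monoid RX"] \<pi>.hom_zero by simp
  next
    case (single t c)
    then have "Poly_Mapping.keys t \<subseteq> {0..n}" using p(1) by (auto simp: polys_carrier)
    then show ?case using homog_single[of t n c] by (auto simp: coord_deg_def intro!: generate.incl)
  next
    case (add f g)
    then have "f \<in> carrier S" "g \<in> carrier S" using p(1) by (auto simp: polys_carrier)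
    with add show ?case using generate.eng[of "\<pi> f" "add_monoid RX" _ "\<pi> g"] by (simp add: \<pi>_add)
  qed
  with p show "x \<in> ?H" by simp
qed

lemma coord_generated:
  assumes "T \<subseteq> carrier RX" "coord_consts n I \<subseteq> T" "\<And>i. i \<le> n \<Longrightarrow> \<pi> (var i) \<in> T"
    and add: "\<And>a b. \<lbrakk>a \<in> T; b \<in> T\<rbrakk> \<Longrightarrow> a \<oplus>\<^bsub>RX\<^esub> b \<in> T"
    and mult: "\<And>a b. \<lbrakk>a \<in> T; b \<in> T\<rbrakk> \<Longrightarrow> a \<otimes>\<^bsub>RX\<^esub> b \<in> T"
  shows "carrier RX \<subseteq> T"
proof
  have const: "\<pi> (const_poly c) \<in> T" for c using assms(2) by (auto simp: coord_consts_def)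
  have monom: "\<pi> (Poly_Mapping.single t c) \<in> T" if "Poly_Mapping.keys t \<subseteq> {0..n}" for t c
    using that
  proof (induction "monom_deg t" arbitrary: t)
    case 0
    then show ?case using const[of c] by (simp add: monom_deg_0_iff const_poly_def)
  next
    case (Suc m)
    then obtain i s where s: "i \<in> Poly_Mapping.keys t" "monom_deg s = m" "t = s + Poly_Mapping.single i 1"
      "Poly_Mapping.keys s \<subseteq> Poly_Mapping.keys t" by (metis monomial_split)
    then have "\<pi> (Poly_Mapping.single s c) \<in> T" "i \<le> n" using Suc by auto
    moreover have "Poly_Mapping.single t c = Poly_Mapping.single s c * var i"
      using s(3) by (simp add: var_def mult_single)
    moreover have "Poly_Mapping.single s c \<in> carrier S"
      using homog_closed[OF homog_single] s Suc.prems by blast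
    moreover have "var i \<in> carrier S" using homog_closed[OF var_homog] \<open>i \<le> n\<close> by blast
    ultimately show ?case using mult[of "\<pi> (Poly_Mapping.single s c)" "\<pi> (var i)"] assms(3) by (simp add: \<pi>_mult)
  qed
  fix x assume "x \<in> carrier RX"
  then obtain p where p: "p \<in> carrier S" "x = \<pi> p" by (auto simp: RX_carrier)
  have "p \<in> carrier S \<longrightarrow> \<pi> p \<in> T"
  proof (induction p rule: poly_mapping_induct)
    case zero
    show ?case using const[of 0] by (simp add: const_poly_def)
  next
    case (single t c)
    then show ?case using p(1) monom by (auto simp: polys_carrier)
  next
    case (add f g)
    then have "f \<in> carrier S" "g \<in> carrier S" using p(1) by (auto simp: polys_carrier)
    with add show ?case using assms(4)[of "\<pi> f" "\<pi> g"] by (simp add: \<pi>_add)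
  qed
  with p show "x \<in> T" by simp
qed

lemma coord_euler_algebra:
  "euler_algebra RX (coord_consts n I) (coord_deg n I) euler_RX (map (\<lambda>i. \<pi> (var i)) [0..<Suc n])"
proof (intro euler_algebra.intro differentials.intro \<pi>.S.is_cring differentials_axioms.intro
    euler_algebra_axioms.intro coord_deg_subgroup coord_span)
  have RXE: "\<exists>p\<in>carrier S. a = \<pi> p" if "a \<in> carrier RX" for a
    using that by (auto simp: RX_carrier)
  show "coord_consts n I \<subseteq> carrier RX"
    using const_poly_closed by (auto simp: coord_consts_def RX_carrier)
  show "coord_deg n I 0 = coord_consts n I"
    by (simp add: coord_deg_def coord_consts_def homog_0 image_image)
  show "a \<otimes>\<^bsub>RX\<^esub> b \<in> coord_deg n I (i + j)" if ab: "a \<in> coord_deg n I i" "b \<in> coord_deg n I j" for a b i j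
  proof -
    obtain p q where "p \<in> homog n i" "a = \<pi> p" "q \<in> homog n j" "b = \<pi> q"
      using ab by (auto simp: coord_deg_def)
    then show ?thesis
      unfolding coord_deg_def
      by (intro image_eqI[of _ _ "p * q"]) (simp_all add: \<pi>_mult homog_closed homog_mult)
  qed
  have "\<pi> (const_poly 1) = \<one>\<^bsub>RX\<^esub>" using \<pi>.hom_one by (simp add: const_poly_def)
  then show "\<one>\<^bsub>RX\<^esub> \<in> coord_consts n I" unfolding coord_consts_def by (metis rangeI)
  show "abelian_group_hom RX RX euler_RX"
  proof (rule additive_homI)
    fix a b assume "a \<in> carrier RX" "b \<in> carrier RX"
    then obtain p q where "p \<in> carrier S" "q \<in> carrier S" "a = \<pi> p" "b = \<pi> q" using RXE by metis
    then show "euler_RX (a \<oplus>\<^bsub>RX\<^esub> b) = euler_RX a \<oplus>\<^bsub>RX\<^esub> euler_RX b"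
      by (simp add: \<pi>_add euler_RX polys_closed euler_add euler_closed)
  next
    fix a assume "a \<in> carrier RX"
    then obtain p where "p \<in> carrier S" "a = \<pi> p" using RXE by metis
    then show "euler_RX a \<in> carrier RX" by (simp add: euler_RX euler_closed)
  qed (rule \<pi>.S.abelian_group_axioms)+
  show "euler_RX (a \<otimes>\<^bsub>RX\<^esub> b) = a \<otimes>\<^bsub>RX\<^esub> euler_RX b \<oplus>\<^bsub>RX\<^esub> b \<otimes>\<^bsub>RX\<^esub> euler_RX a"
    if ab: "a \<in> carrier RX" "b \<in> carrier RX" for a b
  proof -
    obtain p q where "p \<in> carrier S" "q \<in> carrier S" "a = \<pi> p" "b = \<pi> q" using ab RXE by metis
    then show ?thesis
      by (simp add: \<pi>_add \<pi>_mult euler_RX polys_closed euler_mult euler_closed)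
  qed
  show "euler_RX a = cring.nat_scalar RX e \<otimes>\<^bsub>RX\<^esub> a" if a: "a \<in> coord_deg n I e" for a e
  proof -
    obtain p where "p \<in> homog n e" "a = \<pi> p" using a by (auto simp: coord_deg_def)
    then show ?thesis
      by (simp add: RX_nat_scalar \<pi>_mult of_nat_closed euler_RX euler_homog homog_closed)
  qed
  \<comment> \<open>Characteristic zero enters here: the inverse of \<open>m\<close> is the class of
    the constant \<open>1 / m\<close>.\<close>
  show "\<exists>u\<in>carrier RX. u \<otimes>\<^bsub>RX\<^esub> cring.nat_scalar RX m = \<one>\<^bsub>RX\<^esub>" if "m > 0" for m
  proof (rule bexI)
    have "const_poly (1 / of_nat m) * Poly_Mapping.single 0 (of_nat m) = (1 :: 'k mpoly)"
      unfolding const_poly_def using that by (simp add: mult_single del: single_of_nat)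
    then have "const_poly (1 / of_nat m) * of_nat m = (1 :: 'k mpoly)"
      by simp
    then show "\<pi> (const_poly (1 / of_nat m)) \<otimes>\<^bsub>RX\<^esub> cring.nat_scalar RX m = \<one>\<^bsub>RX\<^esub>"
      using \<pi>.hom_one by (simp add: RX_nat_scalar \<pi>_mult const_poly_closed of_nat_closed)
  qed (simp add: const_poly_closed)
  show "set (map (\<lambda>i. \<pi> (var i)) [0..<Suc n]) \<subseteq> coord_deg n I 1"
    using var_homog by (auto simp: coord_deg_def less_Suc_eq_le)
  show "carrier RX \<subseteq> T" if "T \<subseteq> carrier RX" "coord_consts n I \<subseteq> T" "set (map (\<lambda>i. \<pi> (var i)) [0..<Suc n]) \<subseteq> T"
    "\<And>a b. \<lbrakk>a \<in> T; b \<in> T\<rbrakk> \<Longrightarrow> a \<oplus>\<^bsub>RX\<^esub> b \<in> T" "\<And>a b. \<lbrakk>a \<in> T; b \<in> T\<rbrakk> \<Longrightarrow> a \<otimes>\<^bsub>RX\<^esub> b \<in> T" for T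
    using that by (intro coord_generated) (auto simp: image_subset_iff less_Suc_eq_le)
qed

end

theorem proposition2p4:
  fixes n :: nat and I :: "'k::field_char_0 mpoly set"
  assumes "n \<ge> 1"
    and "zero_dim_subscheme n I"
  shows
    "graded_module (coord_ring n I) (coord_deg n I) (max_module n I) (max_deg n I) \<and>
     (\<forall>m\<in>{1..n+1}. graded_module (coord_ring n I) (coord_deg n I) (Omega n I m) (Omega_deg n I m)) \<and>
     (\<forall>m\<in>{2..n+1}. koszul n I m \<in> graded_hom (coord_ring n I)
        (Omega n I m) (Omega_deg n I m) (Omega n I (m - 1)) (Omega_deg n I (m - 1))) \<and>
     koszul_last n I \<in> graded_hom (coord_ring n I)
        (Omega n I 1) (Omega_deg n I 1) (max_module n I) (max_deg n I) \<and>
     a_kernel (Omega n I (n + 1)) (Omega n I n) (koszul n I (n + 1)) = {\<zero>\<^bsub>Omega n I (n + 1)\<^esub>} \<and>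
     (\<forall>m\<in>{2..n}. koszul n I (m + 1) ` carrier (Omega n I (m + 1)) =
        a_kernel (Omega n I m) (Omega n I (m - 1)) (koszul n I m)) \<and>
     koszul n I 2 ` carrier (Omega n I 2) =
        a_kernel (Omega n I 1) (max_module n I) (koszul_last n I) \<and>
     koszul_last n I ` carrier (Omega n I 1) = carrier (max_module n I)"
proof -
  interpret homogeneous_ideal n I
    using assms(2) by unfold_locales (simp add: zero_dim_subscheme_def)
  \<comment> \<open>There are \<open>n + 1\<close> variables, so the general result places the
    injective end of the complex at exponent \<open>n + 1\<close>.\<close>
  let ?xs = "map (\<lambda>i. \<pi> (var i)) [0..<Suc n]"
  have xs: "set ?xs = (\<lambda>i. \<pi> (var i)) ` {0..n}" "length ?xs = Suc n"
    by (simp_all only: set_map set_upt atLeastLessThanSuc_atLeastAtMost length_map length_upt diff_zero)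
  have "max_deg n I = (\<lambda>e. Idl\<^bsub>coord_ring n I\<^esub> (set ?xs) \<inter> coord_deg n I e)"
    unfolding xs(1) by (intro ext) (simp add: max_deg_def max_ideal_def)
  moreover have "max_module n I = (ring_module (coord_ring n I))\<lparr>carrier := Idl\<^bsub>coord_ring n I\<^esub> (set ?xs)\<rparr>"
    unfolding xs(1) by (simp add: max_module_def max_ideal_def)
  ultimately show ?thesis
    unfolding Omega_def Omega_deg_def koszul_def koszul_last_def
    using euler_algebra.koszul_exact[OF coord_euler_algebra xs(2)] by simp
qed

end
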